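(* Let $\Gamma$ be a group. Then $\Gamma$ is (isomorphic to) a cocompact discrete reflection group of some geodesic space $X$ if and only if $\Gamma$ is a Coxeter group.
   Context: A metric space $(X,d)$ is a geodesic space if for all $x,y\in X$ there is an isometric embedding $\xi:[0,d(x,y)]\to X$ with $\xi(0)=x$ and $\xi(d(x,y))=y$ (such $\xi$ is called a geodesic). A subset $A\subset X$ is convex if every geodesic of $X$ joining two points of $A$ is contained in $A$. An isometry $r$ of a geodesic space $X$ is a reflection of $X$ if $r^2=\mathrm{id}_X$, the set $X\setminus F_r$ has exactly two connected components, both convex, and $\operatorname{Int}F_r=\emptyset$, where $F_r=\{x\in X: rx=x\}$ is the wall of $r$; moreover $r$ interchanges the two components of $X\setminus F_r$. A group $\Gamma$ of isometries of $X$ is a reflection group of $X$ if it is generated by some set of reflections of $X$. Let $R$ be the set of all reflections of $X$ lying in $\Gamma$. The action of $\Gamma$ on $X$ is proper if $\{\gamma\in\Gamma:\gamma x\in B(x,N)\}$ is finite for all $x\in X$ and $N>0$, where $B(x,N)$ is the ball of radius $N$ about $x$. When $\Gamma$ acts properly, a chamber is a connected component $C$ of $X\setminus\bigcup_{r\in R}F_r$. A group $\Gamma$ is a cocompact discrete reflection group of a geodesic space $X$ if (1) $\Gamma$ is a reflection group of $X$; (2) the action of $\Gamma$ on $X$ is proper; (3) for a chamber $C$, the closure $\overline{C}$ is compact; and (4) $\{\gamma\in\Gamma: C=\gamma C\}=\{1\}$. A Coxeter group is a group $W$ having a presentation $\langle S\mid (st)^{m(s,t)}=1 \text{ for } s,t\in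 S\rangle$, where $S$ is a finite set and $m:S\times S\to\mathbb{N}\cup\{\infty\}$ satisfies $m(s,t)=m(t,s)$ for all $s,t\in S$, $m(s,s)=1$ for all $s\in S$, and $m(s,t)\ge 2$ for all $s\ne t$ in $S$ (no relation is imposed when $m(s,t)=\infty$). *)

theory Defs
  imports
    "HOL-Analysis.Abstract_Metric_Spaces"
    "HOL-Library.Extended_Nat"
    "HOL-Algebra.Bij"
    "HOL-Algebra.Generated_Groups"
begin

section \<open>Reflection groups of geodesic spaces\<close>

context Metric_space
begin

text \<open>A path is a function on all reals of which only the values on the interval from
  \<open>0\<close> to \<open>d x y\<close> matter.\<close>

definition geodesic :: "'a \<Rightarrow> 'a \<Rightarrow> (real \<Rightarrow> 'a) \<Rightarrow> bool" where
  "geodesic x y \<xi> \<longleftrightarrow>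
     \<xi> \<in> {0..d x y} \<rightarrow> M \<and>
     (\<forall>s\<in>{0..d x y}. \<forall>t\<in>{0..d x y}. d (\<xi> s) (\<xi> t) = \<bar>s - t\<bar>) \<and>
     \<xi> 0 = x \<and> \<xi> (d x y) = y"

definition geodesic_space :: bool where
  "geodesic_space \<longleftrightarrow> (\<forall>x\<in>M. \<forall>y\<in>M. \<exists>\<xi>. geodesic x y \<xi>)"

definition geodesically_convex :: "'a set \<Rightarrow> bool" where
  "geodesically_convex A \<longleftrightarrow>
     A \<subseteq> M \<and> (\<forall>x\<in>A. \<forall>y\<in>A. \<forall>\<xi>. geodesic x y \<xi> \<longrightarrow> \<xi> ` {0..d x y} \<subseteq> A)"

text \<open>Isometries of the space onto itself, taken extensional as in \<^const>\<open>Bij\<close>, so that they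
  form a subgroup of \<^term>\<open>BijGroup M\<close>.\<close>

definition isometries :: "('a \<Rightarrow> 'a) set" where
  "isometries = {f \<in> Bij M. \<forall>x\<in>M. \<forall>y\<in>M. d (f x) (f y) = d x y}"

definition wall :: "('a \<Rightarrow> 'a) \<Rightarrow> 'a set" where
  "wall r = {x \<in> M. r x = x}"

definition reflection :: "('a \<Rightarrow> 'a) \<Rightarrow> bool" where
  "reflection r \<longleftrightarrow>
     r \<in> isometries \<and>
     (\<forall>x\<in>M. r (r x) = x) \<and>
     (\<exists>A B. A \<noteq> B \<and>
        connected_components_of (subtopology mtopology (M - wall r)) = {A, B} \<and>
        geodesically_convex A \<and> geodesically_convex B \<and>
        r ` A = B \<and> r ` B = A) \<and>
     mtopology interior_of (wall r) = {}"

definition isometry_group :: "('a \<Rightarrow> 'a) set \<Rightarrow> bool" where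
  "isometry_group \<Gamma> \<longleftrightarrow> subgroup \<Gamma> (BijGroup M) \<and> \<Gamma> \<subseteq> isometries"

definition reflection_group :: "('a \<Rightarrow> 'a) set \<Rightarrow> bool" where
  "reflection_group \<Gamma> \<longleftrightarrow>
     isometry_group \<Gamma> \<and> (\<exists>S. (\<forall>r\<in>S. reflection r) \<and> \<Gamma> = generate (BijGroup M) S)"

definition proper_action :: "('a \<Rightarrow> 'a) set \<Rightarrow> bool" where
  "proper_action \<Gamma> \<longleftrightarrow> (\<forall>x\<in>M. \<forall>N>0. finite {\<gamma> \<in> \<Gamma>. \<gamma> x \<in> mball x N})"

definition chamber :: "('a \<Rightarrow> 'a) set \<Rightarrow> 'a set \<Rightarrow> bool" where
  "chamber \<Gamma> C \<longleftrightarrow>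
     C \<in> connected_components_of
           (subtopology mtopology (M - (\<Union>r\<in>{r \<in> \<Gamma>. reflection r}. wall r)))"

text \<open>The last two conditions are imposed on one chamber. Both are invariant under \<open>\<Gamma>\<close>, which
  permutes the chambers transitively, so it makes no difference which chamber is taken.\<close>

definition cocompact_discrete_reflection_group :: "('a \<Rightarrow> 'a) set \<Rightarrow> bool" where
  "cocompact_discrete_reflection_group \<Gamma> \<longleftrightarrow>
     reflection_group \<Gamma> \<and>
     proper_action \<Gamma> \<and>
     (\<exists>C. chamber \<Gamma> C \<and>
        compactin mtopology (Abstract_Topology.closure_of mtopology C) \<and>
        {\<gamma> \<in> \<Gamma>. \<gamma> ` C = C} = {\<one>\<^bsub>BijGroup M\<^esub>})"

end

definition iso_to_cocompact_discrete_reflection_group ::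
  "('g, 'c) monoid_scheme \<Rightarrow> 'x set \<Rightarrow> ('x \<Rightarrow> 'x \<Rightarrow> real) \<Rightarrow> bool" where
  "iso_to_cocompact_discrete_reflection_group G X d \<longleftrightarrow>
     (\<exists>\<Gamma>. Metric_space.cocompact_discrete_reflection_group X d \<Gamma> \<and>
          G \<cong> (BijGroup X)\<lparr>carrier := \<Gamma>\<rparr>)"


section \<open>Group presentations and Coxeter groups\<close>

text \<open>A letter \<open>(s, True)\<close> stands for the generator \<open>s\<close> and \<open>(s, False)\<close> for its formal inverse.
  The group presented by generators \<open>S\<close> and relators \<open>R\<close> consists of the words in these letters
  modulo the congruence generated by free cancellation and by setting each relator equal to
  the empty word.\<close>

type_synonym 's word = "('s \<times> bool) list"

definition words :: "'s set \<Rightarrow> 's word set" where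
  "words S = lists (S \<times> UNIV)"

inductive word_equiv :: "'s set \<Rightarrow> 's word set \<Rightarrow> 's word \<Rightarrow> 's word \<Rightarrow> bool"
  for S R where
  refl: "u \<in> words S \<Longrightarrow> word_equiv S R u u"
| sym: "word_equiv S R u v \<Longrightarrow> word_equiv S R v u"
| trans: "word_equiv S R u v \<Longrightarrow> word_equiv S R v w \<Longrightarrow> word_equiv S R u w"
| cancel: "u \<in> words S \<Longrightarrow> v \<in> words S \<Longrightarrow> s \<in> S \<Longrightarrow>
    word_equiv S R (u @ [(s, b), (s, \<not> b)] @ v) (u @ v)"
| relator: "u \<in> words S \<Longrightarrow> v \<in> words S \<Longrightarrow> r \<in> R \<Longrightarrow> r \<in> words S \<Longrightarrow>
    word_equiv S R (u @ r @ v) (u @ v)"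

definition word_class :: "'s set \<Rightarrow> 's word set \<Rightarrow> 's word \<Rightarrow> 's word set" where
  "word_class S R u = {v. word_equiv S R u v}"

definition presented_group :: "'s set \<Rightarrow> 's word set \<Rightarrow> 's word set monoid" where
  "presented_group S R =
     \<lparr>carrier = word_class S R ` words S,
      mult = (\<lambda>A B. \<Union>a\<in>A. \<Union>b\<in>B. word_class S R (a @ b)),
      one = word_class S R []\<rparr>"

definition coxeter_matrix :: "'s set \<Rightarrow> ('s \<Rightarrow> 's \<Rightarrow> enat) \<Rightarrow> bool" where
  "coxeter_matrix S m \<longleftrightarrow>
     (\<forall>s\<in>S. \<forall>t\<in>S. m s t = m t s) \<and>
     (\<forall>s\<in>S. m s s = 1) \<and>
     (\<forall>s\<in>S. \<forall>t\<in>S. s \<noteq> t \<longrightarrow> 2 \<le> m s t)"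

definition coxeter_relators :: "'s set \<Rightarrow> ('s \<Rightarrow> 's \<Rightarrow> enat) \<Rightarrow> 's word set" where
  "coxeter_relators S m =
     {concat (replicate n [(s, True), (t, True)]) | s t n. s \<in> S \<and> t \<in> S \<and> m s t = enat n}"

text \<open>As the generating set is finite, it may be taken to consist of natural numbers.\<close>

definition coxeter_group :: "('g, 'c) monoid_scheme \<Rightarrow> bool" where
  "coxeter_group G \<longleftrightarrow>
     (\<exists>(S :: nat set) m. finite S \<and> coxeter_matrix S m \<and>
        G \<cong> presented_group S (coxeter_relators S m))"


subsection \<open>Presented groups are groups\<close>

lemma words_simps [simp]:
  "[] \<in> words S" "u @ v \<in> words S \<longleftrightarrow> u \<in> words S \<and> v \<in> words S"
  "(s, b) # u \<in> words S \<longleftrightarrow> s \<in> S \<and> u \<in> words S"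
  by (auto simp: words_def)

lemma word_equiv_words: "word_equiv S R u v \<Longrightarrow> u \<in> words S \<and> v \<in> words S"
  by (induction rule: word_equiv.induct) auto

lemma word_equiv_context:
  assumes "word_equiv S R u v" "x \<in> words S" "y \<in> words S"
  shows "word_equiv S R (x @ u @ y) (x @ v @ y)"
  using assms
proof (induction rule: word_equiv.induct)
  case (refl u)
  then show ?case by (intro word_equiv.refl) simp
next
  case (sym u v)
  then show ?case by (meson word_equiv.sym)
next
  case (trans u v w)
  then show ?case by (meson word_equiv.trans)
next
  case (cancel u v s b)
  then show ?case using word_equiv.cancel[of "x @ u" S "v @ y" s R b] by simp
next
  case (relator u v r)
  then show ?case using word_equiv.relator[of "x @ u" S "v @ y" r R] by simp
qed

lemma word_equiv_append:
  assumes "word_equiv S R u u'" "word_equiv S R v v'"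
  shows "word_equiv S R (u @ v) (u' @ v')"
proof (rule word_equiv.trans)
  show "word_equiv S R (u @ v) (u' @ v)"
    using word_equiv_context[OF assms(1), of "[]" v] word_equiv_words[OF assms(2)] by simp
  show "word_equiv S R (u' @ v) (u' @ v')"
    using word_equiv_context[OF assms(2), of u' "[]"] word_equiv_words[OF assms(1)] by simp
qed

lemma word_class_eqI: "word_equiv S R u v \<Longrightarrow> word_class S R u = word_class S R v"
  unfolding word_class_def
  by (rule Collect_cong) (meson word_equiv.sym word_equiv.trans)

lemma word_class_self: "u \<in> words S \<Longrightarrow> u \<in> word_class S R u"
  by (simp add: word_class_def word_equiv.refl)

lemma word_class_eq_iff:
  "v \<in> words S \<Longrightarrow> word_class S R u = word_class S R v \<longleftrightarrow> word_equiv S R u v"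
  using word_class_self[of v S R] word_class_eqI[of S R u v] by (auto simp: word_class_def)

lemma mult_word_class:
  assumes "u \<in> words S" "v \<in> words S"
  shows "word_class S R u \<otimes>\<^bsub>presented_group S R\<^esub> word_class S R v = word_class S R (u @ v)"
proof -
  have eq: "word_class S R (a @ b) = word_class S R (u @ v)"
    if "a \<in> word_class S R u" "b \<in> word_class S R v" for a b
  proof -
    from that have "word_equiv S R u a" "word_equiv S R v b"
      by (simp_all add: word_class_def)
    then show ?thesis by (rule word_class_eqI[OF word_equiv_append, symmetric])
  qed
  have "(\<Union>a\<in>word_class S R u. \<Union>b\<in>word_class S R v. word_class S R (a @ b)) =
      (\<Union>a\<in>word_class S R u. \<Union>b\<in>word_class S R v. word_class S R (u @ v))"
    by (intro SUP_cong HOL.refl eq)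
  also have "\<dots> = word_class S R (u @ v)"
    using word_class_self[OF assms(1), of R] word_class_self[OF assms(2), of R] by blast
  finally show ?thesis
    by (simp add: presented_group_def)
qed

lemma inverse_word_exists:
  assumes "u \<in> words S"
  shows "\<exists>v\<in>words S. word_equiv S R (v @ u) []"
  using assms
proof (induction u)
  case Nil
  then show ?case by (intro bexI[of _ "[]"]) (auto intro: word_equiv.refl)
next
  case (Cons l u)
  obtain s b where l: "l = (s, b)" by (cases l)
  from Cons l have s: "s \<in> S" "u \<in> words S" by auto
  from Cons s obtain v where v: "v \<in> words S" "word_equiv S R (v @ u) []" by auto
  have "word_equiv S R ((v @ [(s, \<not> b)]) @ l # u) []"
    using word_equiv.trans[OF word_equiv.cancel[of v S u s R "\<not> b"] v(2)] v s l by simp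
  moreover have "v @ [(s, \<not> b)] \<in> words S" using v s by simp
  ultimately show ?case by blast
qed

lemma group_presented_group: "group (presented_group S R)" (is "group ?P")
proof -
  have c: "carrier ?P = word_class S R ` words S" and o: "\<one>\<^bsub>?P\<^esub> = word_class S R []"
    by (simp_all add: presented_group_def)
  show ?thesis
  proof (rule groupI)
    fix x assume "x \<in> carrier ?P"
    then obtain u where u: "u \<in> words S" "x = word_class S R u" unfolding c by blast
    then show "\<one>\<^bsub>?P\<^esub> \<otimes>\<^bsub>?P\<^esub> x = x"
      unfolding o by (simp add: mult_word_class)
    obtain v where v: "v \<in> words S" "word_equiv S R (v @ u) []"
      using inverse_word_exists[OF u(1)] by blast
    have "word_class S R v \<otimes>\<^bsub>?P\<^esub> x = \<one>\<^bsub>?P\<^esub>"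
      unfolding o u(2) mult_word_class[OF v(1) u(1)] by (rule word_class_eqI[OF v(2)])
    then show "\<exists>y\<in>carrier ?P. y \<otimes>\<^bsub>?P\<^esub> x = \<one>\<^bsub>?P\<^esub>"
      using v(1) unfolding c by blast
  next
    show "\<one>\<^bsub>?P\<^esub> \<in> carrier ?P" unfolding c o by simp
  next
    fix x y assume "x \<in> carrier ?P" "y \<in> carrier ?P"
    then obtain u v where "u \<in> words S" "x = word_class S R u" "v \<in> words S" "y = word_class S R v"
      unfolding c by blast
    then show "x \<otimes>\<^bsub>?P\<^esub> y \<in> carrier ?P" unfolding c by (simp add: mult_word_class)
  next
    fix x y z assume "x \<in> carrier ?P" "y \<in> carrier ?P" "z \<in> carrier ?P"
    then obtain u v w where "u \<in> words S" "x = word_class S R u" "v \<in> words S" "y = word_class S R v"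
      "w \<in> words S" "z = word_class S R w"
      unfolding c by blast
    then show "x \<otimes>\<^bsub>?P\<^esub> y \<otimes>\<^bsub>?P\<^esub> z = x \<otimes>\<^bsub>?P\<^esub> (y \<otimes>\<^bsub>?P\<^esub> z)"
      by (simp add: mult_word_class)
  qed
qed

end

(* A reflection group of a geodesic space comes with its reflection cocycle: fixing a base point c off
  all walls, N(g) is the set of reflections whose wall separates c from g c, and N(gh) is the symmetric
  difference of N(g) and g N(h) g^-1. Choose a minimal set S of reflections whose half-spaces around c
  cut out the chamber. Near a suitable point of the wall of s in S only the chambers C and s C exist,
  so triviality of chamber stabilizers gives N(s) = {s}. Since |N| is then the word length, the
  exchange condition and Matsumoto's argument (any two reduced words of one element are linked by braid
  moves) yield the Coxeter presentation.

  Conversely, counting how often t occurs among the reflections s1...si...s1 of a word is, modulo 2,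
  invariant under the Coxeter relations, so a presented Coxeter group carries such a cocycle. The
  geodesic space is its Cayley graph as a metric graph. The wall of a generator s consists of the
  midpoints of the edges that s flips, the cocycle decides on which side a vertex lies, and the sides
  are convex because folding a geodesic along the wall would give a geodesic that turns back. The
  chambers are the open stars of radius 1/2 around the vertices. *)

theory Submission
  imports Defs "HOL-Algebra.Multiplicative_Group"
begin


section \<open>Reflection cocycles and Coxeter presentations\<close>

text \<open>Both directions meet in an algebraic interface, the map N with its cocycle rule, so the
  word combinatorics never mentions a space. On the geometric side, a reflection moves a point by at
  most twice the distance to its wall, so properness makes the walls locally finite, and compactness
  of the closed chamber makes S finite. Condition (4) enters twice: an element whose N avoids S maps
  the chamber to itself and is trivial, and any r in N(s) differs from s by such an element. S has
  to be minimal because a wall may touch the closed chamber in a corner only. For the converse, the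
  obstacle is that the orders of products of generators in a presented group are not known in
  advance. The parity count works regardless: (st)^n = 1 makes the 2n reflections of the relator a
  list of n repeated twice. In the Cayley graph, relations close up to circuits, so geodesics need
  not be unique and convexity of the sides is not automatic. Folding settles it because the graph is
  one-dimensional: near a midpoint, a point is determined by its side and its distance.\<close>

primrec alt :: "'a \<Rightarrow> 'a \<Rightarrow> nat \<Rightarrow> 'a list" where
  "alt x y 0 = []"
| "alt x y (Suc n) = x # alt y x n"

lemma length_alt [simp]: "length (alt x y n) = n"
  by (induction n arbitrary: x y) auto

lemma alt_in_lists: "x \<in> A \<Longrightarrow> y \<in> A \<Longrightarrow> alt x y n \<in> lists A"
  by (induction n arbitrary: x y) auto

lemma alt_add: "alt x y (m + n) = alt x y m @ (if even m then alt x y n else alt y x n)"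
  by (induction m arbitrary: x y) auto

lemma rev_alt: "rev (alt x y n) = (if even n then alt y x n else alt x y n)"
proof (induction n arbitrary: x y)
  case (Suc n)
  have "rev (alt x y (Suc n)) = (if even n then alt x y n else alt y x n) @ [x]"
    by (simp add: Suc)
  also have "\<dots> = (if even (Suc n) then alt y x (Suc n) else alt x y (Suc n))"
    using alt_add[of x y n 1] alt_add[of y x n 1] by simp
  finally show ?case .
qed auto

text \<open>Splits the relator (xy)^n, an alternating word of length 2n, into the two sides of the
  braid relation.\<close>

lemma alt_append_rev_alt: "alt x y n @ rev (alt y x n) = alt x y (2 * n)"
  using alt_add[of x y n n] by (simp add: rev_alt mult_2)

lemma alt_double: "alt x y (2 * n) = concat (replicate n [x, y])"
  by (induction n) auto

text \<open>\<open>N a\<close> stands for the reflections whose walls separate the base chamber from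
  its image under \<open>a\<close>. \<open>N_mult\<close> writes the symmetric difference pointwise,
  with \<open>\<noteq>\<close> between truth values as exclusive or.\<close>

locale reflection_cocycle = group K for K (structure) +
  fixes S :: "'a set" and N :: "'a \<Rightarrow> 'a set"
  assumes gens: "S \<subseteq> carrier K"
    and invol: "s \<in> S \<Longrightarrow> s \<otimes> s = \<one>"
    and N_gen: "s \<in> S \<Longrightarrow> N s = {s}"
    and N_sub: "a \<in> carrier K \<Longrightarrow> N a \<subseteq> carrier K"
    and N_mult: "\<lbrakk>a \<in> carrier K; b \<in> carrier K; r \<in> carrier K\<rbrakk> \<Longrightarrow>
       r \<in> N (a \<otimes> b) \<longleftrightarrow> (r \<in> N a) \<noteq> (inv a \<otimes> r \<otimes> a \<in> N b)"
begin

section \<open>Words and left multiplication by a generator\<close>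

definition ev :: "'a list \<Rightarrow> 'a" where
  "ev l = foldr (\<otimes>) l \<one>"

lemma ev_simps [simp]: "ev [] = \<one>" "ev (x # l) = x \<otimes> ev l"
  by (simp_all add: ev_def)

lemma gen_closed [simp]: "s \<in> S \<Longrightarrow> s \<in> carrier K"
  using gens by blast

lemma inv_gen: "s \<in> S \<Longrightarrow> inv s = s"
  by (simp add: inv_equality invol)

lemma gen_cancel [simp]: "s \<in> S \<Longrightarrow> a \<in> carrier K \<Longrightarrow> s \<otimes> (s \<otimes> a) = a"
  by (simp add: invol flip: m_assoc)

lemma ev_closed [simp]: "l \<in> lists S \<Longrightarrow> ev l \<in> carrier K"
  by (induction l) auto

lemma ev_append: "u \<in> lists S \<Longrightarrow> v \<in> lists S \<Longrightarrow> ev (u @ v) = ev u \<otimes> ev v"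
  by (induction u) (auto simp: m_assoc)

lemma ev_rev: "u \<in> lists S \<Longrightarrow> ev (rev u) = inv (ev u)"
proof (induction u)
  case (Cons a u)
  then show ?case
    using ev_append[of "rev u" "[a]"] by (simp add: inv_mult_group inv_gen in_lists_conv_set)
qed simp

text \<open>For a = b = 1 the cocycle rule makes \<open>N \<one>\<close> the symmetric difference of
  itself with itself.\<close>

lemma N_one: "N \<one> = {}"
  using N_mult[of \<one> \<one>] N_sub[of \<one>] by auto

lemma N_left: "s \<in> S \<Longrightarrow> a \<in> carrier K \<Longrightarrow> r \<in> carrier K \<Longrightarrow>
    r \<in> N (s \<otimes> a) \<longleftrightarrow> (r = s) \<noteq> (s \<otimes> r \<otimes> s \<in> N a)"
  by (simp add: N_mult N_gen inv_gen)

lemma gen_conj_conj: "s \<in> S \<Longrightarrow> r \<in> carrier K \<Longrightarrow> s \<otimes> (s \<otimes> r \<otimes> s) \<otimes> s = r"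
  by (simp add: m_assoc invol)

text \<open>Conjugation by \<open>s\<close> fixes \<open>s\<close>, so \<open>s\<close> cannot enter
  the conjugate of \<open>N a\<close>, and the symmetric difference in the cocycle rule is a
  disjoint union.\<close>

lemma N_left_insert:
  assumes "s \<in> S" "a \<in> carrier K" "s \<notin> N a"
  shows "N (s \<otimes> a) = insert s ((\<lambda>r. s \<otimes> r \<otimes> s) ` N a)" (is "?L = ?R")
    and "s \<notin> (\<lambda>r. s \<otimes> r \<otimes> s) ` N a"
proof -
  have sss: "s \<otimes> s \<otimes> s = s" using assms by (simp add: invol)
  show 2: "s \<notin> (\<lambda>r. s \<otimes> r \<otimes> s) ` N a"
  proof
    assume "s \<in> (\<lambda>r. s \<otimes> r \<otimes> s) ` N a"
    then obtain r where r: "r \<in> N a" and eq: "s \<otimes> r \<otimes> s = s" by force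
    then have "s \<otimes> s \<otimes> s = r"
      using gen_conj_conj[OF assms(1), of r] N_sub[OF assms(2)] unfolding eq by blast
    then show False using r(1) assms(3) unfolding sss by simp
  qed
  show "?L = ?R"
  proof (intro equalityI subsetI)
    fix r assume r: "r \<in> ?L"
    then have rc: "r \<in> carrier K" using N_sub[of "s \<otimes> a"] assms by auto
    from r have "r = s \<or> s \<otimes> r \<otimes> s \<in> N a" using N_left[of s a r] assms rc by blast
    moreover have "r = s \<otimes> (s \<otimes> r \<otimes> s) \<otimes> s" using gen_conj_conj[OF assms(1) rc] ..
    ultimately show "r \<in> ?R" by blast
  next
    fix r assume r: "r \<in> ?R"
    show "r \<in> ?L"
    proof (cases "r = s")
      case True
      then show ?thesis using N_left[of s a s] assms sss by simp
    next
      case False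
      then obtain q where q: "q \<in> N a" "r = s \<otimes> q \<otimes> s" using r by blast
      then have "q \<in> carrier K" using N_sub[OF assms(2)] by blast
      then show ?thesis using N_left[of s a r] q assms(1,2) False gen_conj_conj[of s q] by simp
    qed
  qed
qed

lemma inj_gen_conj: "s \<in> S \<Longrightarrow> A \<subseteq> carrier K \<Longrightarrow> inj_on (\<lambda>r. s \<otimes> r \<otimes> s) A"
  by (rule inj_on_inverseI[where g = "\<lambda>r. s \<otimes> r \<otimes> s"]) (auto intro: gen_conj_conj)

end

text \<open>In the geometric instance, \<open>N_trivial\<close> combines two facts: a point on the
  base side of every wall in \<open>S\<close> lies in the base chamber, and chamber stabilizers are
  trivial.\<close>

locale finite_reflection_cocycle = reflection_cocycle +
  assumes finite_N: "a \<in> carrier K \<Longrightarrow> finite (N a)"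
    and N_trivial: "a \<in> carrier K \<Longrightarrow> N a \<inter> S = {} \<Longrightarrow> a = \<one>"
begin

section \<open>Length and strong exchange\<close>

lemma length_up:
  assumes "s \<in> S" "a \<in> carrier K" "s \<notin> N a"
  shows "s \<in> N (s \<otimes> a)" "card (N (s \<otimes> a)) = Suc (card (N a))"
proof -
  have "card ((\<lambda>r. s \<otimes> r \<otimes> s) ` N a) = card (N a)"
    by (rule card_image[OF inj_gen_conj[OF assms(1) N_sub[OF assms(2)]]])
  then show "s \<in> N (s \<otimes> a)" "card (N (s \<otimes> a)) = Suc (card (N a))"
    unfolding N_left_insert(1)[OF assms]
    using N_left_insert(2)[OF assms] finite_N[OF assms(2)] by simp_all
qed

text \<open>This is \<open>length_up\<close> for \<open>s \<otimes> a\<close>, since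
  \<open>s\<close> lies in exactly one of \<open>N a\<close> and
  \<open>N (s \<otimes> a)\<close>.\<close>

lemma length_down:
  assumes "s \<in> S" "a \<in> carrier K" "s \<in> N a"
  shows "s \<notin> N (s \<otimes> a)" "Suc (card (N (s \<otimes> a))) = card (N a)"
proof -
  show 1: "s \<notin> N (s \<otimes> a)"
    using N_left[of s a s] assms by (simp add: invol)
  show "Suc (card (N (s \<otimes> a))) = card (N a)"
    using length_up[OF assms(1) _ 1] assms by simp
qed

lemma length_ev: "l \<in> lists S \<Longrightarrow> card (N (ev l)) \<le> length l"
proof (induction l)
  case (Cons s l)
  then show ?case
    using length_up[of s "ev l"] length_down[of s "ev l"] by (cases "s \<in> N (ev l)") auto
qed (simp add: N_one)

text \<open>A letter is deleted: either \<open>r\<close> cancels the first letter, or s r s is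
  crossed by the rest of the word. Here \<open>r\<close> is any element of \<open>N (ev l)\<close>,
  not only a generator; \<open>dihedral_prefix\<close> relies on this strong form.\<close>

lemma exchange:
  assumes "l \<in> lists S" "r \<in> N (ev l)"
  shows "\<exists>l'\<in>lists S. Suc (length l') = length l \<and> ev l' = r \<otimes> ev l"
  using assms
proof (induction l arbitrary: r)
  case Nil
  then show ?case by (simp add: N_one)
next
  case (Cons s l)
  then have s: "s \<in> S" "l \<in> lists S" and r: "r \<in> carrier K"
    using N_sub[of "ev (s # l)"] by auto
  show ?case
  proof (cases "r = s")
    case True
    then show ?thesis using s by (intro bexI[of _ l]) auto
  next
    case False
    then have "s \<otimes> r \<otimes> s \<in> N (ev l)" using N_left[of s "ev l" r] s r Cons.prems by simp
    then obtain l' where l': "l' \<in> lists S" "Suc (length l') = length l"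
      "ev l' = s \<otimes> r \<otimes> s \<otimes> ev l" using Cons.IH s by blast
    then have "ev (s # l') = r \<otimes> ev (s # l)" using s r by (simp add: m_assoc)
    then show ?thesis using l' s by (intro bexI[of _ "s # l'"]) auto
  qed
qed

text \<open>By \<open>N_trivial\<close>, a non-empty \<open>N a\<close> contains a generator, and
  stripping it off lowers the cardinality by one. Hence \<open>S\<close> generates and
  \<open>card (N a)\<close> is the word length.\<close>

lemma exists_reduced: "a \<in> carrier K \<Longrightarrow> \<exists>l\<in>lists S. ev l = a \<and> length l = card (N a)"
proof (induction "card (N a)" arbitrary: a)
  case 0
  then have "a = \<one>" using finite_N N_trivial[of a] by auto
  then show ?case using 0 by (intro bexI[of _ "[]"]) auto
next
  case (Suc n)
  then have "N a \<noteq> {}" by auto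
  then have "N a \<inter> S \<noteq> {}" using N_trivial N_one Suc by blast
  then obtain s where s: "s \<in> S" "s \<in> N a" by blast
  then have n: "card (N (s \<otimes> a)) = n" using length_down[of s a] Suc by simp
  then obtain l where "l \<in> lists S" "ev l = s \<otimes> a" "length l = n"
    using Suc(1)[of "s \<otimes> a"] s Suc by auto
  then show ?case using s Suc by (intro bexI[of _ "s # l"]) auto
qed

lemma length_mult:
  assumes "a \<in> carrier K" "b \<in> carrier K"
  shows "card (N (a \<otimes> b)) \<le> card (N a) + card (N b)"
proof -
  obtain l m where "l \<in> lists S" "ev l = a" "length l = card (N a)"
    "m \<in> lists S" "ev m = b" "length m = card (N b)"
    using exists_reduced assms by metis
  then show ?thesis using length_ev[of "l @ m"] by (simp add: ev_append)
qed

section \<open>Dihedral subgroups\<close>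

lemma pow_shift:
  assumes "x \<in> carrier K" "y \<in> carrier K"
  shows "x \<otimes> ((y \<otimes> x) [^] (i::nat)) = (x \<otimes> y) [^] i \<otimes> x"
proof (induction i)
  case (Suc i)
  have "x \<otimes> ((y \<otimes> x) [^] Suc i) = (x \<otimes> ((y \<otimes> x) [^] i)) \<otimes> (y \<otimes> x)"
    using assms by (simp add: m_assoc)
  also have "\<dots> = (x \<otimes> y) [^] Suc i \<otimes> x"
    unfolding Suc using assms by (simp add: m_assoc)
  finally show ?case .
qed (use assms in simp)

text \<open>These are the reflections of the dihedral group of \<open>x\<close> and
  \<open>y\<close>, in the order met by the alternating word: conjugation by \<open>x\<close> turns
  (yx)^i y into (xy)^(i+1) x. Only an inclusion holds, since a word longer than the order meets some
  of them twice.\<close>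

lemma N_alt:
  assumes "x \<in> S" "y \<in> S"
  shows "N (ev (alt x y j)) \<subseteq> (\<lambda>i. (x \<otimes> y) [^] i \<otimes> x) ` {..<j}"
  using assms
proof (induction j arbitrary: x y)
  case (Suc j)
  have a: "alt y x j \<in> lists S" using Suc alt_in_lists by metis
  show ?case
  proof
    fix r assume r: "r \<in> N (ev (alt x y (Suc j)))"
    then have rc: "r \<in> carrier K" using N_sub[of "ev (alt x y (Suc j))"] a Suc by auto
    have "r = x \<or> x \<otimes> r \<otimes> x \<in> N (ev (alt y x j))"
      using r N_left[of x "ev (alt y x j)" r] rc a Suc by auto
    then show "r \<in> (\<lambda>i. (x \<otimes> y) [^] i \<otimes> x) ` {..<Suc j}"
    proof
      assume "r = x" then show ?thesis using Suc by (intro image_eqI[of _ _ 0]) auto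
    next
      assume "x \<otimes> r \<otimes> x \<in> N (ev (alt y x j))"
      then obtain i where i: "i < j" "x \<otimes> r \<otimes> x = (y \<otimes> x) [^] i \<otimes> y" using Suc by blast
      have "r = x \<otimes> ((y \<otimes> x) [^] i \<otimes> y) \<otimes> x"
        using gen_conj_conj[of x r] i Suc rc by simp
      also have "\<dots> = (x \<otimes> (y \<otimes> x) [^] i) \<otimes> y \<otimes> x" using Suc by (simp add: m_assoc)
      also have "\<dots> = (x \<otimes> y) [^] Suc i \<otimes> x"
        unfolding pow_shift[OF gen_closed gen_closed, OF Suc(2,3)] using Suc by (simp add: m_assoc)
      finally show ?thesis using i by blast
    qed
  qed
qed (simp add: N_one)

text \<open>Two generators that both shorten \<open>\<gamma>\<close> let one strip alternating words of growing length
  off \<open>\<gamma>\<close>; this only stops when the alternating word is the longest of its dihedral group.\<close>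

lemma dihedral_prefix:
  assumes "x \<in> S" "y \<in> S" "x \<noteq> y" "\<delta> \<in> carrier K" "\<gamma> = ev (alt x y j) \<otimes> \<delta>"
    "card (N \<gamma>) = j + card (N \<delta>)" "x \<in> N \<gamma>" "y \<in> N \<gamma>"
  shows "\<exists>x' y' \<delta>. {x', y'} = {x, y} \<and> \<delta> \<in> carrier K \<and> ord (x' \<otimes> y') > 0 \<and>
     \<gamma> = ev (alt x' y' (ord (x' \<otimes> y'))) \<otimes> \<delta> \<and> card (N \<gamma>) = ord (x' \<otimes> y') + card (N \<delta>)"
  using assms
proof (induction "card (N \<gamma>) - j" arbitrary: x y j \<delta> rule: less_induct)
  case less
  define p where "p = ev (alt x y j)"
  have al: "alt x y j \<in> lists S" using alt_in_lists[of _ S] less(2,3) by metis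
  have p: "p \<in> carrier K" using al unfolding p_def by simp
  have pj: "card (N p) = j"
  proof -
    have "card (N p) \<le> j" using length_ev[OF al] unfolding p_def by simp
    moreover have "card (N \<gamma>) \<le> card (N p) + card (N \<delta>)"
      using length_mult[OF p less(5)] less(6) unfolding p_def by simp
    ultimately show ?thesis using less(2-9) by simp
  qed
  have "y \<in> N p \<or> inv p \<otimes> y \<otimes> p \<in> N \<delta>"
    using less(3,5,6,9) N_mult[of p \<delta> y] p unfolding p_def by auto
  then show ?case
  proof
    \<comment> \<open>Here the dihedral group closes up. The form of \<open>y\<close> from
      \<open>N_alt\<close> gives (xy)^(i+1) = 1 with i < j, so the order is positive and at most
      \<open>j\<close>; conversely \<open>N p\<close> has \<open>j\<close> elements among at most
      \<open>ord (x \<otimes> y)\<close> reflections.\<close>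
    assume "y \<in> N p"
    then obtain i where i: "i < j" "y = (x \<otimes> y) [^] i \<otimes> x"
      using N_alt[of x y j] less(2,3) unfolding p_def by blast
    have "(x \<otimes> y) [^] Suc i = ((x \<otimes> y) [^] i \<otimes> x) \<otimes> y"
      using less(2,3) by (simp add: m_assoc)
    also have "\<dots> = \<one>" unfolding i(2)[symmetric] using less(2,3) invol by simp
    finally have dv: "ord (x \<otimes> y) dvd Suc i" using less(2,3) pow_eq_id[of "x \<otimes> y" "Suc i"] by simp
    then have o: "ord (x \<otimes> y) \<le> j" "ord (x \<otimes> y) > 0"
      using i dvd_imp_le[OF dv] by (auto intro: Nat.gr0I)
    have "(x \<otimes> y) [^] k \<otimes> x \<in> (\<lambda>i. (x \<otimes> y) [^] i \<otimes> x) ` {..<ord (x \<otimes> y)}" for k :: nat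
    proof -
      let ?o = "ord (x \<otimes> y)"
      have "(x \<otimes> y) [^] k = (x \<otimes> y) [^] (?o * (k div ?o)) \<otimes> (x \<otimes> y) [^] (k mod ?o)"
        using less(2,3) by (simp add: nat_pow_mult)
      also have "\<dots> = (x \<otimes> y) [^] (k mod ?o)"
        using less(2,3) by (simp flip: nat_pow_pow)
      finally have "(x \<otimes> y) [^] k = (x \<otimes> y) [^] (k mod ?o)" .
      then show ?thesis using o by auto
    qed
    then have "N p \<subseteq> (\<lambda>i. (x \<otimes> y) [^] i \<otimes> x) ` {..<ord (x \<otimes> y)}"
      using N_alt[of x y j] less(2,3) unfolding p_def by blast
    then have "card (N p) \<le> ord (x \<otimes> y)"
      by (metis card_image_le card_lessThan card_mono finite_imageI finite_lessThan le_trans)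
    then have "ord (x \<otimes> y) = j" using o pj by simp
    then show ?thesis
      using less(5-7) o by (intro exI[of _ x] exI[of _ y] exI[of _ \<delta>]) simp
  next
    \<comment> \<open>Exchange removes a letter from \<open>\<delta>\<close>, which pays for putting
      \<open>y\<close> in front of the alternating word; the roles of \<open>x\<close> and
      \<open>y\<close> swap.\<close>
    assume in\<delta>: "inv p \<otimes> y \<otimes> p \<in> N \<delta>"
    obtain d where d: "d \<in> lists S" "ev d = \<delta>" "length d = card (N \<delta>)"
      using exists_reduced less(5) by blast
    obtain d' where d': "d' \<in> lists S" "Suc (length d') = length d" "ev d' = inv p \<otimes> y \<otimes> p \<otimes> \<delta>"
      using exchange[of d] d in\<delta> by blast
    have pc: "p \<otimes> (inv p \<otimes> z) = z" if "z \<in> carrier K" for z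
      using p that by (simp flip: m_assoc)
    have "ev (alt y x (Suc j)) \<otimes> ev d' = y \<otimes> (p \<otimes> (inv p \<otimes> (y \<otimes> (p \<otimes> \<delta>))))"
      using d'(3) less(3,5) p by (simp add: m_assoc p_def[symmetric])
    also have "\<dots> = \<gamma>"
      using less(3,5,6) p pc by (simp add: p_def[symmetric])
    finally have ga: "\<gamma> = ev (alt y x (Suc j)) \<otimes> ev d'" ..
    have al': "alt y x (Suc j) \<in> lists S" using alt_in_lists[of _ S] less(2,3) by metis
    have "card (N \<gamma>) \<le> card (N (ev (alt y x (Suc j)))) + card (N (ev d'))"
      unfolding ga using al' d' by (intro length_mult ev_closed)
    also have "\<dots> \<le> Suc j + card (N (ev d'))"
      using length_ev[OF al'] by simp
    finally have c: "card (N \<gamma>) = Suc j + card (N (ev d'))"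
      using length_ev[OF d'(1)] d' d less(7) by simp
    have "card (N \<gamma>) - Suc j < card (N \<gamma>) - j" using c by simp
    from less(1)[OF this less(3,2) less(4)[symmetric] ev_closed[OF d'(1)] ga c less(9,8)]
    show ?thesis unfolding insert_commute[of y x "{}"] .
  qed
qed

end

text \<open>Abstracts what Matsumoto's argument uses of an equality of words. Letters are the group
  elements in \<open>S\<close> themselves, without formal inverses. Infinite order is
  \<open>ord = 0\<close>, for which no relation is assumed.\<close>

locale coxeter_word_relation = finite_reflection_cocycle +
  fixes eqv :: "'a list \<Rightarrow> 'a list \<Rightarrow> bool"  (infix "\<asymp>" 50)
  assumes eqv_refl: "u \<in> lists S \<Longrightarrow> u \<asymp> u"
    and eqv_sym: "u \<asymp> v \<Longrightarrow> v \<asymp> u"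
    and eqv_trans: "u \<asymp> v \<Longrightarrow> v \<asymp> w \<Longrightarrow> u \<asymp> w"
    and eqv_append: "u \<asymp> u' \<Longrightarrow> v \<asymp> v' \<Longrightarrow> u @ v \<asymp> u' @ v'"
    and eqv_invol: "s \<in> S \<Longrightarrow> [s, s] \<asymp> []"
    and eqv_braid: "\<lbrakk>s \<in> S; t \<in> S; ord (s \<otimes> t) > 0\<rbrakk> \<Longrightarrow>
      concat (replicate (ord (s \<otimes> t)) [s, t]) \<asymp> []"
    and eqv_sound: "u \<in> lists S \<Longrightarrow> v \<in> lists S \<Longrightarrow> u \<asymp> v \<Longrightarrow> ev u = ev v"
begin

section \<open>Reduced words and braid moves\<close>

lemma eqv_Cons: "s \<in> S \<Longrightarrow> u \<asymp> v \<Longrightarrow> s # u \<asymp> s # v"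
  using eqv_append[OF eqv_refl[of "[s]"], of u v] by simp

lemma eqv_cancel: "s \<in> S \<Longrightarrow> u \<in> lists S \<Longrightarrow> s # s # u \<asymp> u"
  using eqv_append[OF eqv_invol[of s] eqv_refl[of u]] by simp

lemma eqv_rev_append: "u \<in> lists S \<Longrightarrow> rev u @ u \<asymp> []"
proof (induction u)
  case (Cons s u)
  then have u: "u \<in> lists S" "rev u \<in> lists S" "s \<in> S" by auto
  have "rev u @ s # s # u \<asymp> rev u @ u"
    by (rule eqv_append[OF eqv_refl[OF u(2)] eqv_cancel[OF u(3,1)]])
  then show ?case using eqv_trans[OF _ Cons.IH[OF u(1)]] by simp
qed (simp add: eqv_refl)

text \<open>The relator is u rev(v) for the two alternating words u and v; appending v and
  cancelling rev(v) v leaves u on one side and v on the other.\<close>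

lemma eqv_alt:
  assumes "x \<in> S" "y \<in> S" "ord (x \<otimes> y) > 0"
  shows "alt x y (ord (x \<otimes> y)) \<asymp> alt y x (ord (x \<otimes> y))"
proof -
  let ?u = "alt x y (ord (x \<otimes> y))" and ?v = "alt y x (ord (x \<otimes> y))"
  have l: "?u \<in> lists S" "?v \<in> lists S" using assms alt_in_lists by metis+
  have "?u @ rev ?v \<asymp> []"
    unfolding alt_append_rev_alt alt_double by (rule eqv_braid[OF assms])
  from eqv_append[OF this eqv_refl[OF l(2)]]
  have "?u @ (rev ?v @ ?v) \<asymp> ?v" by simp
  moreover have "?u @ (rev ?v @ ?v) \<asymp> ?u"
    using eqv_append[OF eqv_refl[OF l(1)] eqv_rev_append[OF l(2)]] by simp
  ultimately show ?thesis using eqv_sym eqv_trans by blast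
qed

text \<open>Words with the same first letter are compared by their tails. If the first letters
  \<open>s\<close> and \<open>t\<close> differ, both shorten the element, which therefore has a
  reduced word starting with the longest alternating word of the dihedral group of \<open>s\<close>
  and \<open>t\<close>. One braid move changes its first letter, so it links the two words.\<close>

lemma reduced_eqv:
  assumes "u \<in> lists S" "v \<in> lists S" "ev u = ev v"
    "length u = card (N (ev u))" "length v = card (N (ev v))"
  shows "u \<asymp> v"
  using assms
proof (induction "length u" arbitrary: u v)
  case 0
  then show ?case using eqv_refl[of "[]"] by simp
next
  case (Suc n)
  note prems = Suc(2-)
  define \<gamma> where "\<gamma> = ev u"
  have n: "card (N \<gamma>) = Suc n" and \<gamma>c: "\<gamma> \<in> carrier K" using prems unfolding \<gamma>_def by auto
  \<comment> \<open>Tails of reduced words are reduced, and the first letter of a reduced word lies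
    in \<open>N \<gamma>\<close>.\<close>
  have tail: "b \<in> lists S \<and> c \<in> N \<gamma> \<and> c \<in> S \<and> ev b = c \<otimes> \<gamma> \<and> card (N (ev b)) = n \<and> length b = n"
    if "c # b \<in> lists S" "ev (c # b) = \<gamma>" "length (c # b) = Suc n" for c b
  proof -
    have b: "b \<in> lists S" "c \<in> S" "length b = n" using that by auto
    have "c \<otimes> (c \<otimes> ev b) = ev b" by (intro gen_cancel ev_closed b)
    then have ev: "ev b = c \<otimes> \<gamma>" using that by auto
    have evb: "ev b \<in> carrier K" using b by (intro ev_closed)
    have g: "card (N (c \<otimes> ev b)) = Suc n" using that n by simp
    have "c \<notin> N (ev b)"
    proof
      assume "c \<in> N (ev b)"
      from length_down(2)[OF b(2) evb this] show False
        using g length_ev[OF b(1)] b(3) by simp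
    qed
    then show ?thesis using length_up[OF b(2) evb] that g b ev by auto
  qed
  have same: "c # b \<asymp> c # b'"
    if "c # b \<in> lists S" "ev (c # b) = \<gamma>" "length (c # b) = Suc n"
      "c # b' \<in> lists S" "ev (c # b') = \<gamma>" "length (c # b') = Suc n" for c b b'
    using tail[OF that(1-3)] tail[OF that(4-6)] by (intro eqv_Cons Suc(1)) auto
  obtain s u' where u: "u = s # u'" using prems by (cases u) auto
  obtain t v' where v: "v = t # v'" using prems by (cases v) auto
  have us: "s # u' \<in> lists S" "ev (s # u') = \<gamma>" "length (s # u') = Suc n"
    and vs: "t # v' \<in> lists S" "ev (t # v') = \<gamma>" "length (t # v') = Suc n"
    using prems n u v \<gamma>_def by auto
  show ?case
  proof (cases "s = t")
    case True
    then show ?thesis using same[OF us] vs unfolding u v by blast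
  next
    case False
    \<comment> \<open>The descent starts with the empty alternating word. The pair comes back in
      unknown order, which accounts for the two cases at the end.\<close>
    obtain x y \<delta> where xy: "{x, y} = {s, t}" "\<delta> \<in> carrier K"
      "ord (x \<otimes> y) > 0" "\<gamma> = ev (alt x y (ord (x \<otimes> y))) \<otimes> \<delta>"
      "card (N \<gamma>) = ord (x \<otimes> y) + card (N \<delta>)"
      using dihedral_prefix[of s t \<gamma> \<gamma> 0] False \<gamma>c tail[OF us] tail[OF vs] by (auto simp del: insert_iff)
    have S: "x \<in> S" "y \<in> S" using xy(1) tail[OF us] tail[OF vs] by auto
    obtain d where d: "d \<in> lists S" "ev d = \<delta>" "length d = card (N \<delta>)"
      using exists_reduced xy by blast
    let ?m = "ord (x \<otimes> y)"
    have l: "alt x y ?m \<in> lists S" "alt y x ?m \<in> lists S" using S alt_in_lists by metis+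
    have e: "alt x y ?m @ d \<asymp> alt y x ?m @ d"
      using eqv_append[OF eqv_alt[OF S xy(3)] eqv_refl[OF d(1)]] .
    have 1: "alt x y ?m @ d \<in> lists S" "ev (alt x y ?m @ d) = \<gamma>" "length (alt x y ?m @ d) = Suc n"
      using l d xy n by (auto simp: ev_append)
    have 2: "alt y x ?m @ d \<in> lists S" "ev (alt y x ?m @ d) = \<gamma>" "length (alt y x ?m @ d) = Suc n"
      using l d xy n 1(2) eqv_sound[OF _ _ e] by auto
    obtain k where k: "?m = Suc k" using xy(3) by (cases ?m) auto
    have 3: "x # b \<asymp> y # c" if "x # b \<in> lists S" "ev (x # b) = \<gamma>" "length (x # b) = Suc n"
      "y # c \<in> lists S" "ev (y # c) = \<gamma>" "length (y # c) = Suc n" for b c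
    proof -
      have "x # b \<asymp> alt x y ?m @ d"
        using same[OF that(1-3)] 1 unfolding k by simp
      moreover have "alt y x ?m @ d \<asymp> y # c"
        using same[OF _ _ _ that(4-6)] 2 unfolding k by simp
      ultimately show ?thesis using e eqv_trans by blast
    qed
    from xy(1) consider "x = s" "y = t" | "x = t" "y = s" using False by (auto simp: doubleton_eq_iff)
    then show ?thesis
    proof cases
      case 1 then show ?thesis using 3 us vs unfolding u v by blast
    next
      case 2 then show ?thesis using 3 us vs eqv_sym unfolding u v by blast
    qed
  qed
qed

text \<open>Letters are added on the left one at a time. When \<open>s\<close> shortens the value of
  \<open>v\<close>, \<open>reduced_eqv\<close> replaces \<open>v\<close> by a reduced word that
  starts with \<open>s\<close>, and the two copies of \<open>s\<close> cancel.\<close>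

lemma eqv_reduced:
  "u \<in> lists S \<Longrightarrow> \<exists>v\<in>lists S. u \<asymp> v \<and> length v = card (N (ev v))"
proof (induction u)
  case Nil
  then show ?case using eqv_refl N_one by force
next
  case (Cons s u)
  then obtain v where v: "v \<in> lists S" "u \<asymp> v" "length v = card (N (ev v))" and s: "s \<in> S" by auto
  show ?case
  proof (cases "s \<in> N (ev v)")
    case False
    then show ?thesis using v s length_up[of s "ev v"] eqv_Cons[of s u v]
      by (intro bexI[of _ "s # v"]) auto
  next
    case True
    obtain w where w: "w \<in> lists S" "ev w = s \<otimes> ev v" "length w = card (N (s \<otimes> ev v))"
      using exists_reduced[of "s \<otimes> ev v"] s v by auto
    have "v \<asymp> s # w" using w s v length_down[of s "ev v"] True by (intro reduced_eqv) auto
    then have "s # u \<asymp> s # s # w" using eqv_Cons s v eqv_trans by blast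
    then have "s # u \<asymp> w" using eqv_cancel[OF s w(1)] eqv_trans by blast
    then show ?thesis using w by auto
  qed
qed

lemma eqv_Nil:
  assumes "u \<in> lists S" "ev u = \<one>"
  shows "u \<asymp> []"
proof -
  obtain v where v: "v \<in> lists S" "u \<asymp> v" "length v = card (N (ev v))" 
    using eqv_reduced assms by blast
  then have "ev v = \<one>" using eqv_sound assms by metis
  then show ?thesis using v N_one by simp
qed

end

section \<open>From positive words to the presentation\<close>

lemma word_equiv_letter:
  assumes "i \<in> I" "m i i = 1"
  shows "word_equiv I (coxeter_relators I m) [(i, b)] [(i, True)]"
proof (cases b)
  case False
  let ?E = "word_equiv I (coxeter_relators I m)"
  \<comment> \<open>The relator for m(i,i) = 1 is the word i i; it identifies a generator with its
    formal inverse.\<close>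
  have r: "[(i, True), (i, True)] \<in> coxeter_relators I m"
    using assms unfolding coxeter_relators_def
    by (auto simp: one_enat_def intro!: exI[of _ i] exI[of _ "1 :: nat"])
  have 1: "?E [(i, False), (i, True), (i, True)] [(i, False)]"
    using word_equiv.relator[of "[(i, False)]" I "[]", OF _ _ r] assms by simp
  have 2: "?E [(i, False), (i, True), (i, True)] [(i, True)]"
    using word_equiv.cancel[of "[]" I "[(i, True)]" i "coxeter_relators I m" False] assms by simp
  show ?thesis using False word_equiv.trans[OF word_equiv.sym[OF 1] 2] by simp
qed (use assms in \<open>simp add: word_equiv.refl\<close>)

lemma word_equiv_positive:
  assumes "\<And>i. i \<in> I \<Longrightarrow> m i i = 1" "u \<in> words I"
  shows "word_equiv I (coxeter_relators I m) u (map (\<lambda>i. (i, True)) (map fst u))"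
  using assms(2)
proof (induction u)
  case (Cons l u)
  obtain i b where l: "l = (i, b)" by (cases l)
  with Cons have i: "i \<in> I" "u \<in> words I" by auto
  show ?case
    using word_equiv_append[OF word_equiv_letter[of i I m b, OF i(1) assms(1)[OF i(1)]] Cons.IH[OF i(2)]]
    unfolding l by simp
qed (simp add: word_equiv.refl)

lemma coxeter_relators_doubleI:
  "s \<in> I \<Longrightarrow> t \<in> I \<Longrightarrow> m s t = enat n \<Longrightarrow>
    concat (replicate n [(s, True), (t, True)]) \<in> coxeter_relators I m"
  unfolding coxeter_relators_def by blast

lemma words_concat_replicate: "u \<in> words I \<Longrightarrow> concat (replicate n u) \<in> words I"
  by (induction n) auto

context finite_reflection_cocycle
begin

lemma ev_concat_replicate:
  assumes "s \<in> S" "t \<in> S"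
  shows "ev (concat (replicate n [s, t])) = (s \<otimes> t) [^] n"
proof (induction n)
  case (Suc n)
  have "ev (concat (replicate (Suc n) [s, t])) = s \<otimes> (t \<otimes> (s \<otimes> t) [^] n)"
    by (simp add: Suc)
  also have "\<dots> = (s \<otimes> t) \<otimes> (s \<otimes> t) [^] n"
    using assms by (simp add: m_assoc)
  also have "\<dots> = (s \<otimes> t) [^] Suc n"
    by (rule nat_pow_Suc2[symmetric]) (use assms in simp)
  finally show ?case .
qed simp

text \<open>The presented group maps onto \<open>K\<close> because reduced words exist, and
  injectively because by \<open>eqv_Nil\<close> every word of value 1 is a consequence of the
  relators.\<close>

theorem coxeter_group_if_finite:
  assumes "finite S"
  shows "coxeter_group K"
proof -
  obtain g where g: "bij_betw g {0..<card S} S"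
    using ex_bij_betw_nat_finite[OF assms] by blast
  define I where "I = {0..<card S}"
  \<comment> \<open>Order 0 encodes infinite order and becomes the entry \<infinity>.\<close>
  define m where "m i j = (let o' = ord (g i \<otimes> g j) in if o' = 0 then \<infinity> else enat o')" for i j
  let ?R = "coxeter_relators I m"
  let ?E = "word_equiv I ?R"
  let ?P = "presented_group I ?R"
  have gS [simp]: "g i \<in> S" if "i \<in> I" for i
    using g that unfolding I_def bij_betw_def by blast
  have inj: "inj_on g I" using g unfolding I_def bij_betw_def by blast
  have mii: "m i i = 1" if "i \<in> I" for i
    using that by (simp add: m_def invol one_enat_def)
  have matrix: "coxeter_matrix I m"
    unfolding coxeter_matrix_def
  proof (intro conjI ballI impI)
    fix i j assume ij: "i \<in> I" "j \<in> I"
    have "inv (g i \<otimes> g j) = g j \<otimes> g i" using ij by (simp add: inv_mult_group inv_gen)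
    then have "ord (g i \<otimes> g j) = ord (g j \<otimes> g i)"
      using ord_inv[of "g i \<otimes> g j"] ij by simp
    then show "m i j = m j i" by (simp add: m_def)
    assume "i \<noteq> j"
    then have "g i \<noteq> g j" using inj ij by (meson inj_on_def)
    moreover have "g i = g j" if "g i \<otimes> g j = \<one>"
      using inv_equality[OF that] ij inv_gen by simp
    ultimately have "g i \<otimes> g j \<noteq> \<one>" by blast
    then have "ord (g i \<otimes> g j) \<noteq> 1" using ord_eq_1[of "g i \<otimes> g j"] ij by simp
    then show "2 \<le> m i j" by (simp add: m_def Let_def numeral_eq_enat)
  qed (rule mii)
  define wev where "wev u = ev (map g (map fst u))" for u :: "nat word"
  have wl: "map g (map fst u) \<in> lists S" if "u \<in> words I" for u :: "nat word"
    using that by (auto simp: words_def in_lists_conv_set)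
  have wev_closed: "wev u \<in> carrier K" if "u \<in> words I" for u
    unfolding wev_def by (rule ev_closed[OF wl[OF that]])
  have wev_append: "wev (u @ v) = wev u \<otimes> wev v" if "u \<in> words I" "v \<in> words I" for u v
    using ev_append[OF wl[OF that(1)] wl[OF that(2)]] unfolding wev_def by simp
  have wev_rel: "wev r = \<one>" if "r \<in> ?R" for r
  proof -
    obtain s t n where r: "r = concat (replicate n [(s, True), (t, True)])"
      "s \<in> I" "t \<in> I" "m s t = enat n"
      using \<open>r \<in> ?R\<close> unfolding coxeter_relators_def by blast
    have "ord (g s \<otimes> g t) = n" using r(4) by (simp add: m_def Let_def split: if_splits)
    moreover have "wev r = ev (concat (replicate n [g s, g t]))"
      unfolding wev_def r(1) by (simp add: map_concat)
    ultimately show ?thesis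
      using r(2,3) pow_ord_eq_1[of "g s \<otimes> g t"] by (simp add: ev_concat_replicate)
  qed
  have wev_sound: "wev u = wev v" if "?E u v" for u v
    using that
  proof (induction rule: word_equiv.induct)
    case (cancel u v s b)
    have "wev [(s, b), (s, \<not> b)] = \<one>" using cancel by (simp add: wev_def invol)
    then have "wev ([(s, b), (s, \<not> b)] @ v) = wev v"
      using cancel wev_append[of "[(s, b), (s, \<not> b)]" v] wev_closed[of v] by simp
    then show ?case using cancel wev_append[of u v] wev_append[of u "[(s, b), (s, \<not> b)] @ v"] by simp
  next
    case (relator u v r)
    then show ?case by (simp add: wev_append wev_closed wev_rel)
  qed simp_all
  \<comment> \<open>Translates a word in group elements into a positive word in the index letters;
    pulling \<open>word_equiv\<close> back along it gives the relation for Matsumoto's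
    argument.\<close>
  define pos where "pos u = map (\<lambda>i. (i, True)) (map (inv_into I g) u)" for u
  have pos_append: "pos (u @ v) = pos u @ pos v" for u v by (simp add: pos_def)
  have gI: "inv_into I g s \<in> I" "g (inv_into I g s) = s" if "s \<in> S" for s
    using that g inv_into_into[of s g I] f_inv_into_f[of s g I] unfolding I_def bij_betw_def by auto
  have pos_words: "pos u \<in> words I" if "u \<in> lists S" for u
    using that by (induction u) (auto simp: pos_def gI)
  have wev_pos: "wev (pos u) = ev u" if "u \<in> lists S" for u
    using that by (induction u) (auto simp: wev_def pos_def gI)
  interpret W: coxeter_word_relation K S N "\<lambda>u v. ?E (pos u) (pos v)"
  proof unfold_locales
    fix s t assume st: "s \<in> S" "t \<in> S" "ord (s \<otimes> t) > 0"
    let ?r = "pos (concat (replicate (ord (s \<otimes> t)) [s, t]))"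
    have "?r = concat (replicate (ord (s \<otimes> t)) [(inv_into I g s, True), (inv_into I g t, True)])"
      by (simp add: pos_def map_concat)
    also have "\<dots> \<in> ?R"
      using st gI by (intro coxeter_relators_doubleI) (auto simp: m_def Let_def)
    finally have "?r \<in> ?R" .
    moreover have "?r \<in> words I"
      using st by (intro pos_words) auto
    ultimately show "?E ?r (pos [])"
      using word_equiv.relator[of "[]" I "[]" ?r ?R] by (simp add: pos_def)
  next
    fix s assume s: "s \<in> S"
    have "?E [(inv_into I g s, True), (inv_into I g s, False)] []"
      using word_equiv.cancel[of "[]" I "[]" "inv_into I g s" ?R True] s gI by simp
    moreover have "?E [(inv_into I g s, True), (inv_into I g s, False)] (pos [s, s])"
      using word_equiv_positive[of I m "[(inv_into I g s, True), (inv_into I g s, False)]"]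
        s gI mii by (simp add: pos_def)
    ultimately have "?E (pos [s, s]) []" by (meson word_equiv.sym word_equiv.trans)
    then show "?E (pos [s, s]) (pos [])" by (simp add: pos_def)
  next
    fix u v assume "u \<in> lists S" "v \<in> lists S" "?E (pos u) (pos v)"
    then show "ev u = ev v" using wev_sound wev_pos by metis
  next
    fix u v w assume "?E (pos u) (pos v)" "?E (pos v) (pos w)"
    then show "?E (pos u) (pos w)" by (rule word_equiv.trans)
  next
    fix u v assume "?E (pos u) (pos v)"
    then show "?E (pos v) (pos u)" by (rule word_equiv.sym)
  next
    fix u assume "u \<in> lists S"
    then show "?E (pos u) (pos u)" by (intro word_equiv.refl pos_words)
  next
    fix u u' v v' assume "?E (pos u) (pos u')" "?E (pos v) (pos v')"
    then show "?E (pos (u @ v)) (pos (u' @ v'))" unfolding pos_append by (rule word_equiv_append)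
  qed
  have wev_Nil: "?E u []" if u: "u \<in> words I" "wev u = \<one>" for u
  proof -
    let ?l = "map g (map fst u)"
    have "pos ?l = map (\<lambda>i. (i, True)) (map fst u)"
      using u(1) inj by (auto simp: pos_def words_def in_lists_conv_set)
    moreover have "?E (pos ?l) (pos [])"
      using W.eqv_Nil[OF wl[OF u(1)]] u(2) unfolding wev_def by simp
    moreover have "pos [] = []" by (simp add: pos_def)
    ultimately have 2: "?E (map (\<lambda>i. (i, True)) (map fst u)) []" by simp
    have 1: "?E u (map (\<lambda>i. (i, True)) (map fst u))"
      by (rule word_equiv_positive[OF _ u(1)]) (rule mii)
    show ?thesis by (rule word_equiv.trans[OF 1 2])
  qed
  define h where "h A = the_elem (wev ` A)" for A
  have h: "h (word_class I ?R u) = wev u" if "u \<in> words I" for u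
  proof -
    have "wev v = wev u" if "v \<in> word_class I ?R u" for v
      by (rule wev_sound[symmetric]) (use that in \<open>simp add: word_class_def\<close>)
    moreover have "word_class I ?R u \<noteq> {}" using word_class_self[OF that] by blast
    ultimately show ?thesis unfolding h_def by (intro the_elem_image_unique)
  qed
  have cP: "carrier ?P = word_class I ?R ` words I" by (simp add: presented_group_def)
  have hom: "h \<in> hom ?P K"
  proof (rule homI)
    fix A B assume "A \<in> carrier ?P" "B \<in> carrier ?P"
    then obtain u v where uv: "u \<in> words I" "A = word_class I ?R u" "v \<in> words I" "B = word_class I ?R v"
      unfolding cP by blast
    then have "h (A \<otimes>\<^bsub>?P\<^esub> B) = wev (u @ v)" by (simp add: mult_word_class h)
    then show "h (A \<otimes>\<^bsub>?P\<^esub> B) = h A \<otimes> h B" using uv by (simp add: h wev_append)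
  qed (auto simp: cP h wev_closed)
  interpret P: group ?P by (rule group_presented_group)
  interpret h: group_hom ?P K h
    using hom by unfold_locales
  have "inj_on h (carrier ?P)"
    unfolding h.inj_on_one_iff
  proof (intro allI impI)
    fix A assume "A \<in> carrier ?P" "h A = \<one>"
    then obtain u where "u \<in> words I" "A = word_class I ?R u" "wev u = \<one>" unfolding cP using h by auto
    then show "A = \<one>\<^bsub>?P\<^esub>"
      using word_class_eqI[OF wev_Nil[of u]] by (simp add: presented_group_def)
  qed
  moreover have "h ` carrier ?P = carrier K"
  proof (intro equalityI subsetI)
    fix a assume "a \<in> carrier K"
    then obtain l where l: "l \<in> lists S" "ev l = a" using exists_reduced by blast
    then have "h (word_class I ?R (pos l)) = a" using h[OF pos_words] wev_pos by simp
    then show "a \<in> h ` carrier ?P" unfolding cP using pos_words l by blast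
  next
    fix a assume "a \<in> h ` carrier ?P"
    then show "a \<in> carrier K" using hom by (auto simp: hom_def)
  qed
  ultimately have "h \<in> iso ?P K" using hom unfolding iso_def bij_betw_def by simp
  then have "K \<cong> ?P" by (intro P.iso_sym is_isoI)
  moreover have "finite I" unfolding I_def by simp
  ultimately show ?thesis unfolding coxeter_group_def using matrix by blast
qed

end


section \<open>Reflections of geodesic spaces\<close>

context Metric_space
begin

section \<open>Geodesics as connected sets\<close>

lemma geodesic_endpoints:
  assumes "geodesic x y \<xi>"
  shows "\<xi> 0 = x" "\<xi> (d x y) = y" "t \<in> {0..d x y} \<Longrightarrow> \<xi> t \<in> M"
  using assms by (auto simp: geodesic_def)

lemma geodesic_dist:
  "geodesic x y \<xi> \<Longrightarrow> s \<in> {0..d x y} \<Longrightarrow> t \<in> {0..d x y} \<Longrightarrow> d (\<xi> s) (\<xi> t) = \<bar>s - t\<bar>"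
  by (auto simp: geodesic_def)

lemma geodesic_dist_endpoints:
  assumes "geodesic x y \<xi>" "t \<in> {0..d x y}"
  shows "d x (\<xi> t) = t" "d (\<xi> t) y = d x y - t"
  using geodesic_dist[OF assms(1), of 0 t] geodesic_dist[OF assms(1), of t "d x y"]
    geodesic_endpoints[OF assms(1)] assms(2) by auto

lemma continuous_map_geodesic:
  assumes "geodesic x y \<xi>"
  shows "continuous_map (top_of_set {0..d x y}) mtopology \<xi>"
  unfolding continuous_map_to_metric
proof (intro ballI allI impI)
  fix t \<epsilon> :: real assume t: "t \<in> topspace (top_of_set {0..d x y})" and e: "\<epsilon> > 0"
  let ?U = "{0..d x y} \<inter> ball t \<epsilon>"
  have "openin (top_of_set {0..d x y}) ?U" by (intro openin_open_Int) simp
  moreover have "\<xi> s \<in> mball (\<xi> t) \<epsilon>" if "s \<in> ?U" for s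
    using that t geodesic_dist[OF assms, of t s] geodesic_endpoints(3)[OF assms]
    by (auto simp: dist_real_def)
  ultimately show "\<exists>U. openin (top_of_set {0..d x y}) U \<and> t \<in> U \<and> (\<forall>s\<in>U. \<xi> s \<in> mball (\<xi> t) \<epsilon>)"
    using t e by (intro exI[of _ ?U]) auto
qed

lemma connectedin_geodesic:
  assumes "geodesic x y \<xi>"
  shows "connectedin mtopology (\<xi> ` {0..d x y})"
  by (rule connectedin_continuous_map_image[OF continuous_map_geodesic[OF assms]])
    (simp add: connectedin_subtopology connectedin_iff_connected)

lemma geodesic_endpoints_image:
  assumes "geodesic x y \<xi>"
  shows "x \<in> \<xi> ` {0..d x y}" "y \<in> \<xi> ` {0..d x y}"
  using image_eqI[of x \<xi> 0 "{0..d x y}"] image_eqI[of y \<xi> "d x y" "{0..d x y}"]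
    geodesic_endpoints[OF assms] by auto

text \<open>All geodesics issuing from \<open>a\<close> share the point \<open>a\<close>, so their
  union is connected. Only star-shapedness is assumed, so that balls are covered as well as convex
  sets.\<close>

lemma connectedin_if_geodesics:
  assumes geo: "geodesic_space" and a: "a \<in> A" and AM: "A \<subseteq> M"
    and star: "\<And>y \<xi>. y \<in> A \<Longrightarrow> geodesic a y \<xi> \<Longrightarrow> \<xi> ` {0..d a y} \<subseteq> A"
  shows "connectedin mtopology A"
proof -
  let ?U = "{\<xi> ` {0..d a y} |\<xi> y. y \<in> A \<and> geodesic a y \<xi>}"
  have "connectedin mtopology (\<Union>?U)"
  proof (rule connectedin_Union)
    have "a \<in> \<Inter>?U" using geodesic_endpoints_image(1) by blast
    then show "\<Inter>?U \<noteq> {}" by blast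
  qed (auto intro: connectedin_geodesic)
  moreover have "\<Union>?U = A"
  proof
    show "\<Union>?U \<subseteq> A" using star by blast
    show "A \<subseteq> \<Union>?U"
    proof
      fix y assume y: "y \<in> A"
      then obtain \<xi> where g: "geodesic a y \<xi>" using geo a AM unfolding geodesic_space_def by blast
      have "\<xi> ` {0..d a y} \<in> ?U" using y g by blast
      then show "y \<in> \<Union>?U" using geodesic_endpoints_image(2)[OF g] by (rule UnionI)
    qed
  qed
  ultimately show ?thesis by simp
qed

lemma connectedin_geodesically_convex:
  assumes "geodesic_space" "geodesically_convex A"
  shows "connectedin mtopology A"
proof (cases "A = {}")
  case False
  then obtain a where a: "a \<in> A" by blast
  show ?thesis
    by (rule connectedin_if_geodesics[OF assms(1) a])
      (use assms(2) a in \<open>unfold geodesically_convex_def, blast+\<close>)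
qed simp

section \<open>Isometries, walls and half-spaces\<close>

lemma isometriesD:
  assumes "f \<in> isometries"
  shows "f \<in> Bij M" "x \<in> M \<Longrightarrow> f x \<in> M" "x \<in> M \<Longrightarrow> y \<in> M \<Longrightarrow> d (f x) (f y) = d x y"
    "f ` M = M" "inj_on f M"
  using assms by (auto simp: isometries_def Bij_def bij_betw_def)

lemma homeomorphic_map_isometry:
  assumes "f \<in> isometries"
  shows "homeomorphic_map mtopology mtopology f"
proof -
  interpret Metric_space12 M d M d by unfold_locales
  show ?thesis using isometry_imp_homeomorphic_map[of f] isometriesD[OF assms] by blast
qed

text \<open>A fixed point y satisfies d(x, r x) \<le> 2 d(x, y), so a ball of half the displacement
  about \<open>x\<close> contains none.\<close>

lemma openin_compl_wall:
  assumes "r \<in> isometries"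
  shows "openin mtopology (M - wall r)"
  unfolding openin_mtopology
proof (intro conjI allI impI)
  fix x assume x: "x \<in> M - wall r"
  then have rx: "r x \<in> M" "0 < d x (r x)"
    using isometriesD(2)[OF assms] by (auto simp: wall_def mdist_pos_eq)
  have "mball x (d x (r x) / 2) \<subseteq> M - wall r"
  proof
    fix y assume y: "y \<in> mball x (d x (r x) / 2)"
    have "y \<notin> wall r"
    proof
      assume "y \<in> wall r"
      then have ry: "r y = y" "y \<in> M" by (auto simp: wall_def)
      have "d x (r x) \<le> d x y + d y (r x)" using x ry rx by (intro triangle) auto
      also have "d y (r x) = d y x" using isometriesD(3)[OF assms, of y x] x ry by auto
      finally show False using y by (simp add: commute)
    qed
    then show "y \<in> M - wall r" using y by auto
  qed
  then show "\<exists>e>0. mball x e \<subseteq> M - wall r" using rx by (intro exI[of _ "d x (r x) / 2"]) auto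
qed auto

text \<open>The empty set when \<open>x\<close> is on the wall, since a point outside a subspace has
  no component in it.\<close>

definition half :: "('a \<Rightarrow> 'a) \<Rightarrow> 'a \<Rightarrow> 'a set" where
  "half r x = connected_component_of_set (subtopology mtopology (M - wall r)) x"

lemma half_subset: "half r x \<subseteq> M - wall r"
  unfolding half_def using connected_component_of_subset_topspace[of "subtopology mtopology (M - wall r)" x] by auto

lemma half_refl: "x \<in> M - wall r \<Longrightarrow> x \<in> half r x"
  by (simp add: half_def connected_component_of_refl)

lemma half_eq_iff: "x \<in> M - wall r \<Longrightarrow> y \<in> M - wall r \<Longrightarrow> half r x = half r y \<longleftrightarrow> y \<in> half r x"
  unfolding half_def using connected_component_of_equiv[of "subtopology mtopology (M - wall r)" x y] 
    connected_component_of_eq[of "subtopology mtopology (M - wall r)" x y]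
  by (auto simp: half_def)

lemma connectedin_subset_half:
  "connectedin mtopology A \<Longrightarrow> A \<subseteq> M - wall r \<Longrightarrow> x \<in> A \<Longrightarrow> A \<subseteq> half r x"
  unfolding half_def by (intro connected_component_of_maximal) (auto simp: connectedin_subtopology)

lemma reflectionD:
  assumes "reflection r"
  shows "r \<in> isometries" "x \<in> M \<Longrightarrow> r (r x) = x"
  using assms by (auto simp: reflection_def)

text \<open>Components are closed in the complement of the wall. As there are only two, each is the
  complement of the other and so open there, hence open in the space because the wall is
  closed.\<close>

lemma reflection_half:
  assumes r: "reflection r" and x: "x \<in> M - wall r"
  shows "r x \<in> M - wall r" "r x \<notin> half r x" "r ` half r x = half r (r x)"
    "half r x \<union> half r (r x) = M - wall r"
    "openin mtopology (half r x)" "geodesically_convex (half r x)"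
proof -
  let ?X = "subtopology mtopology (M - wall r)"
  obtain A B where AB: "A \<noteq> B" "connected_components_of ?X = {A, B}"
    "geodesically_convex A" "geodesically_convex B" "r ` A = B" "r ` B = A"
    using r unfolding reflection_def by (elim conjE exE) (rule that)
  have top: "topspace ?X = M - wall r" by auto
  have un: "A \<union> B = M - wall r"
    using Union_connected_components_of[of ?X] AB(2) top by simp
  have "disjnt A B"
    by (rule pairwiseD[OF pairwise_disjoint_connected_components_of[of ?X]]) (simp_all add: AB(1,2))
  then have disj: "A \<inter> B = {}" by (simp add: disjnt_def)
  have half: "half r z = E" if "z \<in> E" "E \<in> {A, B}" for z E
  proof -
    have z: "z \<in> M - wall r" using that un by blast
    then have "half r z \<in> {A, B}"
      using connected_component_in_connected_components_of[of ?X z] top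
      unfolding half_def AB(2) by simp
    then show ?thesis using half_refl[OF z] that disj by blast
  qed
  have "openin ?X E" if "E \<in> {A, B}" for E
  proof -
    define F where "F = (if E = A then B else A)"
    have "closedin ?X F" using closedin_connected_components_of[of F ?X] AB(2) by (simp add: F_def)
    moreover have "topspace ?X = A \<union> B" using top un by simp
    then have "topspace ?X - F = E" unfolding F_def using disj that by auto
    ultimately show ?thesis by (metis openin_diff openin_topspace)
  qed
  then have op: "openin mtopology E" if "E \<in> {A, B}" for E
    using openin_trans_full[OF _ openin_compl_wall[OF reflectionD(1)[OF r]]] that by blast
  have "(half r x = A \<and> half r (r x) = B \<and> x \<in> A \<and> r x \<in> B) \<or>
        (half r x = B \<and> half r (r x) = A \<and> x \<in> B \<and> r x \<in> A)"
  proof (cases "x \<in> A")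
    case True
    then have "r x \<in> B" using AB(5) by blast
    then show ?thesis using half True by simp
  next
    case False
    then have "x \<in> B" "r x \<in> A" using x un AB(6) by blast+
    then show ?thesis using half by simp
  qed
  then show "r x \<in> M - wall r" "r x \<notin> half r x" "r ` half r x = half r (r x)"
    "half r x \<union> half r (r x) = M - wall r"
    "openin mtopology (half r x)" "geodesically_convex (half r x)"
    using un disj op AB by auto
qed

lemma half_cases:
  assumes "reflection r" "x \<in> M - wall r" "y \<in> M - wall r" "y \<notin> half r x"
  shows "half r y = half r (r x)"
proof -
  have "y \<in> half r (r x)" using reflection_half(4)[OF assms(1,2)] assms(3,4) by blast
  then show ?thesis
    using half_eq_iff[OF reflection_half(1)[OF assms(1,2)] assms(3)] by simp
qed

lemma geodesic_crosses_wall: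
  assumes "geodesic_space" "reflection r" "x \<in> M - wall r" "y \<in> M" "y \<notin> half r x"
  shows "\<exists>z\<in>wall r. d x z + d z y = d x y"
proof -
  obtain \<xi> where g: "geodesic x y \<xi>" using assms unfolding geodesic_space_def by blast
  let ?I = "\<xi> ` {0..d x y}"
  have "\<not> ?I \<subseteq> M - wall r"
    using connectedin_subset_half[OF connectedin_geodesic[OF g], of r x] assms(5)
      geodesic_endpoints_image[OF g] by blast
  moreover have "?I \<subseteq> M" using geodesic_endpoints[OF g] by blast
  ultimately obtain t where t: "t \<in> {0..d x y}" "\<xi> t \<in> wall r" by blast
  then show ?thesis
    using geodesic_dist_endpoints[OF g t(1)] by (intro bexI[of _ "\<xi> t"]) auto
qed

text \<open>The point \<open>z\<close> is equally far from \<open>x\<close> and \<open>r x\<close>.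
  Together with properness this bounds the number of walls near a point.\<close>

lemma dist_reflection_le:
  assumes "r \<in> isometries" "x \<in> M" "z \<in> wall r"
  shows "d x (r x) \<le> 2 * d x z"
proof -
  have z: "z \<in> M" "r z = z" using assms by (auto simp: wall_def)
  have "d x (r x) \<le> d x z + d z (r x)"
    using z assms isometriesD(2)[OF assms(1)] by (intro triangle) auto
  also have "d z (r x) = d z x" using isometriesD(3)[OF assms(1), of z x] z assms by simp
  finally show ?thesis by (simp add: commute)
qed

text \<open>The parameters outside \<open>D\<close> form a compact set, whose least element is the
  exit time; earlier parameters lie in \<open>D\<close> and come arbitrarily close.\<close>

lemma geodesic_exit:
  assumes "geodesic x y \<xi>" "openin mtopology D" "x \<in> D" "y \<notin> D"
  obtains t where "t \<in> {0..d x y}" "\<xi> t \<notin> D" "\<And>e. e > 0 \<Longrightarrow> \<exists>a\<in>D. d (\<xi> t) a < e"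
proof -
  let ?L = "{0..d x y}"
  have "openin (top_of_set ?L) {t \<in> ?L. \<xi> t \<in> D}"
    using openin_continuous_map_preimage[OF continuous_map_geodesic[OF assms(1)] assms(2)] by simp
  then have "closedin (top_of_set ?L) (?L - {t \<in> ?L. \<xi> t \<in> D})"
    using closedin_diff closedin_topspace topspace_euclidean_subtopology by metis
  then have "compact {t \<in> ?L. \<xi> t \<notin> D}"
    using closedin_compact[of ?L] by (simp add: set_diff_eq Collect_conj_eq[symmetric] conj_commute cong: conj_cong)
  moreover have "d x y \<in> {t \<in> ?L. \<xi> t \<notin> D}"
    using assms geodesic_endpoints[OF assms(1)] by auto
  ultimately obtain t where t: "t \<in> ?L" "\<xi> t \<notin> D" "\<And>s. s \<in> ?L \<Longrightarrow> \<xi> s \<notin> D \<Longrightarrow> t \<le> s"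
    using compact_attains_inf[of "{t \<in> ?L. \<xi> t \<notin> D}"] by blast
  have "t \<noteq> 0" using t assms geodesic_endpoints[OF assms(1)] by auto
  have "\<exists>a\<in>D. d (\<xi> t) a < e" if e: "e > 0" for e
  proof -
    define s where "s = max 0 (t - e / 2)"
    have s: "s \<in> ?L" "s < t" "t - s < e" using t e \<open>t \<noteq> 0\<close> by (auto simp: s_def)
    then have "\<xi> s \<in> D" using t(3)[of s] by auto
    then show ?thesis using geodesic_dist[OF assms(1) t(1) s(1)] s by (intro bexI[of _ "\<xi> s"]) auto
  qed
  with t that show ?thesis by blast
qed

end

context Metric_space
begin

section \<open>Transport under isometries\<close>

lemma geodesically_convex_image:
  assumes "f \<in> isometries" "geodesically_convex A"
  shows "geodesically_convex (f ` A)"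
  unfolding geodesically_convex_def
proof (intro conjI ballI allI impI)
  have AM: "A \<subseteq> M" using assms(2) by (simp add: geodesically_convex_def)
  then show "f ` A \<subseteq> M" using isometriesD(2)[OF assms(1)] by blast
  fix x y \<xi> assume "x \<in> f ` A" "y \<in> f ` A" and g: "geodesic x y \<xi>"
  then obtain a b where ab: "a \<in> A" "x = f a" "b \<in> A" "y = f b" by blast
  define \<eta> where "\<eta> = inv_into M f \<circ> \<xi>"
  have L: "d a b = d x y" using isometriesD(3)[OF assms(1), of a b] ab AM by (simp add: subset_iff)
  have \<eta>: "\<eta> t \<in> M" "f (\<eta> t) = \<xi> t" if "t \<in> {0..d x y}" for t
    using geodesic_endpoints(3)[OF g that] inv_into_into[of "\<xi> t" f M] f_inv_into_f[of "\<xi> t" f M]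
      isometriesD(4)[OF assms(1)] unfolding \<eta>_def by auto
  have "geodesic a b \<eta>"
    unfolding geodesic_def L
  proof (intro conjI ballI)
    show "\<eta> \<in> {0..d x y} \<rightarrow> M" using \<eta> by blast
    fix s t assume "s \<in> {0..d x y}" "t \<in> {0..d x y}"
    then show "d (\<eta> s) (\<eta> t) = \<bar>s - t\<bar>"
      using isometriesD(3)[OF assms(1), of "\<eta> s" "\<eta> t"] \<eta> geodesic_dist[OF g] by simp
  next
    show "\<eta> 0 = a" "\<eta> (d x y) = b"
      using geodesic_endpoints(1,2)[OF g] ab AM inv_into_f_f[OF isometriesD(5)[OF assms(1)]]
      unfolding \<eta>_def by auto
  qed
  then have "\<eta> ` {0..d x y} \<subseteq> A"
    using assms(2) ab(1,3) L unfolding geodesically_convex_def by metis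
  then show "\<xi> ` {0..d x y} \<subseteq> f ` A" using \<eta>(2) by force
qed

text \<open>\<open>r'\<close> is the conjugate of \<open>r\<close> by \<open>f\<close>. It is
  described by the intertwining equation on \<open>M\<close>, which avoids inverses and compositions
  of extensional maps.\<close>

lemma reflection_conj:
  assumes f: "f \<in> isometries" and r: "reflection r" and r': "r' \<in> isometries"
    and fr: "\<And>x. x \<in> M \<Longrightarrow> r' (f x) = f (r x)"
  shows "reflection r'" "wall r' = f ` wall r"
    "x \<in> M - wall r \<Longrightarrow> half r' (f x) = f ` half r x"
proof -
  note fM = isometriesD(2,4,5)[OF f]
  note rM = isometriesD(2)[OF reflectionD(1)[OF r]]
  have w: "wall r' = f ` wall r"
  proof (intro equalityI subsetI)
    fix y assume y: "y \<in> wall r'"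
    then obtain x where x: "x \<in> M" "y = f x" using fM(2) by (auto simp: wall_def)
    then have "f (r x) = f x" using y fr by (auto simp: wall_def)
    then have "r x = x" using inj_onD[OF fM(3)] rM x by blast
    then show "y \<in> f ` wall r" using x by (auto simp: wall_def)
  next
    fix y assume "y \<in> f ` wall r"
    then show "y \<in> wall r'" using fr fM(1) by (auto simp: wall_def)
  qed
  then show "wall r' = f ` wall r" .
  let ?X = "subtopology mtopology (M - wall r)" and ?Y = "subtopology mtopology (M - wall r')"
  have "f ` (M - wall r) = M - wall r'"
    using inj_on_image_set_diff[OF fM(3), of M "wall r"] fM(2) unfolding w by (auto simp: wall_def)
  then have hom: "homeomorphic_map ?X ?Y f"
    by (intro homeomorphic_map_subtopologies[OF homeomorphic_map_isometry[OF f]])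
      (simp add: Int_absorb1)
  show "half r' (f x) = f ` half r x" if "x \<in> M - wall r"
    unfolding half_def by (rule homeomorphic_map_connected_component_of[OF hom]) (use that in auto)
  obtain A B where AB: "A \<noteq> B" "connected_components_of ?X = {A, B}"
    "geodesically_convex A" "geodesically_convex B" "r ` A = B" "r ` B = A"
    using r unfolding reflection_def by (elim conjE exE) (rule that)
  have int: "mtopology interior_of wall r = {}" using r unfolding reflection_def by (elim conjE)
  have sub: "A \<subseteq> M" "B \<subseteq> M" using AB by (auto simp: geodesically_convex_def)
  have ne: "f ` A \<noteq> f ` B" using AB(1) inj_on_image_eq_iff[OF fM(3) sub] by simp
  have comps: "connected_components_of ?Y = {f ` A, f ` B}"
    using homeomorphic_map_connected_components_of[OF hom] AB(2) by simp
  have "r' ` f ` E = f ` r ` E" if "E \<subseteq> M" for E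
    unfolding image_image using fr that by (intro image_cong) auto
  from this[OF sub(1)] this[OF sub(2)] have sw: "r' ` f ` A = f ` B" "r' ` f ` B = f ` A" unfolding AB(5,6) .
  have cv: "geodesically_convex (f ` A)" "geodesically_convex (f ` B)"
    using geodesically_convex_image[OF f AB(3)] geodesically_convex_image[OF f AB(4)] .
  have invol: "r' (r' y) = y" if "y \<in> M" for y
  proof -
    have "y \<in> f ` M" using fM(2) that by simp
    then obtain x where "x \<in> M" "y = f x" by (rule imageE)
    then show ?thesis using fr rM reflectionD(2)[OF r] by simp
  qed
  have int': "mtopology interior_of wall r' = {}"
    using homeomorphic_map_interior_of[OF homeomorphic_map_isometry[OF f], of "wall r"] int w
    by (auto simp: wall_def)
  show "reflection r'"
    unfolding reflection_def
    by (intro conjI exI[of _ "f ` A"] exI[of _ "f ` B"] ballI r' ne comps cv sw invol int')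
qed

end

locale discrete_reflections = Metric_space M d for M :: "'a set" and d +
  fixes \<Gamma> :: "('a \<Rightarrow> 'a) set" and c :: 'a
  assumes geo: "geodesic_space"
    and sub: "subgroup \<Gamma> (BijGroup M)"
    and isos: "\<Gamma> \<subseteq> isometries"
    and properly: "proper_action \<Gamma>"
    and c: "c \<in> M"
    and c_wall: "\<And>r. r \<in> \<Gamma> \<Longrightarrow> reflection r \<Longrightarrow> c \<notin> wall r"
begin

section \<open>Group elements acting on points and reflections\<close>

definition "K = (BijGroup M)\<lparr>carrier := \<Gamma>\<rparr>"

lemma carrier_K [simp]: "carrier K = \<Gamma>"
  by (simp add: K_def)

sublocale K: group K
  using subgroup.subgroup_is_group[OF sub group_BijGroup] unfolding K_def .

definition "R = {r \<in> \<Gamma>. reflection r}"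

lemma R_D: "r \<in> R \<Longrightarrow> r \<in> \<Gamma>" "r \<in> R \<Longrightarrow> reflection r" "r \<in> R \<Longrightarrow> c \<in> M - wall r"
  using c c_wall by (auto simp: R_def)

lemma in_isometries: "\<gamma> \<in> \<Gamma> \<Longrightarrow> \<gamma> \<in> isometries"
  using isos by blast

lemma in_Bij: "\<gamma> \<in> \<Gamma> \<Longrightarrow> \<gamma> \<in> Bij M"
  using isos isometriesD(1) by blast

lemma act_closed [simp]: "\<gamma> \<in> \<Gamma> \<Longrightarrow> x \<in> M \<Longrightarrow> \<gamma> x \<in> M"
  using in_isometries isometriesD(2) by blast

lemma mult_apply [simp]: "\<gamma> \<in> \<Gamma> \<Longrightarrow> \<delta> \<in> \<Gamma> \<Longrightarrow> x \<in> M \<Longrightarrow> (\<gamma> \<otimes>\<^bsub>K\<^esub> \<delta>) x = \<gamma> (\<delta> x)"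
  using in_Bij by (simp add: K_def BijGroup_def compose_def)

lemma one_apply [simp]: "x \<in> M \<Longrightarrow> \<one>\<^bsub>K\<^esub> x = x"
  by (simp add: K_def BijGroup_def)

lemma mult_closed: "\<gamma> \<in> \<Gamma> \<Longrightarrow> \<delta> \<in> \<Gamma> \<Longrightarrow> \<gamma> \<otimes>\<^bsub>K\<^esub> \<delta> \<in> \<Gamma>"
  using K.m_closed by simp

lemma inv_closed: "\<gamma> \<in> \<Gamma> \<Longrightarrow> inv\<^bsub>K\<^esub> \<gamma> \<in> \<Gamma>"
  using K.inv_closed by simp

lemma inv_apply [simp]:
  assumes "\<gamma> \<in> \<Gamma>" "x \<in> M"
  shows "(inv\<^bsub>K\<^esub> \<gamma>) (\<gamma> x) = x" "\<gamma> ((inv\<^bsub>K\<^esub> \<gamma>) x) = x"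
  using mult_apply[OF inv_closed[OF assms(1)] assms] mult_apply[OF assms(1) inv_closed[OF assms(1)] assms(2)]
    K.l_inv[of \<gamma>] K.r_inv[of \<gamma>] one_apply[OF assms(2)] assms by auto

lemma group_eqI:
  assumes "\<gamma> \<in> \<Gamma>" "\<delta> \<in> \<Gamma>" "\<And>x. x \<in> M \<Longrightarrow> \<gamma> x = \<delta> x"
  shows "\<gamma> = \<delta>"
  using in_Bij[OF assms(1)] in_Bij[OF assms(2)] assms(3)
  by (auto simp: Bij_def intro: extensionalityI)

lemma conj_R:
  assumes "\<gamma> \<in> \<Gamma>" "r \<in> \<Gamma>" and rR: "inv\<^bsub>K\<^esub> \<gamma> \<otimes>\<^bsub>K\<^esub> r \<otimes>\<^bsub>K\<^esub> \<gamma> \<in> R" (is "?r' \<in> R")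
  shows "r \<in> R" "x \<in> M - wall ?r' \<Longrightarrow> half r (\<gamma> x) = \<gamma> ` half ?r' x" "wall r = \<gamma> ` wall ?r'"
proof -
  have eq: "r (\<gamma> x) = \<gamma> (?r' x)" if "x \<in> M" for x
    using assms(1,2) that by (simp add: mult_closed inv_closed)
  note * = reflection_conj[where f = \<gamma> and r = "?r'" and r' = r, OF in_isometries[OF assms(1)] R_D(2)[OF rR] in_isometries[OF assms(2)] eq]
  show "r \<in> R" using *(1) assms(2) by (simp add: R_def)
  show "x \<in> M - wall ?r' \<Longrightarrow> half r (\<gamma> x) = \<gamma> ` half ?r' x" by (rule *(3))
  show "wall r = \<gamma> ` wall ?r'" by (rule *(2))
qed

lemma conj_R_iff:
  assumes "\<gamma> \<in> \<Gamma>" "r \<in> \<Gamma>"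
  shows "inv\<^bsub>K\<^esub> \<gamma> \<otimes>\<^bsub>K\<^esub> r \<otimes>\<^bsub>K\<^esub> \<gamma> \<in> R \<longleftrightarrow> r \<in> R"
proof
  let ?r' = "inv\<^bsub>K\<^esub> \<gamma> \<otimes>\<^bsub>K\<^esub> r \<otimes>\<^bsub>K\<^esub> \<gamma>"
  assume "r \<in> R"
  moreover have "inv\<^bsub>K\<^esub> (inv\<^bsub>K\<^esub> \<gamma>) \<otimes>\<^bsub>K\<^esub> ?r' \<otimes>\<^bsub>K\<^esub> inv\<^bsub>K\<^esub> \<gamma> = r"
    using assms by (intro group_eqI) (auto simp: mult_closed inv_closed)
  ultimately show "?r' \<in> R"
    using conj_R(1)[of "inv\<^bsub>K\<^esub> \<gamma>" ?r'] assms by (simp add: inv_closed mult_closed)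
qed (rule conj_R(1)[OF assms])

text \<open>Conjugation permutes \<open>R\<close>, so \<open>\<gamma>\<close> permutes the
  walls.\<close>

lemma act_not_wall: "\<gamma> \<in> \<Gamma> \<Longrightarrow> r \<in> R \<Longrightarrow> x \<in> M \<Longrightarrow> (\<And>r. r \<in> R \<Longrightarrow> x \<notin> wall r) \<Longrightarrow> \<gamma> x \<in> M - wall r"
proof -
  assume a: "\<gamma> \<in> \<Gamma>" "r \<in> R" "x \<in> M" "\<And>r. r \<in> R \<Longrightarrow> x \<notin> wall r"
  let ?r' = "inv\<^bsub>K\<^esub> \<gamma> \<otimes>\<^bsub>K\<^esub> r \<otimes>\<^bsub>K\<^esub> \<gamma>"
  have R: "?r' \<in> R" using conj_R_iff[OF a(1) R_D(1)[OF a(2)]] a(2) by blast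
  have "\<gamma> x \<notin> \<gamma> ` wall ?r'"
    using a(4)[OF R] inj_onD[OF isometriesD(5)[OF in_isometries[OF a(1)]]] a(3)
    by (auto simp: wall_def)
  then show ?thesis using conj_R(3)[OF a(1) R_D(1)[OF a(2)] R] a by simp
qed

section \<open>The separation cocycle and local finiteness\<close>

definition N :: "('a \<Rightarrow> 'a) \<Rightarrow> ('a \<Rightarrow> 'a) set" where
  "N \<gamma> = {r \<in> R. \<gamma> c \<notin> half r c}"

lemma c_not_wall: "r \<in> R \<Longrightarrow> c \<notin> wall r"
  using R_D(3) by blast

lemma act_c: "\<gamma> \<in> \<Gamma> \<Longrightarrow> r \<in> R \<Longrightarrow> \<gamma> c \<in> M - wall r"
  using act_not_wall c c_not_wall by blast

text \<open>The wall of \<open>r\<close> separates c from abc if and only if it separates exactly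
  one of the pairs (c, ac) and (ac, abc), because there are just two sides. Applying a^-1 turns the
  second pair into (c, bc) and \<open>r\<close> into a^-1 r a.\<close>

lemma N_mult:
  assumes "a \<in> \<Gamma>" "b \<in> \<Gamma>" "r \<in> \<Gamma>"
  shows "r \<in> N (a \<otimes>\<^bsub>K\<^esub> b) \<longleftrightarrow> (r \<in> N a) \<noteq> (inv\<^bsub>K\<^esub> a \<otimes>\<^bsub>K\<^esub> r \<otimes>\<^bsub>K\<^esub> a \<in> N b)"
proof (cases "r \<in> R")
  case True
  let ?r' = "inv\<^bsub>K\<^esub> a \<otimes>\<^bsub>K\<^esub> r \<otimes>\<^bsub>K\<^esub> a"
  have R': "?r' \<in> R" using conj_R_iff[OF assms(1,3)] True by blast
  have m: "c \<in> M - wall r" "a c \<in> M - wall r" "a (b c) \<in> M - wall r" "(a \<otimes>\<^bsub>K\<^esub> b) c = a (b c)"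
    using act_c[OF assms(1) True] act_c[OF mult_closed[OF assms(1,2)] True] R_D(3)[OF True]
      mult_apply[OF assms(1,2) c] by simp_all
  have "a (b c) \<in> half r (a c) \<longleftrightarrow> b c \<in> half ?r' c"
  proof -
    have "half r (a c) = a ` half ?r' c" using conj_R(2)[OF assms(1,3) R'] R_D(3)[OF R'] by simp
    moreover have "b c \<in> M" "half ?r' c \<subseteq> M" using assms c half_subset by auto
    ultimately show ?thesis
      using inj_on_image_mem_iff[OF isometriesD(5)[OF in_isometries[OF assms(1)]]] by simp
  qed
  moreover have "a (b c) \<in> half r c \<longleftrightarrow> (a c \<in> half r c) = (a (b c) \<in> half r (a c))"
  proof (cases "a c \<in> half r c")
    case True
    then show ?thesis using half_eq_iff[OF m(1,2)] by simp
  next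
    case False
    then have h: "half r (a c) = half r (r c)"
      using half_cases[OF R_D(2)[OF \<open>r \<in> R\<close>]] m by blast
    note rh = reflection_half[OF R_D(2)[OF \<open>r \<in> R\<close>] m(1)]
    have "a (b c) \<in> half r c \<union> half r (r c)" using rh(4) m by blast
    moreover have "\<not> (a (b c) \<in> half r c \<and> a (b c) \<in> half r (r c))"
      using half_eq_iff[OF m(1) m(3)] half_eq_iff[OF rh(1) m(3)] half_refl[OF rh(1)] rh(2) by metis
    ultimately show ?thesis using False h by blast
  qed
  ultimately show ?thesis using m True R' by (auto simp: N_def)
next
  case False
  then show ?thesis using conj_R_iff[OF assms(1,3)] by (simp add: N_def)
qed

lemma finite_near: "x \<in> M \<Longrightarrow> finite {\<gamma> \<in> \<Gamma>. d x (\<gamma> x) \<le> B}"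
proof (rule finite_subset)
  assume "x \<in> M"
  then show "finite {\<gamma> \<in> \<Gamma>. \<gamma> x \<in> mball x (\<bar>B\<bar> + 1)}"
    using properly unfolding proper_action_def by simp
  show "{\<gamma> \<in> \<Gamma>. d x (\<gamma> x) \<le> B} \<subseteq> {\<gamma> \<in> \<Gamma>. \<gamma> x \<in> mball x (\<bar>B\<bar> + 1)}"
    using \<open>x \<in> M\<close> by auto
qed

lemma dist_wall:
  assumes "r \<in> R" "x \<in> M" "x \<notin> wall r" "y \<in> M" "y \<notin> half r x"
  shows "d x (r x) \<le> 2 * d x y"
proof -
  obtain z where z: "z \<in> wall r" "d x z + d z y = d x y"
    using geodesic_crosses_wall[OF geo R_D(2)[OF assms(1)], of x y] assms by blast
  have "d x (r x) \<le> 2 * d x z"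
    using dist_reflection_le[OF in_isometries[OF R_D(1)[OF assms(1)]] assms(2) z(1)] .
  then show ?thesis using z nonneg[of z y] by linarith
qed

lemma finite_N: "\<gamma> \<in> \<Gamma> \<Longrightarrow> finite (N \<gamma>)"
proof (rule finite_subset)
  assume g: "\<gamma> \<in> \<Gamma>"
  show "N \<gamma> \<subseteq> {r \<in> \<Gamma>. d c (r c) \<le> 2 * d c (\<gamma> c)}"
    using dist_wall[OF _ c c_not_wall act_closed[OF g c]] by (auto simp: N_def R_D(1))
  show "finite {r \<in> \<Gamma>. d c (r c) \<le> 2 * d c (\<gamma> c)}" by (rule finite_near[OF c])
qed

text \<open>Only finitely many reflections move \<open>x\<close> by at most 2, and their open sides
  intersect in a neighbourhood. By \<open>dist_wall\<close>, any other wall is too far away to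
  separate \<open>x\<close> from a point of the unit ball.\<close>

lemma locally_same_side:
  assumes "x \<in> M"
  obtains e where "e > 0" "\<And>r y. r \<in> R \<Longrightarrow> x \<notin> wall r \<Longrightarrow> y \<in> mball x e \<Longrightarrow> y \<in> half r x"
proof -
  let ?F = "{r \<in> R. x \<notin> wall r \<and> d x (r x) \<le> 2}"
  have "finite ((\<lambda>r. half r x) ` ?F)"
    using finite_near[OF assms, of 2] by (auto simp: R_def intro: finite_subset[rotated])
  moreover have "openin mtopology A" if "A \<in> (\<lambda>r. half r x) ` ?F" for A
    using that reflection_half(5) R_D(2) assms by auto
  ultimately have "openin mtopology (mball x 1 \<inter> \<Inter>((\<lambda>r. half r x) ` ?F))"
    by (intro openin_Int_Inter) auto
  moreover have "x \<in> mball x 1 \<inter> \<Inter>((\<lambda>r. half r x) ` ?F)"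
    using assms half_refl by auto
  ultimately obtain e where e: "e > 0" "mball x e \<subseteq> mball x 1 \<inter> \<Inter>((\<lambda>r. half r x) ` ?F)"
    unfolding openin_mtopology by blast
  have "y \<in> half r x" if r: "r \<in> R" "x \<notin> wall r" "y \<in> mball x e" for r y
  proof (cases "r \<in> ?F")
    case True
    then show ?thesis using e r by blast
  next
    case False
    then have "2 < d x (r x)" using r by auto
    moreover have "y \<in> mball x 1" using e r by blast
    ultimately show ?thesis using dist_wall[OF r(1) assms r(2), of y] by force
  qed
  with e(1) that show ?thesis by blast
qed

section \<open>The chamber of the base point\<close>

definition C :: "'a set" where
  "C = {x \<in> M. \<forall>r\<in>R. x \<in> half r c}"

lemma c_in_C: "c \<in> C"
  using c R_D(3) half_refl by (auto simp: C_def)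

lemma C_not_wall: "x \<in> C \<Longrightarrow> r \<in> R \<Longrightarrow> x \<in> M - wall r"
  using half_subset by (auto simp: C_def)

lemma convex_half: "r \<in> R \<Longrightarrow> geodesically_convex (half r c)"
  using reflection_half(6)[OF R_D(2) R_D(3)] .

lemma geodesically_convex_C: "geodesically_convex C"
  unfolding geodesically_convex_def
proof (intro conjI ballI allI impI)
  show "C \<subseteq> M" by (auto simp: C_def)
  fix x y \<xi> assume xy: "x \<in> C" "y \<in> C" and g: "geodesic x y \<xi>"
  have "\<xi> ` {0..d x y} \<subseteq> half r c" if "r \<in> R" for r
    using convex_half[OF that] xy that g unfolding C_def geodesically_convex_def by blast
  then show "\<xi> ` {0..d x y} \<subseteq> C" using geodesic_endpoints(3)[OF g] by (auto simp: C_def)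
qed

text \<open>An intersection of convex half-spaces is convex, hence connected; conversely the
  component avoids every wall and so stays in each half-space of \<open>c\<close>.\<close>

lemma C_component:
  "C = connected_component_of_set (subtopology mtopology (M - (\<Union>r\<in>R. wall r))) c"
  (is "_ = connected_component_of_set ?X c")
proof
  have "connectedin ?X C"
    unfolding connectedin_subtopology
    using connectedin_geodesically_convex[OF geo geodesically_convex_C] C_not_wall by (auto simp: C_def)
  then show "C \<subseteq> connected_component_of_set ?X c"
    by (rule connected_component_of_maximal[OF _ c_in_C])
  have con: "connectedin ?X (connected_component_of_set ?X c)" by (rule connectedin_connected_component_of)
  have "c \<in> topspace ?X" using c c_not_wall by auto
  then have cc: "c \<in> connected_component_of_set ?X c" by (simp add: connected_component_of_refl)
  show "connected_component_of_set ?X c \<subseteq> C"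
  proof
    fix y assume y: "y \<in> connected_component_of_set ?X c"
    have s: "connected_component_of_set ?X c \<subseteq> M - (\<Union>r\<in>R. wall r)"
      using con by (simp add: connectedin_subtopology)
    have "connected_component_of_set ?X c \<subseteq> half r c" if "r \<in> R" for r
      using con s that cc by (intro connectedin_subset_half) (auto simp: connectedin_subtopology)
    then show "y \<in> C" using y s by (auto simp: C_def)
  qed
qed

lemma C_eq_half: "x \<in> C \<Longrightarrow> r \<in> R \<Longrightarrow> half r x = half r c"
  using half_eq_iff[of c r x] R_D(3)[of r] C_not_wall[of x r] by (auto simp: C_def)

lemma openin_C: "openin mtopology C"
  unfolding openin_mtopology
proof (intro conjI allI impI)
  show "C \<subseteq> M" by (auto simp: C_def)
  fix x assume x: "x \<in> C"
  then obtain e where e: "e > 0" "\<And>r y. r \<in> R \<Longrightarrow> x \<notin> wall r \<Longrightarrow> y \<in> mball x e \<Longrightarrow> y \<in> half r x"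
    using locally_same_side[of x] by (auto simp: C_def)
  have "mball x e \<subseteq> C"
  proof
    fix y assume y: "y \<in> mball x e"
    then have "y \<in> half r c" if "r \<in> R" for r
      using e(2)[OF that _ y] C_not_wall[OF x that] C_eq_half[OF x that] by auto
    then show "y \<in> C" using y by (auto simp: C_def)
  qed
  then show "\<exists>e>0. mball x e \<subseteq> C" using e by blast
qed

text \<open>A point off all walls has a ball that lies on its own side of every wall; that ball
  contains points of \<open>C\<close>, so the point would lie in \<open>C\<close> itself.\<close>

lemma boundary_C_wall:
  assumes "z \<in> M" "z \<notin> C" "\<And>e. e > 0 \<Longrightarrow> \<exists>a\<in>C. d z a < e"
  shows "\<exists>r\<in>R. z \<in> wall r"
proof (rule ccontr)
  assume n: "\<not> (\<exists>r\<in>R. z \<in> wall r)"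
  obtain e where e: "e > 0" "\<And>r y. r \<in> R \<Longrightarrow> z \<notin> wall r \<Longrightarrow> y \<in> mball z e \<Longrightarrow> y \<in> half r z"
    using locally_same_side[OF assms(1)] by blast
  obtain a where a: "a \<in> C" "d z a < e" using assms(3)[OF e(1)] by blast
  have "z \<in> half r c" if r: "r \<in> R" for r
  proof -
    have z: "z \<in> M - wall r" using n r assms(1) by blast
    have "a \<in> half r z" using e(2)[OF r, of a] n r a assms(1) C_not_wall[OF a(1) r] by auto
    then have "half r z = half r a" using half_eq_iff[OF z C_not_wall[OF a(1) r]] by simp
    then show ?thesis using half_refl[OF z] C_eq_half[OF a(1) r] by simp
  qed
  then show False using assms by (auto simp: C_def)
qed

lemma wall_if_opposite_limits:
  assumes r: "r \<in> R" and z: "z \<in> M"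
    and 1: "\<And>e. e > 0 \<Longrightarrow> \<exists>a\<in>M - wall r. a \<in> half r c \<and> d z a < e"
    and 2: "\<And>e. e > 0 \<Longrightarrow> \<exists>a\<in>M - wall r. a \<notin> half r c \<and> d z a < e"
  shows "z \<in> wall r"
proof (rule ccontr)
  assume nz: "z \<notin> wall r"
  obtain e where e: "e > 0" "\<And>r y. r \<in> R \<Longrightarrow> z \<notin> wall r \<Longrightarrow> y \<in> mball z e \<Longrightarrow> y \<in> half r z"
    using locally_same_side[OF z] by blast
  obtain a b where a: "a \<in> M - wall r" "a \<in> half r c" "d z a < e"
    and b: "b \<in> M - wall r" "b \<notin> half r c" "d z b < e" using 1 2 e(1) by blast
  have "a \<in> half r z" "b \<in> half r z" using e(2)[OF r nz] a b z by auto
  then have "half r a = half r b" using half_eq_iff[of z r] nz z a b by auto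
  moreover have "half r c = half r a" using half_eq_iff[of c r a] R_D(3)[OF r] a by auto
  ultimately show False using half_refl[OF b(1)] b(2) by simp
qed

text \<open>\<open>\<gamma>\<close> carries the sides of the conjugate walls that contain
  \<open>C\<close> to the sides that contain \<open>\<gamma> a\<close>. Hence
  \<open>\<gamma> c\<close> is on the side of \<open>\<gamma> a\<close>, which is that of
  \<open>c\<close>.\<close>

lemma N_empty_if_meets:
  assumes "\<gamma> \<in> \<Gamma>" "a \<in> C" "\<gamma> a \<in> C"
  shows "N \<gamma> = {}"
proof -
  have "\<gamma> c \<in> half r c" if r: "r \<in> R" for r
  proof -
    let ?r' = "inv\<^bsub>K\<^esub> \<gamma> \<otimes>\<^bsub>K\<^esub> r \<otimes>\<^bsub>K\<^esub> \<gamma>"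
    have R': "?r' \<in> R" using conj_R_iff[OF assms(1) R_D(1)[OF r]] r by blast
    have aM: "a \<in> M - wall ?r'" using C_not_wall[OF assms(2) R'] .
    have "half r c = half r (\<gamma> a)" using C_eq_half[OF assms(3) r] by simp
    also have "\<dots> = \<gamma> ` half ?r' a" using conj_R(2)[OF assms(1) R_D(1)[OF r] R'] aM by blast
    also have "half ?r' a = half ?r' c" using C_eq_half[OF assms(2) R'] .
    finally show ?thesis using half_refl[OF R_D(3)[OF R']] by simp
  qed
  then show ?thesis by (auto simp: N_def)
qed

lemma N_empty_subset:
  assumes "\<gamma> \<in> \<Gamma>" "N \<gamma> = {}"
  shows "\<gamma> ` C \<subseteq> C"
proof
  fix y assume "y \<in> \<gamma> ` C"
  then obtain x where x: "x \<in> C" "y = \<gamma> x" by blast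
  have "\<gamma> x \<in> half r c" if r: "r \<in> R" for r
  proof -
    let ?r' = "inv\<^bsub>K\<^esub> \<gamma> \<otimes>\<^bsub>K\<^esub> r \<otimes>\<^bsub>K\<^esub> \<gamma>"
    have R': "?r' \<in> R" using conj_R_iff[OF assms(1) R_D(1)[OF r]] r by blast
    have "\<gamma> c \<in> half r c" using assms(2) r by (auto simp: N_def)
    then have "half r c = half r (\<gamma> c)" using half_eq_iff[OF R_D(3)[OF r] act_c[OF assms(1) r]] by simp
    also have "\<dots> = \<gamma> ` half ?r' c"
      using conj_R(2)[OF assms(1) R_D(1)[OF r] R'] R_D(3)[OF R'] by blast
    finally show ?thesis using x(1) R' by (auto simp: C_def)
  qed
  then show "y \<in> C" using x assms(1) by (auto simp: C_def)
qed

text \<open>The inverse takes \<open>\<gamma> c\<close> to \<open>c\<close>, both in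
  \<open>C\<close>, so its cocycle value is empty as well and the inclusion applies to it
  too.\<close>

lemma N_empty_stabilizes:
  assumes "\<gamma> \<in> \<Gamma>" "N \<gamma> = {}"
  shows "\<gamma> ` C = C"
proof
  show "\<gamma> ` C \<subseteq> C" by (rule N_empty_subset[OF assms])
  have "\<gamma> (c) \<in> C" using N_empty_subset[OF assms] c_in_C by blast
  then have "N (inv\<^bsub>K\<^esub> \<gamma>) = {}"
    using N_empty_if_meets[OF inv_closed[OF assms(1)], of "\<gamma> c"] c_in_C assms c by simp
  then have "(inv\<^bsub>K\<^esub> \<gamma>) ` C \<subseteq> C" by (rule N_empty_subset[OF inv_closed[OF assms(1)]])
  then show "C \<subseteq> \<gamma> ` C"
    using inv_apply(2)[OF assms(1)] by (force simp: C_def)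
qed

end


section \<open>Cocompact groups\<close>

locale cocompact_reflections = discrete_reflections +
  assumes compact: "compactin mtopology (mtopology closure_of C)"
    and free: "\<And>\<gamma>. \<gamma> \<in> \<Gamma> \<Longrightarrow> \<gamma> ` C = C \<Longrightarrow> \<gamma> = \<one>\<^bsub>K\<^esub>"
begin

definition T :: "('a \<Rightarrow> 'a) set" where
  "T = {r \<in> R. \<exists>z\<in>wall r. z \<in> mtopology closure_of C}"

lemma C_subset: "C \<subseteq> M"
  by (auto simp: C_def)

text \<open>The closed chamber is bounded, so these reflections move \<open>c\<close> by a bounded
  amount, and properness leaves finitely many.\<close>

lemma finite_T: "finite T"
proof -
  have "mbounded (mtopology closure_of C)" by (rule compactin_imp_mbounded[OF compact])
  then obtain B where B: "\<And>x y. x \<in> mtopology closure_of C \<Longrightarrow> y \<in> mtopology closure_of C \<Longrightarrow> d x y \<le> B"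
    unfolding mbounded_alt by blast
  have cC: "c \<in> mtopology closure_of C"
    using closure_of_subset[of C mtopology] C_subset c_in_C by auto
  have "T \<subseteq> {\<gamma> \<in> \<Gamma>. d c (\<gamma> c) \<le> 2 * B}"
  proof
    fix r assume "r \<in> T"
    then obtain z where z: "r \<in> R" "z \<in> wall r" "z \<in> mtopology closure_of C" by (auto simp: T_def)
    have "d c (r c) \<le> 2 * d c z"
      by (rule dist_reflection_le[OF in_isometries[OF R_D(1)[OF z(1)]] c z(2)])
    then show "r \<in> {\<gamma> \<in> \<Gamma>. d c (\<gamma> c) \<le> 2 * B}" using B[OF cC z(3)] R_D(1)[OF z(1)] by simp
  qed
  then show ?thesis using finite_near[OF c] by (rule finite_subset)
qed

text \<open>The last clause records that \<open>z\<close> lies on a geodesic from \<open>c\<close>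
  to \<open>y\<close>: every convex set containing both end points contains
  \<open>z\<close>.\<close>

lemma exit_chamber:
  assumes "y \<in> M" "y \<notin> C"
  obtains z r where "z \<in> M" "z \<notin> C" "r \<in> T" "z \<in> wall r" "\<And>e. e > 0 \<Longrightarrow> \<exists>a\<in>C. d z a < e"
    "\<And>A. geodesically_convex A \<Longrightarrow> c \<in> A \<Longrightarrow> y \<in> A \<Longrightarrow> z \<in> A"
proof -
  obtain \<xi> where g: "geodesic c y \<xi>" using geo c assms(1) unfolding geodesic_space_def by blast
  obtain t where t: "t \<in> {0..d c y}" "\<xi> t \<notin> C" "\<And>e. e > 0 \<Longrightarrow> \<exists>a\<in>C. d (\<xi> t) a < e"
    using geodesic_exit[OF g openin_C c_in_C assms(2)] by blast
  have M: "\<xi> t \<in> M" using geodesic_endpoints(3)[OF g t(1)] .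
  obtain r where r: "r \<in> R" "\<xi> t \<in> wall r" using boundary_C_wall[OF M t(2,3)] by blast
  have "\<xi> t \<in> mtopology closure_of C"
    unfolding metric_closure_of using M t(3) C_subset by fastforce
  then have "r \<in> T" using r by (auto simp: T_def)
  moreover have "\<xi> t \<in> A" if "geodesically_convex A" "c \<in> A" "y \<in> A" for A
    using that g t(1) unfolding geodesically_convex_def by blast
  ultimately show ?thesis using that M t r by blast
qed

text \<open>A point on the right side of every wall in \<open>T\<close> but outside \<open>C\<close>
  would force the exit point of a geodesic from \<open>c\<close> into the half-space of a wall on
  which it lies.\<close>

lemma C_eq_T: "C = {x \<in> M. \<forall>r\<in>T. x \<in> half r c}"
proof
  show "C \<subseteq> {x \<in> M. \<forall>r\<in>T. x \<in> half r c}" by (auto simp: C_def T_def)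
  show "{x \<in> M. \<forall>r\<in>T. x \<in> half r c} \<subseteq> C"
  proof
    fix y assume y: "y \<in> {x \<in> M. \<forall>r\<in>T. x \<in> half r c}"
    show "y \<in> C"
    proof (rule ccontr)
      assume "y \<notin> C"
      with y have yM: "y \<in> M" "y \<notin> C" by auto
      obtain z r where z: "z \<in> M" "z \<notin> C" "r \<in> T" "z \<in> wall r" "\<And>e. e > 0 \<Longrightarrow> \<exists>a\<in>C. d z a < e"
        "\<And>A. geodesically_convex A \<Longrightarrow> c \<in> A \<Longrightarrow> y \<in> A \<Longrightarrow> z \<in> A"
        by (rule exit_chamber[OF yM]) (rule that)
      have r: "r \<in> R" using z(3) by (simp add: T_def)
      have "y \<in> half r c" using y z(3) by blast
      then have "z \<in> half r c" by (rule z(6)[OF convex_half[OF r] half_refl[OF R_D(3)[OF r]]])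
      then show False using half_subset z(4) by blast
    qed
  qed
qed

definition S :: "('a \<Rightarrow> 'a) set" where
  "S = (SOME S. (S \<subseteq> T \<and> C = {x \<in> M. \<forall>r\<in>S. x \<in> half r c}) \<and>
     (\<forall>S'. S' \<subseteq> T \<and> C = {x \<in> M. \<forall>r\<in>S'. x \<in> half r c} \<longrightarrow> card S \<le> card S'))"

lemma S: "S \<subseteq> T" "C = {x \<in> M. \<forall>r\<in>S. x \<in> half r c}"
  "\<And>S'. S' \<subseteq> T \<Longrightarrow> C = {x \<in> M. \<forall>r\<in>S'. x \<in> half r c} \<Longrightarrow> card S \<le> card S'"
proof -
  have "\<exists>S. (S \<subseteq> T \<and> C = {x \<in> M. \<forall>r\<in>S. x \<in> half r c}) \<and>
     (\<forall>S'. S' \<subseteq> T \<and> C = {x \<in> M. \<forall>r\<in>S'. x \<in> half r c} \<longrightarrow> card S \<le> card S')"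
    by (rule ex_has_least_nat[of _ T]) (rule conjI[OF order.refl C_eq_T])
  from someI_ex[OF this, folded S_def]
  show "S \<subseteq> T" "C = {x \<in> M. \<forall>r\<in>S. x \<in> half r c}"
    "\<And>S'. S' \<subseteq> T \<Longrightarrow> C = {x \<in> M. \<forall>r\<in>S'. x \<in> half r c} \<Longrightarrow> card S \<le> card S'"
    by simp_all
qed

lemma S_R: "s \<in> S \<Longrightarrow> s \<in> R"
  using S(1) by (auto simp: T_def)

lemma finite_S: "finite S"
  using S(1) finite_T by (rule finite_subset)

text \<open>By minimality of \<open>S\<close>, some point violates only the half-space condition of \<open>s\<close>. A geodesic
  from \<open>c\<close> to it leaves \<open>C\<close> at a point of the wall of \<open>s\<close> that is interior to all other half-spaces
  bounding \<open>C\<close>; near that point there are only the chambers \<open>C\<close> and \<open>s C\<close>.\<close>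

lemma wall_facet:
  assumes s: "s \<in> S"
  obtains z e where "z \<in> wall s" "e > 0" "\<And>e. e > 0 \<Longrightarrow> \<exists>a\<in>C. d z a < e"
    "\<And>x. x \<in> mball z e \<Longrightarrow> x \<in> half s c \<Longrightarrow> x \<in> C"
proof -
  let ?D = "{x \<in> M. \<forall>r\<in>S - {s}. x \<in> half r c}"
  have "card (S - {s}) < card S" using finite_S s by (rule card_Diff1_less)
  then have "C \<noteq> ?D" using S(3)[of "S - {s}"] S(1) by (meson Diff_subset leD order.trans)
  moreover have "C \<subseteq> ?D" using S(2) by blast
  ultimately obtain y where y: "y \<in> ?D" "y \<notin> C" by blast
  then have yM: "y \<in> M" by simp
  obtain z r where z: "z \<in> M" "z \<notin> C" "r \<in> T" "z \<in> wall r" "\<And>e. e > 0 \<Longrightarrow> \<exists>a\<in>C. d z a < e"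
    "\<And>A. geodesically_convex A \<Longrightarrow> c \<in> A \<Longrightarrow> y \<in> A \<Longrightarrow> z \<in> A"
    by (rule exit_chamber[OF yM y(2)]) (rule that)
  have zt: "z \<in> half r c" if "r \<in> S - {s}" for r
  proof -
    have r: "r \<in> R" "y \<in> half r c" using S_R y(1) that by blast+
    show ?thesis by (rule z(6)[OF convex_half[OF r(1)] half_refl[OF R_D(3)[OF r(1)]] r(2)])
  qed
  then have zs: "z \<notin> half s c" using z(1,2) S(2) by blast
  obtain e where e: "e > 0" "\<And>r y. r \<in> R \<Longrightarrow> z \<notin> wall r \<Longrightarrow> y \<in> mball z e \<Longrightarrow> y \<in> half r z"
    using locally_same_side[OF z(1)] by blast
  have near: "x \<in> half r c" if "x \<in> mball z e" "r \<in> S - {s}" for x r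
  proof -
    have r: "r \<in> R" "z \<in> M - wall r" using S_R that zt half_subset by blast+
    have "half r z = half r c" using half_eq_iff[OF R_D(3)[OF r(1)] r(2)] zt[OF that(2)] by simp
    then show ?thesis using e(2)[OF r(1) _ that(1)] r(2) by blast
  qed
  \<comment> \<open>\<open>z\<close> lies outside the half-space of \<open>s\<close> but is a limit
    of points of \<open>C\<close>; off the wall it would have a neighbourhood on its own
    side.\<close>
  have sw: "z \<in> wall s"
  proof (rule ccontr)
    assume nz: "z \<notin> wall s"
    obtain a where a: "a \<in> C" "d z a < e" using z(5)[OF e(1)] by blast
    have "a \<in> half s z" using e(2)[OF S_R[OF s] nz, of a] a C_subset z(1) by auto
    then have "half s z = half s a"
      using half_eq_iff[of z s a] nz z(1) C_not_wall[OF a(1) S_R[OF s]] by blast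
    then show False using half_refl[of z s] nz z(1) zs C_eq_half[OF a(1) S_R[OF s]] by blast
  qed
  have "x \<in> C" if "x \<in> mball z e" "x \<in> half s c" for x
  proof -
    have "x \<in> M" using that by auto
    moreover have "x \<in> half r c" if "r \<in> S" for r using near that \<open>x \<in> mball z e\<close> \<open>x \<in> half s c\<close> by blast
    ultimately show ?thesis using S(2) by blast
  qed
  from that[OF sw e(1) z(5) this] show ?thesis .
qed

text \<open>Let z be the facet point of s. If r is in N(s), then C and sC lie on different sides of
  r, and both accumulate at z, so r fixes z. Near z, r moves a point of C out of C, hence across the
  wall of s, and s brings it back into C. So s r maps a point of C into C and is trivial.\<close>

lemma N_gen:
  assumes s: "s \<in> S"
  shows "N s = {s}"
proof (intro equalityI subsetI)
  fix r assume "r \<in> {s}"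
  then show "r \<in> N s"
    using S_R[OF s] reflection_half(2)[OF R_D(2) R_D(3)] by (simp add: N_def)
next
  fix r assume "r \<in> N s"
  then have r: "r \<in> R" "s c \<notin> half r c" by (auto simp: N_def)
  have sR: "s \<in> R" "s \<in> \<Gamma>" and rG: "r \<in> \<Gamma>" using S_R[OF s] R_D(1) r by blast+
  obtain z e where z: "z \<in> wall s" "e > 0" "\<And>e. e > 0 \<Longrightarrow> \<exists>a\<in>C. d z a < e"
    "\<And>x. x \<in> mball z e \<Longrightarrow> x \<in> half s c \<Longrightarrow> x \<in> C"
    by (rule wall_facet[OF s]) (rule that)
  have zM: "z \<in> M" "s z = z" using z(1) by (auto simp: wall_def)
  have aM: "a \<in> M" if "a \<in> C" for a using C_subset that by blast
  have Cw: "a \<notin> wall q" if "a \<in> C" "q \<in> R" for a q using C_not_wall[OF that] by blast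
  have zr: "z \<in> wall r"
  proof (rule wall_if_opposite_limits[OF r(1) zM(1)])
    fix e :: real assume "e > 0"
    then obtain a where a: "a \<in> C" "d z a < e" using z(3) by blast
    have "a \<in> half r c" using a(1) r(1) by (auto simp: C_def)
    then show "\<exists>a\<in>M - wall r. a \<in> half r c \<and> d z a < e" using a C_not_wall[OF a(1) r(1)] by blast
    let ?q = "inv\<^bsub>K\<^esub> s \<otimes>\<^bsub>K\<^esub> r \<otimes>\<^bsub>K\<^esub> s"
    have q: "?q \<in> R" using conj_R_iff[OF sR(2) rG] r(1) by blast
    have sa: "s a \<in> M - wall r" using act_not_wall[OF sR(2) r(1) aM[OF a(1)]] Cw[OF a(1)] by blast
    have "half r (s a) = s ` half ?q a"
      using conj_R(2)[OF sR(2) rG q] C_not_wall[OF a(1) q] by blast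
    also have "\<dots> = s ` half ?q c" using C_eq_half[OF a(1) q] by simp
    also have "\<dots> = half r (s c)"
      using conj_R(2)[OF sR(2) rG q] R_D(3)[OF q] by blast
    finally have "half r (s a) = half r (s c)" .
    then have "s a \<notin> half r c"
      using half_eq_iff[OF R_D(3)[OF r(1)] sa] half_eq_iff[OF R_D(3)[OF r(1)] act_c[OF sR(2) r(1)]] r(2)
      by simp
    moreover have "d z (s a) < e"
      using a isometriesD(3)[OF in_isometries[OF sR(2)] zM(1) aM[OF a(1)]] zM(2) by simp
    ultimately show "\<exists>a\<in>M - wall r. a \<notin> half r c \<and> d z a < e" using sa by blast
  qed
  obtain a where a: "a \<in> C" "d z a < e" using z(2,3) by blast
  have am: "a \<in> M" using aM[OF a(1)] .
  have dist: "d z (q x) = d z x" if "q \<in> \<Gamma>" "z \<in> wall q" "x \<in> M" for q x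
    using isometriesD(3)[OF in_isometries[OF that(1)] zM(1) that(3)] that(2) by (simp add: wall_def)
  have ra: "r a \<in> M - wall q" if "q \<in> R" for q
    using act_not_wall[OF rG that am] Cw[OF a(1)] by blast
  have raC: "r a \<notin> C"
  proof
    assume "r a \<in> C"
    then have "half r (r a) = half r a" using C_eq_half a(1) r(1) by simp
    then show False
      using reflection_half(1,2)[OF R_D(2)[OF r(1)] C_not_wall[OF a(1) r(1)]] half_refl by blast
  qed
  have rab: "r a \<in> mball z e" using dist[OF rG zr am] a(2) zM(1) am rG by simp
  have "r a \<notin> half s c" using z(4)[OF rab] raC by blast
  then have "half s (r a) = half s (s c)"
    using half_cases[OF R_D(2)[OF sR(1)] R_D(3)[OF sR(1)] ra[OF sR(1)]] by blast
  then have "s (r a) \<in> s ` half s (s c)" using half_refl[OF ra[OF sR(1)]] by blast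
  also have "s ` half s (s c) = half s (s (s c))"
    by (rule reflection_half(3)[OF R_D(2)[OF sR(1)] act_c[OF sR(2,1)]])
  also have "s (s c) = c" by (rule reflectionD(2)[OF R_D(2)[OF sR(1)] c])
  finally have "s (r a) \<in> half s c" .
  moreover have "s (r a) \<in> mball z e"
    using dist[OF sR(2) z(1), of "r a"] rab by simp (use sR am rG in auto)
  ultimately have "s (r a) \<in> C" using z(4) by blast
  then have "N (s \<otimes>\<^bsub>K\<^esub> r) = {}"
    using N_empty_if_meets[OF mult_closed[OF sR(2) rG] a(1)] sR(2) rG am by simp
  then have "s \<otimes>\<^bsub>K\<^esub> r = \<one>\<^bsub>K\<^esub>"
    using free[OF mult_closed[OF sR(2) rG]] N_empty_stabilizes[OF mult_closed[OF sR(2) rG]] by blast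
  then have "s (r x) = x" if "x \<in> M" for x
    using mult_apply[OF sR(2) rG that] one_apply[OF that] by simp
  then have "r x = s x" if "x \<in> M" for x
    using reflectionD(2)[OF R_D(2)[OF sR(1)], of "r x"] act_closed[OF rG that] that by simp
  then have "r = s" by (rule group_eqI[OF rG sR(2)])
  then show "r \<in> {s}" by simp
qed

sublocale finite_reflection_cocycle K S N
proof unfold_locales
  show "S \<subseteq> carrier K" using S_R R_D(1) by auto
  show "s \<otimes>\<^bsub>K\<^esub> s = \<one>\<^bsub>K\<^esub>" if "s \<in> S" for s
    using reflectionD(2)[OF R_D(2)[OF S_R[OF that]]] R_D(1)[OF S_R[OF that]] 
    by (intro group_eqI) (auto simp: mult_closed K.one_closed[simplified])
  show "N s = {s}" if "s \<in> S" for s by (rule N_gen[OF that])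
  show "N a \<subseteq> carrier K" if "a \<in> carrier K" for a by (auto simp: N_def R_D(1))
  show "finite (N a)" if "a \<in> carrier K" for a using finite_N that by simp
  show "r \<in> N (a \<otimes>\<^bsub>K\<^esub> b) \<longleftrightarrow> (r \<in> N a) \<noteq> (inv\<^bsub>K\<^esub> a \<otimes>\<^bsub>K\<^esub> r \<otimes>\<^bsub>K\<^esub> a \<in> N b)"
    if "a \<in> carrier K" "b \<in> carrier K" "r \<in> carrier K" for a b r
    using N_mult that by simp
  show "a = \<one>\<^bsub>K\<^esub>" if a: "a \<in> carrier K" "N a \<inter> S = {}" for a
  proof -
    have "a c \<in> half s c" if "s \<in> S" for s using a(2) that S_R by (auto simp: N_def)
    then have "a c \<in> C" using S(2) a(1) c by auto
    then have "N a = {}" using N_empty_if_meets[OF _ c_in_C] a(1) by simp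
    then show ?thesis using free N_empty_stabilizes a(1) by simp
  qed
qed

lemma coxeter_group_K: "coxeter_group K"
  by (rule coxeter_group_if_finite[OF finite_S])

end

context Metric_space
begin

theorem coxeter_group_if_cocompact_discrete:
  assumes geo: "geodesic_space" and \<Gamma>: "cocompact_discrete_reflection_group \<Gamma>"
  shows "coxeter_group ((BijGroup M)\<lparr>carrier := \<Gamma>\<rparr>)"
proof -
  let ?W = "\<Union>r\<in>{r \<in> \<Gamma>. reflection r}. wall r"
  have sub: "subgroup \<Gamma> (BijGroup M)" "\<Gamma> \<subseteq> isometries" "proper_action \<Gamma>"
    using \<Gamma> unfolding cocompact_discrete_reflection_group_def reflection_group_def isometry_group_def
    by blast+
  obtain C where C: "chamber \<Gamma> C" "compactin mtopology (mtopology closure_of C)"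
    "{\<gamma> \<in> \<Gamma>. \<gamma> ` C = C} = {\<one>\<^bsub>BijGroup M\<^esub>}"
    using \<Gamma> unfolding cocompact_discrete_reflection_group_def by blast
  \<comment> \<open>A component is non-empty; any point of it serves as base point, and the chamber
    of that point is the given one.\<close>
  obtain c where c: "c \<in> C" "C = connected_component_of_set (subtopology mtopology (M - ?W)) c"
    "c \<in> M - ?W"
    using C(1) unfolding chamber_def connected_components_of_def
    by (auto simp: connected_component_of_refl)
  interpret D: discrete_reflections M d \<Gamma> c
    by (intro discrete_reflections.intro discrete_reflections_axioms.intro Metric_space_axioms geo sub)
      (use c(3) in auto)
  have "D.C = C" unfolding D.C_component c(2) D.R_def by simp
  then interpret D: cocompact_reflections M d \<Gamma> c
    using C(2,3) by (intro cocompact_reflections.intro cocompact_reflections_axioms.intro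
      D.discrete_reflections_axioms) (auto simp: D.K_def)
  show ?thesis using D.coxeter_group_K unfolding D.K_def .
qed

end


section \<open>The reflection cocycle of a presented Coxeter group\<close>

locale coxeter_presentation =
  fixes S :: "'s set" and m :: "'s \<Rightarrow> 's \<Rightarrow> enat"
  assumes matrix: "coxeter_matrix S m"
begin

definition W :: "'s word set monoid" where
  "W = presented_group S (coxeter_relators S m)"

definition cl :: "'s word \<Rightarrow> 's word set" where
  "cl u = word_class S (coxeter_relators S m) u"

definition gen :: "'s \<Rightarrow> 's word set" where
  "gen s = cl [(s, True)]"

sublocale W: group W
  unfolding W_def by (rule group_presented_group)

lemma carrier_W: "carrier W = cl ` words S"
  by (simp add: W_def cl_def presented_group_def)

lemma one_W: "\<one>\<^bsub>W\<^esub> = cl []"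
  by (simp add: W_def cl_def presented_group_def)

lemma cl_append: "u \<in> words S \<Longrightarrow> v \<in> words S \<Longrightarrow> cl (u @ v) = cl u \<otimes>\<^bsub>W\<^esub> cl v"
  by (simp add: W_def cl_def mult_word_class)

lemma cl_closed [simp]: "u \<in> words S \<Longrightarrow> cl u \<in> carrier W"
  by (simp add: carrier_W)

lemma gen_closed [simp]: "s \<in> S \<Longrightarrow> gen s \<in> carrier W"
  by (simp add: gen_def)

lemma cl_eq: "word_equiv S (coxeter_relators S m) u v \<Longrightarrow> cl u = cl v"
  unfolding cl_def by (rule word_class_eqI)

lemma cl_letter: "s \<in> S \<Longrightarrow> cl [(s, b)] = gen s"
  unfolding gen_def using matrix by (intro cl_eq word_equiv_letter) (auto simp: coxeter_matrix_def)

lemma cl_Cons: "s \<in> S \<Longrightarrow> u \<in> words S \<Longrightarrow> cl ((s, b) # u) = gen s \<otimes>\<^bsub>W\<^esub> cl u"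
  using cl_append[of "[(s, b)]" u] cl_letter[of s b] by simp

lemma gen_gen: "s \<in> S \<Longrightarrow> gen s \<otimes>\<^bsub>W\<^esub> gen s = \<one>\<^bsub>W\<^esub>"
proof -
  assume s: "s \<in> S"
  have "cl ([] @ [(s, True), (s, \<not> True)] @ []) = cl ([] @ [])"
    using s by (intro cl_eq word_equiv.cancel) auto
  then show ?thesis using s cl_Cons[of s "[(s, False)]" True] cl_letter[of s False] by (simp add: one_W)
qed

lemma inv_gen: "s \<in> S \<Longrightarrow> inv\<^bsub>W\<^esub> gen s = gen s"
  by (simp add: W.inv_equality gen_gen)

lemma gen_cancel: "s \<in> S \<Longrightarrow> a \<in> carrier W \<Longrightarrow> gen s \<otimes>\<^bsub>W\<^esub> (gen s \<otimes>\<^bsub>W\<^esub> a) = a"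
  by (simp add: gen_gen flip: W.m_assoc)

text \<open>\<open>crosses u t\<close> says that \<open>t\<close> occurs an odd number of times among the reflections
  \<open>s\<^sub>1 \<dots> s\<^sub>i \<dots> s\<^sub>1\<close> of the word \<open>u = s\<^sub>1 s\<^sub>2 \<dots>\<close>, that is, that the gallery of \<open>u\<close> ends beyond
  the wall of \<open>t\<close>.\<close>

primrec crosses :: "'s word \<Rightarrow> 's word set \<Rightarrow> bool" where
  "crosses [] t \<longleftrightarrow> False"
| "crosses (l # u) t \<longleftrightarrow>
     (t = gen (fst l)) \<noteq> crosses u (gen (fst l) \<otimes>\<^bsub>W\<^esub> t \<otimes>\<^bsub>W\<^esub> gen (fst l))"

text \<open>The cocycle rule at the level of words. The correction depends on the prefix only
  through its value in \<open>W\<close>, so invariance of \<open>crosses\<close> reduces to the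
  cancelling pairs and the relators themselves.\<close>

lemma crosses_append:
  assumes "u \<in> words S" "v \<in> words S" "t \<in> carrier W"
  shows "crosses (u @ v) t \<longleftrightarrow>
    crosses u t \<noteq> crosses v (inv\<^bsub>W\<^esub> cl u \<otimes>\<^bsub>W\<^esub> t \<otimes>\<^bsub>W\<^esub> cl u)"
  using assms(1,3)
proof (induction u arbitrary: t)
  case Nil
  then show ?case by (simp flip: one_W)
next
  case (Cons l u)
  obtain s b where l: "l = (s, b)" by (cases l)
  with Cons have s: "s \<in> S" "u \<in> words S" by auto
  let ?t = "gen s \<otimes>\<^bsub>W\<^esub> t \<otimes>\<^bsub>W\<^esub> gen s"
  have "inv\<^bsub>W\<^esub> cl u \<otimes>\<^bsub>W\<^esub> ?t \<otimes>\<^bsub>W\<^esub> cl u = inv\<^bsub>W\<^esub> cl (l # u) \<otimes>\<^bsub>W\<^esub> t \<otimes>\<^bsub>W\<^esub> cl (l # u)"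
    unfolding l cl_Cons[OF s] using s Cons.prems by (simp add: W.inv_mult_group inv_gen W.m_assoc)
  then show ?case using Cons.IH[OF s(2), of ?t] s Cons.prems unfolding l by auto
qed

lemma sum_lessThan_add: "(\<Sum>i<j + k. f i) = (\<Sum>i<j. f i) + (\<Sum>i<k. f (i + j))"
  for f :: "nat \<Rightarrow> nat"
  by (induction k) (auto simp: add.commute)

text \<open>The reflections met by (st)^k are (st)^i s for i < 2k. Dropping the first two letters
  shifts the index by 2, up to conjugation; the two dropped terms are s and sts.\<close>

lemma crosses_alternating:
  assumes s: "s \<in> S" and t: "t \<in> S" and "x \<in> carrier W"
  shows "crosses (concat (replicate k [(s, True), (t, True)])) x \<longleftrightarrow>
    odd (\<Sum>i<2 * k. of_bool ((gen s \<otimes>\<^bsub>W\<^esub> gen t) [^]\<^bsub>W\<^esub> i \<otimes>\<^bsub>W\<^esub> gen s = x) :: nat)"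
  using assms(3)
proof (induction k arbitrary: x)
  case (Suc k)
  let ?a = "gen s" and ?b = "gen t"
  let ?p = "?a \<otimes>\<^bsub>W\<^esub> ?b"
  define ref where "ref i = ?p [^]\<^bsub>W\<^esub> i \<otimes>\<^bsub>W\<^esub> ?a" for i :: nat
  have c: "?a \<in> carrier W" "?b \<in> carrier W" "ref i \<in> carrier W" for i
    using s t by (auto simp: ref_def)
  let ?y = "?b \<otimes>\<^bsub>W\<^esub> (?a \<otimes>\<^bsub>W\<^esub> x \<otimes>\<^bsub>W\<^esub> ?a) \<otimes>\<^bsub>W\<^esub> ?b"
  have conj_eq: "a \<otimes>\<^bsub>W\<^esub> z \<otimes>\<^bsub>W\<^esub> a = w \<longleftrightarrow> z = a \<otimes>\<^bsub>W\<^esub> w \<otimes>\<^bsub>W\<^esub> a"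
    if "a \<in> {?a, ?b}" "z \<in> carrier W" "w \<in> carrier W" for a z w
    using that s t by (auto simp: W.m_assoc gen_gen gen_cancel)
  have shift: "ref (Suc (Suc i)) = ?a \<otimes>\<^bsub>W\<^esub> (?b \<otimes>\<^bsub>W\<^esub> ref i \<otimes>\<^bsub>W\<^esub> ?b) \<otimes>\<^bsub>W\<^esub> ?a" for i
  proof -
    have "ref (Suc (Suc i)) = ?p \<otimes>\<^bsub>W\<^esub> (?p [^]\<^bsub>W\<^esub> i \<otimes>\<^bsub>W\<^esub> ?p) \<otimes>\<^bsub>W\<^esub> ?a"
      unfolding ref_def using c(1,2) W.nat_pow_Suc2[of ?p "Suc i"] by simp
    then show ?thesis unfolding ref_def using c(1,2) by (simp add: W.m_assoc)
  qed
  have "ref i = ?y \<longleftrightarrow> ref (Suc (Suc i)) = x" for i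
    unfolding shift using conj_eq[of ?a "?b \<otimes>\<^bsub>W\<^esub> ref i \<otimes>\<^bsub>W\<^esub> ?b" x]
      conj_eq[of ?b "ref i" "?a \<otimes>\<^bsub>W\<^esub> x \<otimes>\<^bsub>W\<^esub> ?a"] c Suc.prems by simp
  moreover have "?a \<otimes>\<^bsub>W\<^esub> x \<otimes>\<^bsub>W\<^esub> ?a = ?b \<longleftrightarrow> ref (Suc 0) = x"
    using conj_eq[of ?a x ?b] c Suc.prems by (auto simp: ref_def)
  moreover have "x = ?a \<longleftrightarrow> ref 0 = x"
    using c by (auto simp: ref_def)
  moreover have "crosses (concat (replicate k [(s, True), (t, True)])) ?y \<longleftrightarrow>
      odd (\<Sum>i<2 * k. of_bool (ref i = ?y) :: nat)"
    unfolding ref_def by (rule Suc.IH) (use c Suc.prems in auto)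
  ultimately show ?case
    unfolding ref_def[symmetric] by (simp add: sum.lessThan_Suc_shift del: sum.lessThan_Suc)
qed simp

lemma cl_relator:
  assumes "r \<in> coxeter_relators S m" "r \<in> words S"
  shows "cl r = \<one>\<^bsub>W\<^esub>"
  using cl_eq[OF word_equiv.relator[of "[]" S "[]" r]] assms by (simp add: one_W)

lemma cl_alternating:
  assumes "s \<in> S" "t \<in> S"
  shows "cl (concat (replicate k [(s, True), (t, True)])) = (gen s \<otimes>\<^bsub>W\<^esub> gen t) [^]\<^bsub>W\<^esub> k"
proof (induction k)
  case (Suc k)
  have "concat (replicate k [(s, True), (t, True)]) \<in> words S"
    using assms by (intro words_concat_replicate) simp
  then have "cl (concat (replicate (Suc k) [(s, True), (t, True)])) =
      (gen s \<otimes>\<^bsub>W\<^esub> gen t) \<otimes>\<^bsub>W\<^esub> (gen s \<otimes>\<^bsub>W\<^esub> gen t) [^]\<^bsub>W\<^esub> k"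
    using assms by (simp add: cl_Cons Suc W.m_assoc)
  also have "\<dots> = (gen s \<otimes>\<^bsub>W\<^esub> gen t) [^]\<^bsub>W\<^esub> Suc k"
    by (rule W.nat_pow_Suc2[symmetric]) (use assms in simp)
  finally show ?case .
qed (simp add: one_W)

text \<open>From (st)^n = 1 the list of 2n reflections is periodic with period n, so each element is
  counted an even number of times. The exact order of st is not presupposed.\<close>

lemma crosses_relator:
  assumes "r \<in> coxeter_relators S m" "x \<in> carrier W"
  shows "\<not> crosses r x"
proof -
  obtain s t n where r: "r = concat (replicate n [(s, True), (t, True)])" "s \<in> S" "t \<in> S" 
    using assms(1) unfolding coxeter_relators_def by blast
  have w: "r \<in> words S" unfolding r(1) using r(2,3) by (intro words_concat_replicate) simp
  let ?p = "gen s \<otimes>\<^bsub>W\<^esub> gen t"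
  have pn: "?p [^]\<^bsub>W\<^esub> n = \<one>\<^bsub>W\<^esub>"
    using cl_relator[OF assms(1) w] cl_alternating[OF r(2,3)] r(1) by simp
  have "?p [^]\<^bsub>W\<^esub> (i + n) = ?p [^]\<^bsub>W\<^esub> i" for i :: nat
    using W.nat_pow_mult[of ?p i n] r(2,3) by (simp add: pn)
  then have "even (\<Sum>i<2 * n. of_bool (?p [^]\<^bsub>W\<^esub> i \<otimes>\<^bsub>W\<^esub> gen s = x) :: nat)"
    by (simp add: mult_2 sum_lessThan_add)
  then show ?thesis unfolding r(1) crosses_alternating[OF r(2,3) assms(2)] by simp
qed

lemma crosses_sound:
  assumes "word_equiv S (coxeter_relators S m) u v" "t \<in> carrier W"
  shows "crosses u t = crosses v t"
  using assms
proof (induction arbitrary: t rule: word_equiv.induct)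
  case (refl u)
  show ?case by (rule HOL.refl)
next
  case (sym u v)
  show ?case by (rule sym.IH[symmetric, OF sym.prems])
next
  case (trans u v w)
  show ?case by (rule HOL.trans[OF trans.IH(1,2)[OF trans.prems]])
next
  case (cancel u v s b)
  let ?y = "inv\<^bsub>W\<^esub> cl u \<otimes>\<^bsub>W\<^esub> t \<otimes>\<^bsub>W\<^esub> cl u"
  have y: "?y \<in> carrier W" using cancel by simp
  have conj: "gen s \<otimes>\<^bsub>W\<^esub> (gen s \<otimes>\<^bsub>W\<^esub> ?y \<otimes>\<^bsub>W\<^esub> gen s) \<otimes>\<^bsub>W\<^esub> gen s = ?y"
    using y cancel by (simp add: W.m_assoc gen_gen gen_cancel)
  have sss: "gen s \<otimes>\<^bsub>W\<^esub> gen s \<otimes>\<^bsub>W\<^esub> gen s = gen s" using cancel by (simp add: gen_gen)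
  \<comment> \<open>Conjugation by \<open>gen s\<close> fixes \<open>gen s\<close>, so the two
    letters toggle both times or not at all.\<close>
  have "gen s \<otimes>\<^bsub>W\<^esub> ?y \<otimes>\<^bsub>W\<^esub> gen s = gen s \<longleftrightarrow> ?y = gen s"
    using conj sss by metis
  then have "crosses ([(s, b), (s, \<not> b)] @ v) ?y = crosses v ?y"
    using conj by (cases "?y = gen s") simp_all
  then show ?case
    using crosses_append[of u v t] crosses_append[of u "[(s, b), (s, \<not> b)] @ v" t] cancel by simp
next
  case (relator u v r)
  let ?y = "inv\<^bsub>W\<^esub> cl u \<otimes>\<^bsub>W\<^esub> t \<otimes>\<^bsub>W\<^esub> cl u"
  have y: "?y \<in> carrier W" using relator by simp
  have "crosses (r @ v) ?y = crosses v ?y"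
    using crosses_append[of r v ?y] crosses_relator[of r ?y] cl_relator[of r] relator y by simp
  then show ?case
    using crosses_append[of u v t] crosses_append[of u "r @ v" t] relator by simp
qed

text \<open>A chosen representative word stands in for the class; \<open>N_cl\<close> shows that the
  choice is immaterial.\<close>

definition N :: "'s word set \<Rightarrow> 's word set set" where
  "N A = {t \<in> carrier W. crosses (SOME u. u \<in> words S \<and> cl u = A) t}"

lemma N_cl:
  assumes "u \<in> words S"
  shows "N (cl u) = {t \<in> carrier W. crosses u t}"
proof -
  define v where "v = (SOME v. v \<in> words S \<and> cl v = cl u)"
  have "v \<in> words S \<and> cl v = cl u"
    unfolding v_def by (rule someI[of "\<lambda>v. v \<in> words S \<and> cl v = cl u" u]) (use assms in simp)
  then have "word_equiv S (coxeter_relators S m) v u"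
    using assms by (simp add: cl_def word_class_eq_iff)
  from crosses_sound[OF this] show ?thesis unfolding N_def v_def[symmetric] by auto
qed

lemma reflection_cocycle_W: "reflection_cocycle W (gen ` S) N"
proof (intro reflection_cocycle.intro reflection_cocycle_axioms.intro W.group_axioms)
  show "gen ` S \<subseteq> carrier W" by auto
  show "s \<otimes>\<^bsub>W\<^esub> s = \<one>\<^bsub>W\<^esub>" if "s \<in> gen ` S" for s using that gen_gen by auto
  show "N s = {s}" if s: "s \<in> gen ` S" for s
  proof -
    obtain t where t: "t \<in> S" "s = gen t" using s by blast
    then have "N s = {r \<in> carrier W. r = gen t}"
      using N_cl[of "[(t, True)]"] by (simp add: gen_def)
    then show ?thesis using t by auto
  qed
  show "N a \<subseteq> carrier W" if "a \<in> carrier W" for a by (auto simp: N_def)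
  show "r \<in> N (a \<otimes>\<^bsub>W\<^esub> b) \<longleftrightarrow> (r \<in> N a) \<noteq> (inv\<^bsub>W\<^esub> a \<otimes>\<^bsub>W\<^esub> r \<otimes>\<^bsub>W\<^esub> a \<in> N b)"
    if ab: "a \<in> carrier W" "b \<in> carrier W" and r: "r \<in> carrier W" for a b r
  proof -
    obtain u v where uv: "u \<in> words S" "a = cl u" "v \<in> words S" "b = cl v"
      using ab unfolding carrier_W by blast
    have "a \<otimes>\<^bsub>W\<^esub> b = cl (u @ v)" using uv by (simp add: cl_append)
    then show ?thesis
      using uv r ab N_cl[of "u @ v"] N_cl[of u] N_cl[of v] crosses_append[of u v r] by simp
  qed
qed

lemma generate_W: "generate W (gen ` S) = carrier W"
proof
  show "generate W (gen ` S) \<subseteq> carrier W" by (rule W.generate_incl) auto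
  show "carrier W \<subseteq> generate W (gen ` S)"
  proof
    fix a assume "a \<in> carrier W"
    then obtain u where "u \<in> words S" "a = cl u" unfolding carrier_W by blast
    then show "a \<in> generate W (gen ` S)"
    proof (induction u arbitrary: a)
      case Nil
      then show ?case using generate.one[of W] by (simp add: one_W)
    next
      case (Cons l u)
      obtain s b where "l = (s, b)" by (cases l)
      then show ?case
        using Cons generate.eng[OF generate.incl[of "gen s" "gen ` S" W]] by (auto simp: cl_Cons)
    qed
  qed
qed

end

section \<open>Transport to the natural numbers\<close>

lemma reflection_cocycle_iso:
  assumes RC: "reflection_cocycle G S N" and H: "group H" and h: "h \<in> iso G H"
  shows "reflection_cocycle H (h ` S) (\<lambda>a. h ` N (inv_into (carrier G) h a))"
proof -
  interpret reflection_cocycle G S N by (rule RC)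
  interpret H: group H by (rule H)
  interpret h: group_hom G H h
    using h by unfold_locales (simp add: iso_def)
  have inj: "inj_on h (carrier G)" and surj: "h ` carrier G = carrier H"
    using h by (auto simp: iso_def bij_betw_def)
  have inv_h [simp]: "inv_into (carrier G) h (h a) = a" if "a \<in> carrier G" for a
    using inj that by simp
  have mem: "h r \<in> h ` N a \<longleftrightarrow> r \<in> N a" if "r \<in> carrier G" "a \<in> carrier G" for r a
    using inj_on_image_mem_iff[OF inj that(1) N_sub[OF that(2)]] .
  have ex: "\<exists>a'. a' \<in> carrier G \<and> a = h a'" if "a \<in> carrier H" for a
    using that unfolding surj[symmetric] by blast
  show ?thesis
  proof (intro reflection_cocycle.intro reflection_cocycle_axioms.intro H)
    show "h ` S \<subseteq> carrier H" using gens by auto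
    show "s \<otimes>\<^bsub>H\<^esub> s = \<one>\<^bsub>H\<^esub>" if "s \<in> h ` S" for s
      using that invol by (auto simp flip: h.hom_mult)
    show "h ` N (inv_into (carrier G) h s) = {s}" if "s \<in> h ` S" for s
      using that N_gen by auto
    show "h ` N (inv_into (carrier G) h a) \<subseteq> carrier H" if a: "a \<in> carrier H" for a
    proof -
      obtain a' where "a' \<in> carrier G" "a = h a'" using ex[OF a] by blast
      then show ?thesis using N_sub[of a'] by auto
    qed
    show "r \<in> h ` N (inv_into (carrier G) h (a \<otimes>\<^bsub>H\<^esub> b)) \<longleftrightarrow>
       (r \<in> h ` N (inv_into (carrier G) h a)) \<noteq>
       (inv\<^bsub>H\<^esub> a \<otimes>\<^bsub>H\<^esub> r \<otimes>\<^bsub>H\<^esub> a \<in> h ` N (inv_into (carrier G) h b))"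
      if abr: "a \<in> carrier H" "b \<in> carrier H" "r \<in> carrier H" for a b r
    proof -
      obtain a' b' r' where 1: "a' \<in> carrier G" "a = h a'" "b' \<in> carrier G" "b = h b'"
        "r' \<in> carrier G" "r = h r'" using ex[OF abr(1)] ex[OF abr(2)] ex[OF abr(3)] by blast
      have 2: "a \<otimes>\<^bsub>H\<^esub> b = h (a' \<otimes>\<^bsub>G\<^esub> b')" "inv\<^bsub>H\<^esub> a \<otimes>\<^bsub>H\<^esub> r \<otimes>\<^bsub>H\<^esub> a = h (inv\<^bsub>G\<^esub> a' \<otimes>\<^bsub>G\<^esub> r' \<otimes>\<^bsub>G\<^esub> a')"
        using 1 by simp_all
      have i: "inv_into (carrier G) h (a \<otimes>\<^bsub>H\<^esub> b) = a' \<otimes>\<^bsub>G\<^esub> b'"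
        "inv_into (carrier G) h a = a'" "inv_into (carrier G) h b = b'"
        unfolding 2(1) by (rule inv_h, use 1 in simp) (use 1 in simp_all)
      have "inv\<^bsub>G\<^esub> a' \<otimes>\<^bsub>G\<^esub> r' \<otimes>\<^bsub>G\<^esub> a' \<in> carrier G" "a' \<otimes>\<^bsub>G\<^esub> b' \<in> carrier G" using 1 by simp_all
      then show ?thesis
        unfolding i 2(2) unfolding 1(6) using N_mult[OF 1(1,3,5)] mem 1(1,3,5) by blast
    qed
  qed
qed

text \<open>Transport of structure along an injection. It fixes the type of the vertices, and
  thereby the type in which the space is built.\<close>

lemma iso_onto_nat:
  assumes G: "group G" and e: "inj_on e (carrier G)"
  obtains H :: "nat monoid" where "group H" "e \<in> iso G H"
proof -
  interpret group G by (rule G)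
  define i where "i = inv_into (carrier G) e"
  have i [simp]: "i (e a) = a" if "a \<in> carrier G" for a using e that by (simp add: i_def)
  define H where "H = \<lparr>carrier = e ` carrier G, mult = \<lambda>a b. e (i a \<otimes>\<^bsub>G\<^esub> i b), one = e \<one>\<^bsub>G\<^esub>\<rparr>"
  have "group H"
  proof (rule groupI)
    fix x assume "x \<in> carrier H"
    then obtain a where "a \<in> carrier G" "x = e a" by (auto simp: H_def)
    then show "\<exists>y\<in>carrier H. y \<otimes>\<^bsub>H\<^esub> x = \<one>\<^bsub>H\<^esub>"
      by (intro bexI[of _ "e (inv\<^bsub>G\<^esub> a)"]) (auto simp: H_def)
  qed (auto simp: H_def m_assoc)
  moreover have "e \<in> iso G H"
    using e by (auto simp: iso_def hom_def bij_betw_def H_def)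
  ultimately show ?thesis using that by blast
qed

theorem coxeter_group_cocycle:
  assumes "group G" "coxeter_group G"
  obtains K :: "nat monoid" and S N where "reflection_cocycle K S N" "finite S"
    "generate K S = carrier K" "G \<cong> K"
proof -
  obtain I :: "nat set" and m where I: "finite I" "coxeter_matrix I m"
    "G \<cong> presented_group I (coxeter_relators I m)"
    using assms(2) unfolding coxeter_group_def by blast
  interpret P: coxeter_presentation I m by unfold_locales (rule I(2))
  \<comment> \<open>A class is coded by the number of a chosen word in it; the word determines its
    class, so the coding is injective.\<close>
  define e where "e A = to_nat (SOME u. u \<in> words I \<and> P.cl u = A)" for A
  have "inj_on e (carrier P.W)"
  proof (rule inj_onI)
    fix A B assume AB: "A \<in> carrier P.W" "B \<in> carrier P.W" "e A = e B"
    define f where "f A = (SOME u. u \<in> words I \<and> P.cl u = A)" for A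
    have f: "P.cl (f A) = A" if A: "A \<in> carrier P.W" for A
    proof -
      obtain u where "u \<in> words I \<and> P.cl u = A" using A unfolding P.carrier_W by blast
      then have "f A \<in> words I \<and> P.cl (f A) = A" unfolding f_def by (rule someI)
      then show ?thesis ..
    qed
    have "f A = f B" using AB(3) injD[OF inj_to_nat] unfolding e_def f_def by blast
    then show "A = B" using f AB(1,2) by metis
  qed
  then obtain K :: "nat monoid" where K: "group K" "e \<in> iso P.W K"
    by (rule iso_onto_nat[OF P.W.group_axioms]) (rule that)
  interpret e: group_hom P.W K e
    using K by (intro group_hom.intro group_hom_axioms.intro P.W.group_axioms) (auto simp: iso_def)
  have "P.gen ` I \<subseteq> carrier P.W" by auto
  from e.generate_img[OF this] have "generate K (e ` P.gen ` I) = carrier K"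
    using P.generate_W K(2) by (simp add: iso_def bij_betw_def)
  moreover have "G \<cong> K"
    by (rule iso_trans[OF I(3)[folded P.W_def] is_isoI[OF K(2)]])
  moreover have "finite (e ` P.gen ` I)" using I(1) by simp
  ultimately show ?thesis
    by (intro that[OF reflection_cocycle_iso[OF P.reflection_cocycle_W K]])
qed


section \<open>The metric of a graph\<close>

text \<open>The point at parameter \<open>t\<close> of the edge from \<open>u\<close> to \<open>v\<close> is encoded by its barycentric
  coordinates; for \<open>u = v\<close> it is the vertex \<open>u\<close> whatever \<open>t\<close> is.\<close>

definition pt :: "'v \<Rightarrow> 'v \<Rightarrow> real \<Rightarrow> 'v \<Rightarrow> real" where
  "pt u v t = (\<lambda>x. (if x = u then 1 - t else 0) + (if x = v then t else 0))"

definition supp :: "('v \<Rightarrow> real) \<Rightarrow> 'v set" where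
  "supp p = {x. p x \<noteq> 0}"

lemma pt_apply: "u \<noteq> v \<Longrightarrow> pt u v t u = 1 - t" "u \<noteq> v \<Longrightarrow> pt u v t v = t" "pt u u t u = 1"
  "x \<noteq> u \<Longrightarrow> x \<noteq> v \<Longrightarrow> pt u v t x = 0"
  by (auto simp: pt_def)

lemma pt_same: "pt u u t = pt u u 0"
  by (auto simp: pt_def)

lemma supp_pt_subset: "supp (pt u v t) \<subseteq> {u, v}"
  by (auto simp: supp_def pt_def split: if_splits)

text \<open>\<open>D_step\<close> provides a first step towards \<open>y\<close>, which makes
  \<open>D\<close> the path metric of the graph whose edges join points at distance 1.\<close>

locale metric_graph =
  fixes V :: "'v set" and D :: "'v \<Rightarrow> 'v \<Rightarrow> nat"
  assumes D_zero: "x \<in> V \<Longrightarrow> y \<in> V \<Longrightarrow> D x y = 0 \<longleftrightarrow> x = y"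
    and D_sym: "x \<in> V \<Longrightarrow> y \<in> V \<Longrightarrow> D x y = D y x"
    and D_triangle: "x \<in> V \<Longrightarrow> y \<in> V \<Longrightarrow> z \<in> V \<Longrightarrow> D x z \<le> D x y + D y z"
    and D_step: "x \<in> V \<Longrightarrow> y \<in> V \<Longrightarrow> D x y = Suc n \<Longrightarrow> \<exists>z\<in>V. D x z = 1 \<and> D z y = n"
begin

text \<open>Degenerate edges with u = v are included, so a vertex lies on an edge even in a graph
  without proper edges.\<close>

definition edge :: "'v \<Rightarrow> 'v \<Rightarrow> bool" where
  "edge u v \<longleftrightarrow> u \<in> V \<and> v \<in> V \<and> D u v \<le> 1"

definition X :: "('v \<Rightarrow> real) set" where
  "X = {pt u v t |u v t. edge u v \<and> 0 \<le> t \<and> t \<le> 1}"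

definition coedge :: "('v \<Rightarrow> real) \<Rightarrow> ('v \<Rightarrow> real) \<Rightarrow> bool" where
  "coedge p q \<longleftrightarrow> (\<exists>u v. edge u v \<and> supp p \<subseteq> {u, v} \<and> supp q \<subseteq> {u, v})"

text \<open>Half the l1-distance of barycentric coordinates, which on a common edge is the distance
  of the parameters.\<close>

definition along :: "('v \<Rightarrow> real) \<Rightarrow> ('v \<Rightarrow> real) \<Rightarrow> real" where
  "along p q = (\<Sum>x\<in>supp p \<union> supp q. \<bar>p x - q x\<bar>) / 2"

text \<open>Length of the route from \<open>p\<close> to the vertex \<open>x\<close>, through the
  graph to \<open>y\<close>, and on to \<open>q\<close>; a point is at distance 1 - p(x) from a
  vertex x of its support.\<close>

definition via :: "('v \<Rightarrow> real) \<Rightarrow> ('v \<Rightarrow> real) \<Rightarrow> 'v \<Rightarrow> 'v \<Rightarrow> real" where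
  "via p q x y = (1 - p x) + real (D x y) + (1 - q y)"

definition across :: "('v \<Rightarrow> real) \<Rightarrow> ('v \<Rightarrow> real) \<Rightarrow> real" where
  "across p q = Min ((\<lambda>(x, y). via p q x y) ` (supp p \<times> supp q))"

text \<open>The value 0 off \<open>X\<close> keeps the function symmetric and non-negative
  everywhere, as \<open>Metric_space\<close> demands of all arguments.\<close>

definition dst :: "('v \<Rightarrow> real) \<Rightarrow> ('v \<Rightarrow> real) \<Rightarrow> real" where
  "dst p q = (if p \<in> X \<and> q \<in> X then if coedge p q then along p q else across p q else 0)"

lemma dst_eq: "p \<in> X \<Longrightarrow> q \<in> X \<Longrightarrow> dst p q = (if coedge p q then along p q else across p q)"
  by (simp add: dst_def)

lemma edge_refl: "u \<in> V \<Longrightarrow> edge u u"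
  using D_zero[of u u] by (simp add: edge_def)

lemma edge_sym: "edge u v \<Longrightarrow> edge v u"
  using D_sym by (simp add: edge_def)

lemma pt_in_X: "edge u v \<Longrightarrow> 0 \<le> t \<Longrightarrow> t \<le> 1 \<Longrightarrow> pt u v t \<in> X"
  unfolding X_def by blast

lemma X_E:
  assumes "p \<in> X"
  obtains u v t where "edge u v" "p = pt u v t" "0 \<le> t" "t \<le> 1"
  using assms unfolding X_def by blast

lemma X_supp:
  assumes "p \<in> X"
  shows "finite (supp p)" "supp p \<noteq> {}" "supp p \<subseteq> V" "0 \<le> p x" "p x \<le> 1"
    "x \<in> supp p \<Longrightarrow> y \<in> supp p \<Longrightarrow> x \<noteq> y \<Longrightarrow> p x + p y = 1 \<and> D x y = 1"
proof -
  obtain u v t where p: "edge u v" "p = pt u v t" "0 \<le> t" "t \<le> 1" using X_E[OF assms] .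
  have uv: "u \<in> V" "v \<in> V" "D u v \<le> 1" using p(1) by (auto simp: edge_def)
  have sub: "supp p \<subseteq> {u, v}" unfolding p(2) by (rule supp_pt_subset)
  then show "finite (supp p)" by (rule finite_subset) simp
  show "supp p \<subseteq> V" using sub uv by blast
  show "supp p \<noteq> {}"
  proof (cases "t = 0 \<or> u = v")
    case True
    then have "u \<in> supp p" unfolding p(2) by (auto simp: supp_def pt_def)
    then show ?thesis by blast
  next
    case False
    then have "v \<in> supp p" unfolding p(2) by (auto simp: supp_def pt_def)
    then show ?thesis by blast
  qed
  show "0 \<le> p x" "p x \<le> 1" unfolding p(2) pt_def using p(3,4) by auto
  show "p x + p y = 1 \<and> D x y = 1" if "x \<in> supp p" "y \<in> supp p" "x \<noteq> y"
  proof -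
    have "x = u \<and> y = v \<or> x = v \<and> y = u" using that sub by blast
    moreover have "D u v = 1" using uv D_zero[of u v] that sub by (cases "D u v") auto
    ultimately show ?thesis using D_sym[OF uv(1,2)] that unfolding p(2) by (auto simp: pt_def)
  qed
qed

lemma X_on_edge:
  assumes p: "p \<in> X" and e: "edge u v" and s: "supp p \<subseteq> {u, v}"
  shows "p = pt u v (p v)" "u \<noteq> v \<Longrightarrow> p u + p v = 1" "u = v \<Longrightarrow> p u = 1"
proof -
  obtain a b t where ab: "edge a b" "p = pt a b t" "0 \<le> t" "t \<le> 1" using X_E[OF p] .
  have z: "p x = 0" if "x \<noteq> u" "x \<noteq> v" for x using s that by (auto simp: supp_def)
  have sum: "sum p F = sum p (supp p)" if "finite F" "supp p \<subseteq> F" for F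
    using that by (intro sum.mono_neutral_right) (auto simp: supp_def)
  have "sum p {a, b} = 1"
    unfolding ab(2) by (cases "a = b") (simp_all add: pt_apply)
  moreover have "supp p \<subseteq> {a, b}" unfolding ab(2) by (rule supp_pt_subset)
  ultimately have "sum p {u, v} = 1" using sum[of "{a, b}"] sum[of "{u, v}"] s by simp
  then show 1: "u \<noteq> v \<Longrightarrow> p u + p v = 1" and 2: "u = v \<Longrightarrow> p u = 1" by auto
  show "p = pt u v (p v)"
  proof
    fix x show "p x = pt u v (p v) x"
      using 1 2 z[of x] by (cases "u = v") (auto simp: pt_def)
  qed
qed

lemma X_vertex:
  assumes "p \<in> X" "x \<in> V" "supp p \<subseteq> {x}"
  shows "p = pt x x 0" "p x = 1"
proof -
  have s: "supp p \<subseteq> {x, x}" using assms(3) by simp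
  show "p x = 1" by (rule X_on_edge(3)[OF assms(1) edge_refl[OF assms(2)] s HOL.refl])
  show "p = pt x x 0"
    by (rule HOL.trans[OF X_on_edge(1)[OF assms(1) edge_refl[OF assms(2)] s] pt_same])
qed

lemma vertex_in_X: "x \<in> V \<Longrightarrow> pt x x 0 \<in> X"
  using pt_in_X[OF edge_refl] by simp

lemma supp_vertex: "supp (pt x x 0) = {x}"
  by (auto simp: supp_def pt_def)

lemma edge_eq:
  assumes "edge u v" "x \<in> {u, v}" "y \<in> {u, v}" "x \<noteq> y"
  shows "{u, v} = {x, y}"
  using assms by auto

lemma along_eq_sum:
  assumes "finite F" "supp p \<subseteq> F" "supp q \<subseteq> F"
  shows "along p q = (\<Sum>x\<in>F. \<bar>p x - q x\<bar>) / 2"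
  unfolding along_def
  by (rule arg_cong[where f = "\<lambda>x. x / 2"], rule sum.mono_neutral_left)
    (use assms in \<open>auto simp: supp_def\<close>)

lemma along_on_edge:
  assumes "p \<in> X" "q \<in> X" "edge u v" "supp p \<subseteq> {u, v}" "supp q \<subseteq> {u, v}"
  shows "along p q = \<bar>p u - q u\<bar>"
proof -
  have "along p q = (\<Sum>x\<in>{u, v}. \<bar>p x - q x\<bar>) / 2"
    using assms by (intro along_eq_sum) auto
  also have "\<dots> = \<bar>p u - q u\<bar>"
    using X_on_edge(2,3)[OF assms(1,3,4)] X_on_edge(2,3)[OF assms(2,3,5)]
    by (cases "u = v") (auto simp: abs_if)
  finally show ?thesis .
qed

lemma across_le:
  assumes "p \<in> X" "q \<in> X" "x \<in> supp p" "y \<in> supp q"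
  shows "across p q \<le> via p q x y"
  unfolding across_def using X_supp(1)[OF assms(1)] X_supp(1)[OF assms(2)] assms(3,4)
  by (intro Min_le) force+

lemma across_attained:
  assumes "p \<in> X" "q \<in> X"
  obtains x y where "x \<in> supp p" "y \<in> supp q" "across p q = via p q x y"
proof -
  have "across p q \<in> (\<lambda>(x, y). via p q x y) ` (supp p \<times> supp q)"
    unfolding across_def using X_supp(1,2)[OF assms(1)] X_supp(1,2)[OF assms(2)]
    by (intro Min_in) auto
  then show ?thesis using that by auto
qed

lemma coedge_sym: "coedge p q \<longleftrightarrow> coedge q p"
  unfolding coedge_def by blast

lemma along_sym: "along p q = along q p"
  by (simp add: along_def Un_commute abs_minus_commute)

lemma across_sym:
  assumes "p \<in> X" "q \<in> X"
  shows "across p q = across q p"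
proof -
  have "across p q \<le> across q p" if pq: "p \<in> X" "q \<in> X" for p q
  proof -
    obtain x y where xy: "x \<in> supp q" "y \<in> supp p" "across q p = via q p x y"
      using across_attained[OF pq(2,1)] .
    have "x \<in> V" "y \<in> V" using xy X_supp(3) pq by blast+
    then have "via p q y x = via q p x y" using D_sym[of x y] by (simp add: via_def)
    then show ?thesis using across_le[OF pq xy(2,1)] xy(3) by simp
  qed
  then show ?thesis using assms by (simp add: eq_iff)
qed

section \<open>The triangle inequality\<close>

lemma D_le_supp:
  assumes "q \<in> X" "x \<in> supp q" "y \<in> supp q"
  shows "real (D x y) \<le> (1 - q x) + (1 - q y)"
proof (cases "x = y")
  case True
  have "x \<in> V" using X_supp(3)[OF assms(1)] assms(2) by blast
  then have "D x y = 0" using D_zero[of x x] True by simp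
  then show ?thesis using X_supp(5)[OF assms(1), of x] True by simp
next
  case False
  then show ?thesis using X_supp(6)[OF assms False] by simp
qed

text \<open>Walking from \<open>p\<close> to \<open>q\<close> and on to \<open>y\<close> can be
  replaced by a route through a vertex of \<open>p\<close>: this is \<open>y\<close> itself if
  \<open>p\<close> has weight there, and otherwise \<open>p\<close> is the other end of the
  edge.\<close>

lemma coedge_exit:
  assumes pq: "p \<in> X" "q \<in> X" "coedge p q" and y: "y \<in> supp q"
  shows "\<exists>x\<in>supp p. (1 - p x) + real (D x y) \<le> along p q + (1 - q y)"
proof -
  obtain u v where uv: "edge u v" "supp p \<subseteq> {u, v}" "supp q \<subseteq> {u, v}"
    using pq(3) unfolding coedge_def by blast
  obtain w where w: "edge y w" "supp p \<subseteq> {y, w}" "supp q \<subseteq> {y, w}"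
  proof (cases "y = u")
    case True then show ?thesis using that uv by blast
  next
    case False
    then have "y = v" using y uv by blast
    then show ?thesis using that[of u] uv edge_sym by (simp add: insert_commute)
  qed
  have al: "along p q = \<bar>p y - q y\<bar>" by (rule along_on_edge[OF pq(1,2) w])
  have D0: "D y y = 0" using w(1) D_zero[of y y] by (simp add: edge_def)
  show ?thesis
  proof (cases "y \<in> supp p")
    case True
    then show ?thesis using al D0 by (intro bexI[of _ y]) auto
  next
    case False
    then have "supp p \<subseteq> {w}" "p y = 0" using w(2) by (auto simp: supp_def)
    moreover have "w \<in> V" using w(1) by (simp add: edge_def)
    ultimately have "p w = 1" using X_vertex(2)[OF pq(1)] by blast
    moreover have "D w y \<le> 1" using edge_sym[OF w(1)] by (simp add: edge_def)
    ultimately show ?thesis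
      using al \<open>p y = 0\<close> by (intro bexI[of _ w]) (auto simp: supp_def)
  qed
qed

text \<open>The two routes use possibly different vertices of the edge carrying \<open>q\<close>;
  the jump between them costs at most what both routes pay to reach \<open>q\<close>.\<close>

lemma across_triangle:
  assumes "p \<in> X" "q \<in> X" "r \<in> X"
  shows "across p r \<le> across p q + across q r"
proof -
  obtain x y where xy: "x \<in> supp p" "y \<in> supp q" "across p q = via p q x y"
    using across_attained[OF assms(1,2)] .
  obtain y' z where yz: "y' \<in> supp q" "z \<in> supp r" "across q r = via q r y' z"
    using across_attained[OF assms(2,3)] .
  have V: "x \<in> V" "y \<in> V" "y' \<in> V" "z \<in> V" using xy yz X_supp(3) assms by blast+
  have "across p r \<le> via p r x z" using across_le[OF assms(1,3) xy(1) yz(2)] .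
  moreover have "D x z \<le> D x y + D y y' + D y' z"
    using D_triangle[OF V(1,2,4)] D_triangle[OF V(2,3,4)] by linarith
  then have "real (D x z) \<le> D x y + D y y' + D y' z" by linarith
  moreover have "real (D y y') \<le> (1 - q y) + (1 - q y')" using D_le_supp[OF assms(2) xy(2) yz(1)] .
  ultimately show ?thesis using xy yz by (simp add: via_def)
qed

lemma along_across_triangle:
  assumes "p \<in> X" "q \<in> X" "r \<in> X" "coedge p q"
  shows "across p r \<le> along p q + across q r"
proof -
  obtain y z where yz: "y \<in> supp q" "z \<in> supp r" "across q r = via q r y z"
    using across_attained[OF assms(2,3)] .
  obtain x where x: "x \<in> supp p" "(1 - p x) + real (D x y) \<le> along p q + (1 - q y)"
    using coedge_exit[OF assms(1,2,4) yz(1)] by blast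
  have V: "x \<in> V" "y \<in> V" "z \<in> V" using x yz X_supp(3) assms by blast+
  have "across p r \<le> via p r x z" using across_le[OF assms(1,3) x(1) yz(2)] .
  moreover have "real (D x z) \<le> D x y + D y z" using D_triangle[OF V] by linarith
  ultimately show ?thesis using x yz by (simp add: via_def)
qed

lemma along_le_across:
  assumes "p \<in> X" "q \<in> X" "coedge p q"
  shows "along p q \<le> across p q"
proof -
  obtain x y where xy: "x \<in> supp p" "y \<in> supp q" "across p q = via p q x y"
    using across_attained[OF assms(1,2)] .
  obtain u v where uv: "edge u v" "supp p \<subseteq> {u, v}" "supp q \<subseteq> {u, v}"
    using assms(3) unfolding coedge_def by blast
  have V: "x \<in> V" "y \<in> V" using xy X_supp(3) assms by blast+
  note bounds = X_supp(4,5)[OF assms(1)] X_supp(4,5)[OF assms(2)]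
  have al: "along p q = \<bar>p u - q u\<bar>" by (rule along_on_edge[OF assms(1,2) uv])
  have al': "along p q = \<bar>p v - q v\<bar>"
    by (rule along_on_edge[OF assms(1,2) edge_sym[OF uv(1)]]) (use uv in auto)
  show ?thesis
  proof (cases "x = y")
    case True
    have "x = u \<or> x = v" using xy(1) uv(2) by blast
    then have "along p q = \<bar>p x - q x\<bar>" using al al' by auto
    moreover have "\<bar>p x - q x\<bar> \<le> (1 - p x) + (1 - q x)" using bounds[of x] by (simp add: abs_le_iff)
    ultimately show ?thesis using xy(3) True by (simp add: via_def)
  next
    case False
    then have "D x y \<ge> 1" using D_zero[OF V] by linarith
    moreover have "along p q \<le> 1" using al bounds[of u] by (simp add: abs_le_iff)
    ultimately show ?thesis using xy(3) bounds(2)[of x] bounds(4)[of y] by (simp add: via_def)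
  qed
qed

text \<open>If \<open>q\<close> had two support points, these would determine the edge, and
  \<open>p\<close> and \<open>r\<close> would share it. So \<open>q\<close> is a vertex, and both
  routes end there.\<close>

lemma along_along_across:
  assumes "p \<in> X" "q \<in> X" "r \<in> X" "coedge p q" "coedge q r" "\<not> coedge p r"
  shows "across p r \<le> along p q + along q r"
proof -
  obtain u v where uv: "edge u v" "supp p \<subseteq> {u, v}" "supp q \<subseteq> {u, v}"
    using assms(4) unfolding coedge_def by blast
  obtain u' v' where uv': "edge u' v'" "supp q \<subseteq> {u', v'}" "supp r \<subseteq> {u', v'}"
    using assms(5) unfolding coedge_def by blast
  obtain a where a: "a \<in> supp q" using X_supp(2)[OF assms(2)] by blast
  have "supp q = {a}"
  proof (rule ccontr)
    assume "supp q \<noteq> {a}"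
    then obtain b where b: "b \<in> supp q" "b \<noteq> a" using a by blast
    have "{u, v} = {a, b}" using edge_eq[OF uv(1), of a b] a b uv(3) by blast
    moreover have "{u', v'} = {a, b}" using edge_eq[OF uv'(1), of a b] a b uv'(2) by blast
    ultimately have "supp r \<subseteq> {u, v}" using uv'(3) by simp
    then show False using assms(6) uv(1,2) unfolding coedge_def by blast
  qed
  then have qa: "q a = 1" using X_vertex(2)[OF assms(2)] X_supp(3)[OF assms(2)] a by blast
  obtain x where x: "x \<in> supp p" "(1 - p x) + real (D x a) \<le> along p q + (1 - q a)"
    using coedge_exit[OF assms(1,2,4) a] by blast
  obtain z where z: "z \<in> supp r" "(1 - r z) + real (D z a) \<le> along r q + (1 - q a)"
    using coedge_exit[OF assms(3,2) _ a] assms(5) coedge_sym by blast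
  have V: "x \<in> V" "a \<in> V" "z \<in> V" using x z a X_supp(3) assms by blast+
  have "across p r \<le> via p r x z" using across_le[OF assms(1,3) x(1) z(1)] .
  moreover have "real (D x z) \<le> D x a + D z a" using D_triangle[OF V] D_sym[OF V(2,3)] by linarith
  ultimately show ?thesis using x(2) z(2) qa along_sym[of r q] by (simp add: via_def)
qed

lemma along_triangle:
  assumes "p \<in> X" "q \<in> X" "r \<in> X"
  shows "along p r \<le> along p q + along q r"
proof -
  let ?F = "supp p \<union> supp q \<union> supp r"
  have F: "finite ?F" using X_supp(1) assms by blast
  have "(\<Sum>x\<in>?F. \<bar>p x - r x\<bar>) \<le> (\<Sum>x\<in>?F. \<bar>p x - q x\<bar> + \<bar>q x - r x\<bar>)"
    by (intro sum_mono) simp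
  then show ?thesis
    using along_eq_sum[OF F, of p r] along_eq_sum[OF F, of p q] along_eq_sum[OF F, of q r]
    by (simp add: sum.distrib Un_assoc le_supI1 le_supI2)
qed

lemma dst_sym: "p \<in> X \<Longrightarrow> q \<in> X \<Longrightarrow> dst p q = dst q p"
  using coedge_sym[of p q] along_sym[of p q] across_sym[of p q] by (simp add: dst_eq)

lemma dst_le_across: "p \<in> X \<Longrightarrow> q \<in> X \<Longrightarrow> dst p q \<le> across p q"
  using along_le_across by (simp add: dst_eq)

lemma dst_triangle:
  assumes "p \<in> X" "q \<in> X" "r \<in> X"
  shows "dst p r \<le> dst p q + dst q r"
proof -
  have 1: "across p r \<le> along p q + across q r" if "coedge p q"
    by (rule along_across_triangle[OF assms that])
  have 2: "across p r \<le> across p q + along q r" if "coedge q r"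
    using along_across_triangle[OF assms(3,2,1)] that coedge_sym[of r q] across_sym[OF assms(1,3)]
      across_sym[OF assms(1,2)] along_sym[of r q] by simp
  note 3 = across_triangle[OF assms]
  note 4 = dst_le_across[OF assms(1,3)]
  show ?thesis
  proof (cases "coedge p q \<and> coedge q r")
    case True
    then show ?thesis
      using along_triangle[OF assms] along_along_across[OF assms] by (simp add: assms dst_eq)
  next
    case False
    then show ?thesis using 1 2 3 4 by (auto simp: assms dst_eq)
  qed
qed

lemma coedge_refl: "p \<in> X \<Longrightarrow> coedge p p"
proof -
  assume "p \<in> X"
  then obtain u v t where "edge u v" "p = pt u v t" by (rule X_E)
  then show ?thesis using supp_pt_subset[of u v t] unfolding coedge_def by blast
qed

lemma dst_zero:
  assumes "p \<in> X" "q \<in> X"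
  shows "dst p q = 0 \<longleftrightarrow> p = q"
proof
  assume "p = q"
  then show "dst p q = 0" using coedge_refl[OF assms(1)] by (simp add: assms dst_eq along_def)
next
  assume z: "dst p q = 0"
  \<comment> \<open>Distance 0 across the graph forces full weight at one common vertex, and then
    the points do share an edge.\<close>
  have "coedge p q"
  proof (rule ccontr)
    assume n: "\<not> coedge p q"
    obtain x y where xy: "x \<in> supp p" "y \<in> supp q" "across p q = via p q x y"
      using across_attained[OF assms] .
    have V: "x \<in> V" "y \<in> V" using xy X_supp(3) assms by blast+
    have "via p q x y = 0" using n z xy by (simp add: assms dst_eq)
    then have 0: "p x = 1" "q y = 1" "D x y = 0"
      using X_supp(5)[OF assms(1), of x] X_supp(5)[OF assms(2), of y] unfolding via_def by auto
    have "supp p = {x}" 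
    proof (rule ccontr)
      assume "supp p \<noteq> {x}"
      then obtain w where "w \<in> supp p" "w \<noteq> x" using xy by blast
      then show False using X_supp(6)[OF assms(1), of w x] 0(1) xy by (simp add: supp_def)
    qed
    moreover have "supp q = {y}"
    proof (rule ccontr)
      assume "supp q \<noteq> {y}"
      then obtain w where "w \<in> supp q" "w \<noteq> y" using xy by blast
      then show False using X_supp(6)[OF assms(2), of w y] 0(2) xy by (simp add: supp_def)
    qed
    moreover have "x = y" using 0(3) D_zero[OF V] by simp
    ultimately show False using n edge_refl[OF V(1)] unfolding coedge_def by blast
  qed
  then have s: "(\<Sum>x\<in>supp p \<union> supp q. \<bar>p x - q x\<bar>) = 0" using z by (simp add: assms dst_eq along_def)
  have "finite (supp p \<union> supp q)" using X_supp(1) assms by blast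
  then have 0: "\<forall>x\<in>supp p \<union> supp q. \<bar>p x - q x\<bar> = 0"
    using s by (subst (asm) sum_nonneg_eq_0_iff) auto
  show "p = q"
  proof
    fix x
    show "p x = q x"
    proof (cases "x \<in> supp p \<union> supp q")
      case True
      from bspec[OF 0 True] show ?thesis by simp
    qed (simp add: supp_def)
  qed
qed

lemma dst_nonneg:
  assumes "p \<in> X" "q \<in> X"
  shows "0 \<le> dst p q"
proof -
  have "dst p p = 0" using dst_zero[OF assms(1,1)] by simp
  then show ?thesis using dst_triangle[OF assms(1,2,1)] dst_sym[OF assms] by linarith
qed

sublocale Metric_space X dst
proof
  fix p q r
  show "0 \<le> dst p q"
  proof (cases "p \<in> X \<and> q \<in> X")
    case True then show ?thesis using dst_nonneg by blast
  next
    case False then show ?thesis by (auto simp: dst_def)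
  qed
  show "dst p q = dst q p"
  proof (cases "p \<in> X \<and> q \<in> X")
    case True then show ?thesis by (intro dst_sym) auto
  next
    case False then show ?thesis by (auto simp: dst_def)
  qed
  show "dst p q = 0 \<longleftrightarrow> p = q" if "p \<in> X" "q \<in> X" by (rule dst_zero[OF that])
  show "dst p r \<le> dst p q + dst q r" if "p \<in> X" "q \<in> X" "r \<in> X" by (rule dst_triangle[OF that])
qed

end


section \<open>Folding along a wall\<close>

context Metric_space
begin

text \<open>Any loss of length on a subinterval would contradict the triangle inequality between the
  end points.\<close>

lemma geodesicI_lipschitz:
  assumes x: "x \<in> M" "y \<in> M" and M: "\<And>t. t \<in> {0..d x y} \<Longrightarrow> \<zeta> t \<in> M"
    and ends: "\<zeta> 0 = x" "\<zeta> (d x y) = y"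
    and lip: "\<And>s t. 0 \<le> s \<Longrightarrow> s \<le> t \<Longrightarrow> t \<le> d x y \<Longrightarrow> d (\<zeta> s) (\<zeta> t) \<le> t - s"
  shows "geodesic x y \<zeta>"
proof -
  have eq: "d (\<zeta> s) (\<zeta> t) = t - s" if st: "0 \<le> s" "s \<le> t" "t \<le> d x y" for s t
  proof -
    have m: "\<zeta> s \<in> M" "\<zeta> t \<in> M" using M st by auto
    have "d x y \<le> d x (\<zeta> s) + d (\<zeta> s) y" by (rule triangle[OF x(1) m(1) x(2)])
    moreover have "d (\<zeta> s) y \<le> d (\<zeta> s) (\<zeta> t) + d (\<zeta> t) y" by (rule triangle[OF m x(2)])
    moreover have "d x (\<zeta> s) \<le> s" using lip[of 0 s] st ends by simp
    moreover have "d (\<zeta> t) y \<le> d x y - t" using lip[of t "d x y"] st ends by simp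
    ultimately show ?thesis using lip[OF st] by linarith
  qed
  show ?thesis
    unfolding geodesic_def
  proof (intro conjI ballI ends)
    show "\<zeta> \<in> {0..d x y} \<rightarrow> M" using M by blast
    fix s t assume st: "s \<in> {0..d x y}" "t \<in> {0..d x y}"
    show "d (\<zeta> s) (\<zeta> t) = \<bar>s - t\<bar>"
    proof (cases "s \<le> t")
      case True
      then show ?thesis using eq[of s t] st by simp
    next
      case False
      then show ?thesis using eq[of t s] st commute[of "\<zeta> s"] by simp
    qed
  qed
qed

lemma geodesic_concat:
  assumes M: "x \<in> M" "y \<in> M" "z \<in> M" and g: "geodesic x z \<xi>" "geodesic z y \<eta>"
    and eq: "d x z + d z y = d x y"
  shows "\<exists>\<zeta>. geodesic x y \<zeta>"
proof -
  define \<zeta> where "\<zeta> t = (if t \<le> d x z then \<xi> t else \<eta> (t - d x z))" for t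
  have "geodesic x y \<zeta>"
  proof (rule geodesicI_lipschitz[OF M(1,2)])
    show "\<zeta> 0 = x" using geodesic_endpoints(1)[OF g(1)] by (simp add: \<zeta>_def)
    show "\<zeta> (d x y) = y"
    proof (cases "d z y = 0")
      case True
      then show ?thesis
        using eq geodesic_endpoints(2)[OF g(1)] M by (simp add: \<zeta>_def)
    next
      case False
      then have "0 < d z y" using nonneg[of z y] by linarith
      then have "\<not> d x y \<le> d x z" "d x y - d x z = d z y" using eq by linarith+
      then show ?thesis using geodesic_endpoints(2)[OF g(2)] by (simp add: \<zeta>_def)
    qed
    show M': "\<zeta> t \<in> M" if "t \<in> {0..d x y}" for t
      using that eq geodesic_endpoints(3)[OF g(1), of t] geodesic_endpoints(3)[OF g(2), of "t - d x z"]
      by (auto simp: \<zeta>_def)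
    fix s t :: real assume st: "0 \<le> s" "s \<le> t" "t \<le> d x y"
    consider "t \<le> d x z" | "d x z < s" | "s \<le> d x z" "d x z < t" by linarith
    then show "d (\<zeta> s) (\<zeta> t) \<le> t - s"
    proof cases
      case 1
      then show ?thesis using st geodesic_dist[OF g(1), of s t] by (simp add: \<zeta>_def)
    next
      case 2
      then show ?thesis
        using st eq geodesic_dist[OF g(2), of "s - d x z" "t - d x z"] by (simp add: \<zeta>_def)
    next
      case 3
      have "d (\<zeta> s) (\<zeta> t) \<le> d (\<zeta> s) z + d z (\<zeta> t)"
        using M(3) M' st by (intro triangle) auto
      also have "d (\<zeta> s) z = d x z - s"
        using 3 st geodesic_dist_endpoints(2)[OF g(1), of s] by (simp add: \<zeta>_def)
      also have "d z (\<zeta> t) = t - d x z"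
        using 3 st eq geodesic_dist_endpoints(1)[OF g(2), of "t - d x z"] by (simp add: \<zeta>_def)
      finally show ?thesis by simp
    qed
  qed
  then show ?thesis by blast
qed

lemma geodesic_refl: "x \<in> M \<Longrightarrow> geodesic x x (\<lambda>_. x)"
  by (simp add: geodesic_def)

lemma connectedin_separation:
  assumes "connectedin mtopology I" "openin mtopology A" "openin mtopology B" "A \<inter> B = {}"
    "I \<subseteq> A \<union> B" "x \<in> I" "x \<in> A"
  shows "I \<subseteq> A"
proof (rule ccontr)
  assume "\<not> I \<subseteq> A"
  then have "B \<inter> I \<noteq> {}" "A \<inter> I \<noteq> {}" "A \<inter> B \<inter> I = {}" using assms(4-7) by blast+
  then show False using connectedinD[OF assms(1-3,5)] by blast
qed

lemma geodesic_meets_separator: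
  assumes g: "geodesic x y \<xi>"
    and AB: "openin mtopology A" "openin mtopology B" "A \<inter> B = {}" "M \<subseteq> A \<union> B \<union> F"
    and x: "x \<in> A" and t: "t \<in> {0..d x y}" "\<xi> t \<notin> A"
  shows "\<exists>s\<in>{0..d x y}. \<xi> s \<in> F"
proof (rule ccontr)
  assume n: "\<not> (\<exists>s\<in>{0..d x y}. \<xi> s \<in> F)"
  let ?I = "\<xi> ` {0..d x y}"
  have "?I \<subseteq> A \<union> B" using n geodesic_endpoints(3)[OF g] AB(4) by blast
  from connectedin_separation[OF connectedin_geodesic[OF g] AB(1-3) this geodesic_endpoints_image(1)[OF g] x]
  show False using t by blast
qed

text \<open>Folding a geodesic along the wall gives a geodesic again. If the geodesic touched the wall, the
  folded one would turn back there, although it is determined by its distance from the wall point.\<close>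

lemma geodesically_convex_side:
  assumes geo: "geodesic_space" and r: "r \<in> isometries"
    and AB: "openin mtopology A" "openin mtopology B" "A \<inter> B = {}" "A \<union> B = M - wall r"
    and swap: "r ` B = A"
    and isolated: "\<And>z. z \<in> wall r \<Longrightarrow> \<exists>e>0. mball z e \<inter> wall r \<subseteq> {z} \<and>
      (\<forall>a\<in>A. \<forall>b\<in>A. d z a < e \<and> d z b = d z a \<longrightarrow> a = b)"
  shows "geodesically_convex A"
  unfolding geodesically_convex_def
proof (intro conjI ballI allI impI)
  have AM: "A \<subseteq> M" "B \<subseteq> M" "wall r \<subseteq> M" using AB(4) by (auto simp: wall_def)
  then show "A \<subseteq> M" by simp
  have cover: "M \<subseteq> A \<union> B \<union> wall r" using AB(4) by blast
  have rM: "r p \<in> M" "d (r p) (r q) = d p q" if "p \<in> M" "q \<in> M" for p q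
    using isometriesD(2,3)[OF r] that by auto
  have fixed: "r p = p" if "p \<in> wall r" for p using that by (simp add: wall_def)
  define \<rho> where "\<rho> p = (if p \<in> B then r p else p)" for p
  have \<rho>A: "\<rho> p \<in> A \<union> wall r" if "p \<in> M" for p
    using that cover swap by (auto simp: \<rho>_def)
  \<comment> \<open>A geodesic from \<open>p\<close> to \<open>q\<close> meets the wall at a fixed
    point; reflecting the part behind it gives a path of the same length to \<open>r q\<close>. So
    folding does not increase distances.\<close>
  have cross: "d p (r q) \<le> d p q" if p: "p \<in> A \<union> wall r" and q: "q \<in> B" for p q
  proof (cases "p \<in> A")
    case True
    have pq: "p \<in> M" "q \<in> M" "q \<notin> A" using AM AB(3) True q by blast+
    obtain \<xi> where g: "geodesic p q \<xi>" using geo pq unfolding geodesic_space_def by blast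
    obtain s where s: "s \<in> {0..d p q}" "\<xi> s \<in> wall r"
      using geodesic_meets_separator[OF g AB(1-3) cover True, of "d p q"] pq(3)
        geodesic_endpoints(2)[OF g] by auto
    have z: "\<xi> s \<in> M" using s AM by blast
    have "d p (r q) \<le> d p (\<xi> s) + d (\<xi> s) (r q)"
      by (rule triangle[OF pq(1) z rM(1)[OF pq(2,2)]])
    also have "d (\<xi> s) (r q) = d (\<xi> s) q" using rM(2)[OF z pq(2)] fixed[OF s(2)] by simp
    finally show ?thesis using geodesic_dist_endpoints[OF g s(1)] by simp
  next
    case False
    then have pw: "p \<in> wall r" using p by blast
    have "p \<in> M" "q \<in> M" using pw q AM by blast+
    then show ?thesis using rM(2)[of p q] fixed[OF pw] by simp
  qed
  have lip: "d (\<rho> p) (\<rho> q) \<le> d p q" if pq: "p \<in> M" "q \<in> M" for p q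
  proof -
    consider "p \<in> B" "q \<in> B" | "p \<in> B" "q \<notin> B" | "p \<notin> B" "q \<in> B" | "p \<notin> B" "q \<notin> B" by blast
    then show ?thesis
    proof cases
      case 1 then show ?thesis using rM(2)[OF pq] by (simp add: \<rho>_def)
    next
      case 2
      then have "d q (r p) \<le> d q p" using cross[of q p] cover pq by blast
      then show ?thesis using 2 commute[of q] by (simp add: \<rho>_def)
    next
      case 3
      then have "d p (r q) \<le> d p q" using cross[of p q] cover pq by blast
      then show ?thesis using 3 by (simp add: \<rho>_def)
    next
      case 4 then show ?thesis by (simp add: \<rho>_def)
    qed
  qed
  fix x y \<xi> assume xy: "x \<in> A" "y \<in> A" and g: "geodesic x y \<xi>"
  show "\<xi> ` {0..d x y} \<subseteq> A"
  proof (rule ccontr)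
    assume "\<not> \<xi> ` {0..d x y} \<subseteq> A"
    then obtain t' where "t' \<in> {0..d x y}" "\<xi> t' \<notin> A" by blast
    then obtain t where t: "t \<in> {0..d x y}" "\<xi> t \<in> wall r"
      using geodesic_meets_separator[OF g AB(1-3) cover xy(1)] by blast
    have xyM: "x \<in> M" "y \<in> M" using xy AM by blast+
    have \<xi>M: "\<xi> s \<in> M" if "s \<in> {0..d x y}" for s using geodesic_endpoints(3)[OF g that] .
    define \<zeta> where "\<zeta> = \<rho> \<circ> \<xi>"
    have \<rho>id: "\<rho> p = p" if "p \<in> A \<union> wall r" for p using that AB(3,4) by (auto simp: \<rho>_def)
    have gz: "geodesic x y \<zeta>"
    proof (rule geodesicI_lipschitz[OF xyM])
      show "\<zeta> s \<in> M" if "s \<in> {0..d x y}" for s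
        using \<rho>A[OF \<xi>M[OF that]] AM by (auto simp: \<zeta>_def)
      show "\<zeta> 0 = x" "\<zeta> (d x y) = y"
        using \<rho>id[of x] \<rho>id[of y] xy geodesic_endpoints(1,2)[OF g] by (auto simp: \<zeta>_def)
      fix s u :: real assume "0 \<le> s" "s \<le> u" "u \<le> d x y"
      then have su: "s \<in> {0..d x y}" "u \<in> {0..d x y}" "\<bar>s - u\<bar> = u - s" by auto
      show "d (\<zeta> s) (\<zeta> u) \<le> u - s"
        using lip[OF \<xi>M[OF su(1)] \<xi>M[OF su(2)]] geodesic_dist[OF g su(1,2)] su(3) by (simp add: \<zeta>_def)
    qed
    have zt: "\<zeta> t = \<xi> t" using \<rho>id t(2) by (simp add: \<zeta>_def)
    have "x \<notin> wall r" "y \<notin> wall r" using xy AB(4) by blast+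
    then have "t \<noteq> 0" "t \<noteq> d x y" using t(2) geodesic_endpoints(1,2)[OF g] by auto
    then have tt: "0 < t" "t < d x y" using t(1) by auto
    obtain e where e: "e > 0" "mball (\<xi> t) e \<inter> wall r \<subseteq> {\<xi> t}"
      "\<And>a b. a \<in> A \<Longrightarrow> b \<in> A \<Longrightarrow> d (\<xi> t) a < e \<Longrightarrow> d (\<xi> t) b = d (\<xi> t) a \<Longrightarrow> a = b"
      using isolated[OF t(2)] by blast
    \<comment> \<open>Small enough for both \<open>t - \<delta>\<close> and
      \<open>t + \<delta>\<close> to stay in the parameter interval and within \<open>e\<close> of
      the wall point.\<close>
    define \<delta> where "\<delta> = min (min t (d x y - t)) e / 2"
    have \<delta>: "0 < \<delta>" "\<delta> < t" "\<delta> < d x y - t" "\<delta> < e" using tt e(1) by (auto simp: \<delta>_def)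
    have in_A: "\<zeta> s \<in> A" and dist: "d (\<xi> t) (\<zeta> s) = \<delta>" if s: "s \<in> {0..d x y}" "\<bar>t - s\<bar> = \<delta>" for s
    proof -
      show ds: "d (\<xi> t) (\<zeta> s) = \<delta>" using geodesic_dist[OF gz t(1) s(1)] s(2) zt by simp
      have "\<zeta> s \<notin> wall r"
      proof
        assume w: "\<zeta> s \<in> wall r"
        then have "\<zeta> s \<in> mball (\<xi> t) e" using ds \<delta>(4) AM(3) t(2) by auto
        then have "\<zeta> s = \<xi> t" using w e(2) by blast
        then show False using ds \<delta>(1) \<xi>M[OF t(1)] by simp
      qed
      then show "\<zeta> s \<in> A" using \<rho>A[OF \<xi>M[OF s(1)]] by (simp add: \<zeta>_def)
    qed
    have st: "t - \<delta> \<in> {0..d x y}" "\<bar>t - (t - \<delta>)\<bar> = \<delta>" "t + \<delta> \<in> {0..d x y}" "\<bar>t - (t + \<delta>)\<bar> = \<delta>"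
      using \<delta> tt by auto
    \<comment> \<open>Both points lie on the side \<open>A\<close> at distance
      \<open>\<delta>\<close> from the wall point, hence coincide, although the folded geodesic puts
      them \<open>2 * \<delta>\<close> apart.\<close>
    have "\<zeta> (t - \<delta>) = \<zeta> (t + \<delta>)"
      using e(3)[OF in_A[OF st(1,2)] in_A[OF st(3,4)]] dist[OF st(1,2)] dist[OF st(3,4)] \<delta>(4) by simp
    moreover have "d (\<zeta> (t - \<delta>)) (\<zeta> (t + \<delta>)) = 2 * \<delta>"
      using geodesic_dist[OF gz st(1,3)] \<delta>(1) by simp
    moreover have "\<zeta> (t + \<delta>) \<in> M" using in_A[OF st(3,4)] AM by blast
    ultimately show False using \<delta>(1) by simp
  qed
qed

text \<open>The sides are convex by folding, hence connected, and as disjoint open sets covering the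
  complement of the wall they are its components. The wall has empty interior because its points are
  isolated in it, whereas geodesics to points of \<open>A\<close> start at each of them.\<close>

lemma reflectionI:
  assumes geo: "geodesic_space" and r: "r \<in> isometries" and invol: "\<And>x. x \<in> M \<Longrightarrow> r (r x) = x"
    and AB: "openin mtopology A" "openin mtopology B" "A \<inter> B = {}" "A \<union> B = M - wall r"
    and swap: "r ` A = B" "r ` B = A" and ne: "A \<noteq> {}"
    and isolated: "\<And>z. z \<in> wall r \<Longrightarrow> \<exists>e>0. mball z e \<inter> wall r \<subseteq> {z} \<and>
      (\<forall>a b. (a \<in> A \<and> b \<in> A \<or> a \<in> B \<and> b \<in> B) \<and> d z a < e \<and> d z b = d z a \<longrightarrow> a = b)"
  shows "reflection r"
proof -
  have cA: "geodesically_convex A"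
  proof (rule geodesically_convex_side[OF geo r AB swap(2)])
    fix z assume "z \<in> wall r"
    from isolated[OF this] show "\<exists>e>0. mball z e \<inter> wall r \<subseteq> {z} \<and>
      (\<forall>a\<in>A. \<forall>b\<in>A. d z a < e \<and> d z b = d z a \<longrightarrow> a = b)" by meson
  qed
  have cB: "geodesically_convex B"
  proof (rule geodesically_convex_side[OF geo r AB(2,1) _ _ swap(1)])
    show "B \<inter> A = {}" "B \<union> A = M - wall r" using AB(3,4) by auto
    fix z assume "z \<in> wall r"
    from isolated[OF this] show "\<exists>e>0. mball z e \<inter> wall r \<subseteq> {z} \<and>
      (\<forall>a\<in>B. \<forall>b\<in>B. d z a < e \<and> d z b = d z a \<longrightarrow> a = b)" by meson
  qed
  have neB: "B \<noteq> {}" using swap(1) ne by blast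
  let ?X = "subtopology mtopology (M - wall r)"
  have comp: "connected_component_of_set ?X x = E"
    if E: "connectedin mtopology E" "openin mtopology E" "openin mtopology E'" "E \<inter> E' = {}"
      "E \<union> E' = M - wall r" "x \<in> E" for x E E'
  proof
    have "E \<subseteq> M - wall r" using E(5) by blast
    then show "E \<subseteq> connected_component_of_set ?X x"
      using E(1,6) by (intro connected_component_of_maximal) (auto simp: connectedin_subtopology)
    have con: "connectedin ?X (connected_component_of_set ?X x)"
      by (rule connectedin_connected_component_of)
    have "x \<in> topspace ?X" using E(5,6) by auto
    then have "x \<in> connected_component_of_set ?X x" by (simp add: connected_component_of_refl)
    then show "connected_component_of_set ?X x \<subseteq> E"
      using con E(5,6) by (intro connectedin_separation[OF _ E(2-4)]) (auto simp: connectedin_subtopology)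
  qed
  have compA: "connected_component_of_set ?X x = A" if "x \<in> A" for x
    by (rule comp[OF connectedin_geodesically_convex[OF geo cA] AB that])
  have compB: "connected_component_of_set ?X x = B" if "x \<in> B" for x
    using that AB(3,4) by (intro comp[OF connectedin_geodesically_convex[OF geo cB] AB(2,1)]) auto
  have top: "topspace ?X = A \<union> B" using AB(4) by auto
  have comps: "connected_components_of ?X = {A, B}"
    unfolding connected_components_of_def top using compA compB ne neB
    by (auto simp: image_Un image_constant_conv cong: image_cong_simp)
  have int: "mtopology interior_of wall r = {}"
    unfolding interior_of_eq_empty
  proof (intro allI impI)
    fix U assume U: "openin mtopology U \<and> U \<subseteq> wall r"
    show "U = {}"
    proof (rule ccontr)
      assume "U \<noteq> {}"
      then obtain z where z: "z \<in> U" by blast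
      then have zw: "z \<in> wall r" "z \<in> M" using U by (auto simp: wall_def)
      obtain e where e: "e > 0" "mball z e \<subseteq> U" using U z unfolding openin_mtopology by blast
      obtain e' where e': "e' > 0" "mball z e' \<inter> wall r \<subseteq> {z}" using isolated[OF zw(1)] by blast
      obtain a where a: "a \<in> A" using ne by blast
      have aM: "a \<in> M" "a \<noteq> z" using a AB(4) zw by blast+
      obtain \<xi> where g: "geodesic z a \<xi>" using geo zw aM unfolding geodesic_space_def by blast
      have dpos: "0 < d z a" using zw aM by (simp add: mdist_pos_eq)
      define s where "s = min (min e e') (d z a) / 2"
      have s: "0 < s" "s < e" "s < e'" "s \<in> {0..d z a}"
        using e(1) e'(1) dpos by (auto simp: s_def min_def)
      have ds: "d z (\<xi> s) = s" "\<xi> s \<in> M"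
        using geodesic_dist_endpoints(1)[OF g s(4)] geodesic_endpoints(3)[OF g s(4)] by auto
      then have "\<xi> s \<in> mball z e" "\<xi> s \<in> mball z e'" using zw s by auto
      then have "\<xi> s = z" using e(2) e'(2) U by blast
      then show False using ds s(1) zw by simp
    qed
  qed
  have "A \<noteq> B" using ne AB(3) by blast
  then show ?thesis
    unfolding reflection_def
    by (intro conjI exI[of _ A] exI[of _ B] ballI r invol comps cA cB swap int)
qed

end


section \<open>Geodesics and automorphisms of metric graphs\<close>

context metric_graph
begin

lemma dst_on_edge:
  assumes "p \<in> X" "q \<in> X" "edge u v" "supp p \<subseteq> {u, v}" "supp q \<subseteq> {u, v}"
  shows "dst p q = \<bar>p u - q u\<bar>"
proof -
  have "coedge p q" unfolding coedge_def using assms by blast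
  then show ?thesis using along_on_edge[OF assms] assms(1,2) by (simp add: dst_eq)
qed

lemma supp_edge:
  assumes "p \<in> X" "x \<in> supp p"
  obtains w where "edge x w" "supp p \<subseteq> {x, w}"
proof -
  obtain u v t where p: "edge u v" "p = pt u v t" "0 \<le> t" "t \<le> 1" using X_E[OF assms(1)] .
  have sub: "supp p \<subseteq> {u, v}" unfolding p(2) by (rule supp_pt_subset)
  show ?thesis
  proof (cases "x = u")
    case True
    then show ?thesis using that[of v] p(1) sub by simp
  next
    case False
    then have "x = v" using assms(2) sub by blast
    then show ?thesis using that[of u] edge_sym[OF p(1)] sub by (simp add: insert_commute)
  qed
qed

lemma dst_vertex:
  assumes "p \<in> X" "x \<in> supp p"
  shows "dst p (pt x x 0) = 1 - p x"
proof -
  obtain w where w: "edge x w" "supp p \<subseteq> {x, w}" using supp_edge[OF assms] .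
  have x: "x \<in> V" using w(1) by (simp add: edge_def)
  have "dst p (pt x x 0) = \<bar>p x - pt x x 0 x\<bar>"
    by (rule dst_on_edge[OF assms(1) vertex_in_X[OF x] w]) (simp add: supp_vertex)
  then show ?thesis using X_supp(5)[OF assms(1), of x] by (simp add: pt_apply)
qed

lemma dst_vertices:
  assumes "x \<in> V" "y \<in> V"
  shows "dst (pt x x 0) (pt y y 0) = D x y"
proof (cases "coedge (pt x x 0) (pt y y 0)")
  case True
  then obtain u v where uv: "edge u v" "x \<in> {u, v}" "y \<in> {u, v}"
    unfolding coedge_def supp_vertex by blast
  show ?thesis
  proof (cases "x = y")
    case True
    then show ?thesis using D_zero[OF assms] vertex_in_X[OF assms(1)] by simp
  next
    case False
    then have "u = x \<and> v = y \<or> u = y \<and> v = x" using uv(2,3) by blast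
    then have e: "edge x y" using uv(1) edge_sym by blast
    have "D x y \<noteq> 0" using D_zero[OF assms] False by simp
    then have "D x y = 1" using e by (simp add: edge_def)
    moreover have "dst (pt x x 0) (pt y y 0) = \<bar>pt x x 0 x - pt y y 0 x\<bar>"
      by (rule dst_on_edge[OF vertex_in_X[OF assms(1)] vertex_in_X[OF assms(2)] e]) (simp_all add: supp_vertex)
    ultimately show ?thesis using False by (simp add: pt_apply)
  qed
next
  case False
  obtain a b where "a \<in> supp (pt x x 0)" "b \<in> supp (pt y y 0)"
    "across (pt x x 0) (pt y y 0) = via (pt x x 0) (pt y y 0) a b"
    using across_attained[OF vertex_in_X[OF assms(1)] vertex_in_X[OF assms(2)]] .
  then show ?thesis
    using False vertex_in_X assms by (simp add: supp_vertex dst_eq via_def pt_apply)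
qed

section \<open>Existence of geodesics\<close>

lemma geodesic_coedge:
  assumes "p \<in> X" "q \<in> X" "edge u v" "supp p \<subseteq> {u, v}" "supp q \<subseteq> {u, v}"
  shows "\<exists>\<xi>. geodesic p q \<xi>"
proof (cases "u = v")
  case True
  then have "p = q"
    using X_vertex(1)[of p u] X_vertex(1)[of q u] assms by (simp add: edge_def)
  then show ?thesis using geodesic_refl[OF assms(1)] by blast
next
  case False
  define \<sigma> where "\<sigma> = (if p v \<le> q v then 1 else - 1 :: real)"
  define \<xi> where "\<xi> \<tau> = pt u v (p v + \<sigma> * \<tau>)" for \<tau>
  have pv: "0 \<le> p v" "p v \<le> 1" "0 \<le> q v" "q v \<le> 1"
    using X_supp(4,5)[OF assms(1)] X_supp(4,5)[OF assms(2)] by auto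
  have L: "dst p q = \<bar>p v - q v\<bar>"
    using dst_on_edge[OF assms(1,2) edge_sym[OF assms(3)]] assms(4,5) by (simp add: insert_commute)
  have \<sigma>: "\<sigma> * dst p q = q v - p v" "\<sigma> = 1 \<or> \<sigma> = - 1" unfolding L \<sigma>_def by auto
  have range: "0 \<le> p v + \<sigma> * \<tau>" "p v + \<sigma> * \<tau> \<le> 1" if "0 \<le> \<tau>" "\<tau> \<le> dst p q" for \<tau>
    using that pv unfolding L \<sigma>_def by (auto split: if_splits)
  have \<xi>X: "\<xi> \<tau> \<in> X" if "0 \<le> \<tau>" "\<tau> \<le> dst p q" for \<tau>
    unfolding \<xi>_def using range[OF that] by (intro pt_in_X[OF assms(3)])
  have "geodesic p q \<xi>"
  proof (rule geodesicI_lipschitz[OF assms(1,2)])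
    show "\<xi> 0 = p" using X_on_edge(1)[OF assms(1,3,4)] by (simp add: \<xi>_def)
    have "p v + \<sigma> * dst p q = q v" using \<sigma>(1) by simp
    then show "\<xi> (dst p q) = q"
      using X_on_edge(1)[OF assms(2,3,5)] by (simp add: \<xi>_def)
    show "\<xi> \<tau> \<in> X" if "\<tau> \<in> {0..dst p q}" for \<tau> using \<xi>X that by simp
    fix s t :: real assume st: "0 \<le> s" "s \<le> t" "t \<le> dst p q"
    have "dst (\<xi> s) (\<xi> t) = \<bar>\<xi> s u - \<xi> t u\<bar>"
      using st by (intro dst_on_edge[OF \<xi>X \<xi>X assms(3)]) (simp_all add: \<xi>_def supp_pt_subset)
    also have "\<dots> = \<bar>\<sigma> * (t - s)\<bar>" using False by (simp add: \<xi>_def pt_apply algebra_simps)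
    also have "\<dots> = t - s" using \<sigma>(2) st by auto
    finally show "dst (\<xi> s) (\<xi> t) \<le> t - s" by simp
  qed
  then show ?thesis by blast
qed

lemma geodesic_vertices:
  assumes "x \<in> V" "y \<in> V"
  shows "\<exists>\<xi>. geodesic (pt x x 0) (pt y y 0) \<xi>"
  using assms
proof (induction "D x y" arbitrary: x)
  case 0
  then have "x = y" using D_zero by simp
  then show ?case using geodesic_refl[OF vertex_in_X[OF 0(2)]] by blast
next
  case (Suc n)
  obtain z where z: "z \<in> V" "D x z = 1" "D z y = n"
    using D_step[OF Suc(3,4) Suc(2)[symmetric]] by blast
  obtain \<eta> where \<eta>: "geodesic (pt z z 0) (pt y y 0) \<eta>"
    using Suc(1)[OF z(3)[symmetric] z(1) Suc(4)] by blast
  have "edge x z" using Suc(3) z by (simp add: edge_def)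
  then obtain \<xi> where \<xi>: "geodesic (pt x x 0) (pt z z 0) \<xi>"
    using geodesic_coedge[OF vertex_in_X[OF Suc(3)] vertex_in_X[OF z(1)], of x z] by (auto simp: supp_vertex)
  have "dst (pt x x 0) (pt z z 0) + dst (pt z z 0) (pt y y 0) = dst (pt x x 0) (pt y y 0)"
    using Suc(2) z Suc(3,4) by (simp add: dst_vertices)
  then show ?case
    using geodesic_concat[OF vertex_in_X[OF Suc(3)] vertex_in_X[OF Suc(4)] vertex_in_X[OF z(1)] \<xi> \<eta>] by blast
qed

lemma geodesic_to_vertex:
  assumes "p \<in> X" "x \<in> supp p"
  shows "\<exists>\<xi>. geodesic p (pt x x 0) \<xi>" "\<exists>\<xi>. geodesic (pt x x 0) p \<xi>"
proof -
  obtain w where w: "edge x w" "supp p \<subseteq> {x, w}" using supp_edge[OF assms] .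
  have x: "pt x x 0 \<in> X" "supp (pt x x 0) \<subseteq> {x, w}"
    using w(1) vertex_in_X by (auto simp: edge_def supp_vertex)
  show "\<exists>\<xi>. geodesic p (pt x x 0) \<xi>" by (rule geodesic_coedge[OF assms(1) x(1) w x(2)])
  show "\<exists>\<xi>. geodesic (pt x x 0) p \<xi>" by (rule geodesic_coedge[OF x(1) assms(1) w(1) x(2) w(2)])
qed

lemma geodesic_space: "geodesic_space"
  unfolding geodesic_space_def
proof (intro ballI)
  fix p q assume pq: "p \<in> X" "q \<in> X"
  show "\<exists>\<xi>. geodesic p q \<xi>"
  proof (cases "coedge p q")
    case True
    then obtain u v where "edge u v" "supp p \<subseteq> {u, v}" "supp q \<subseteq> {u, v}"
      unfolding coedge_def by blast
    then show ?thesis by (rule geodesic_coedge[OF pq])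
  next
    case False
    obtain x y where xy: "x \<in> supp p" "y \<in> supp q" "across p q = via p q x y"
      using across_attained[OF pq] .
    have V: "x \<in> V" "y \<in> V" using xy X_supp(3) pq by blast+
    let ?x = "pt x x 0" and ?y = "pt y y 0"
    note X = vertex_in_X[OF V(1)] vertex_in_X[OF V(2)]
    have d: "dst p q = (1 - p x) + real (D x y) + (1 - q y)"
      using False pq xy(3) by (simp add: dst_eq via_def)
    have px: "dst p ?x = 1 - p x" and yq: "dst ?y q = 1 - q y"
      using dst_vertex[OF pq(1) xy(1)] dst_vertex[OF pq(2) xy(2)] commute[of ?y q] by simp_all
    \<comment> \<open>A shorter connection from \<open>p\<close> to the vertex \<open>y\<close>
      would shorten the whole route, whose length is already \<open>dst p q\<close>.\<close>
    have "dst p ?y = dst p ?x + dst ?x ?y"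
    proof (rule antisym)
      show "dst p ?y \<le> dst p ?x + dst ?x ?y" by (rule triangle[OF pq(1) X])
      show "dst p ?x + dst ?x ?y \<le> dst p ?y"
        using triangle[OF pq(1) X(2) pq(2)] d px yq dst_vertices[OF V] by linarith
    qed
    moreover obtain \<xi> where "geodesic p ?x \<xi>" using geodesic_to_vertex(1)[OF pq(1) xy(1)] by blast
    moreover obtain \<eta> where "geodesic ?x ?y \<eta>" using geodesic_vertices[OF V] by blast
    ultimately obtain \<zeta> where \<zeta>: "geodesic p ?y \<zeta>"
      using geodesic_concat[OF pq(1) X(2,1)] by metis
    obtain \<omega> where \<omega>: "geodesic ?y q \<omega>" using geodesic_to_vertex(2)[OF pq(2) xy(2)] by blast
    have "dst p ?y + dst ?y q = dst p q"
      using \<open>dst p ?y = dst p ?x + dst ?x ?y\<close> d px yq dst_vertices[OF V] by simp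
    then show ?thesis using geodesic_concat[OF pq X(2) \<zeta> \<omega>] by blast
  qed
qed

text \<open>The affine extension of the indicator function of \<open>A\<close> from the vertices to
  the edges. Being 1-Lipschitz, it supplies the continuous functions whose level 1/2 separates sides
  and chambers.\<close>

definition mass :: "'v set \<Rightarrow> ('v \<Rightarrow> real) \<Rightarrow> real" where
  "mass A p = (\<Sum>x\<in>supp p. if x \<in> A then p x else 0)"

lemma mass_eq_sum:
  assumes "finite F" "supp p \<subseteq> F"
  shows "mass A p = (\<Sum>x\<in>F. if x \<in> A then p x else 0)"
  unfolding mass_def by (rule sum.mono_neutral_left) (use assms in \<open>auto simp: supp_def\<close>)

lemma mass_on_edge:
  assumes "supp p \<subseteq> {u, v}" "u \<noteq> v"
  shows "mass A p = (if u \<in> A then p u else 0) + (if v \<in> A then p v else 0)"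
  using mass_eq_sum[of "{u, v}" p A] assms by simp

lemma mass_vertex: "mass A (pt x x 0) = (if x \<in> A then 1 else 0)"
  by (simp add: mass_def supp_vertex pt_apply)

lemma mass_singleton:
  assumes "p \<in> X"
  shows "mass {x} p = p x"
proof -
  have "mass {x} p = (\<Sum>y\<in>insert x (supp p). if y \<in> {x} then p y else 0)"
    using X_supp(1)[OF assms] by (intro mass_eq_sum) auto
  also have "\<dots> = p x" using X_supp(1)[OF assms] by simp
  finally show ?thesis .
qed

lemma mass_along:
  assumes "p \<in> X" "q \<in> X" "coedge p q"
  shows "\<bar>mass A p - mass A q\<bar> \<le> dst p q"
proof -
  obtain u v where uv: "edge u v" "supp p \<subseteq> {u, v}" "supp q \<subseteq> {u, v}"
    using assms(3) unfolding coedge_def by blast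
  show ?thesis
  proof (cases "u = v")
    case True
    then have "p = q"
      using X_vertex(1)[of p u] X_vertex(1)[of q u] assms uv by (simp add: edge_def)
    then show ?thesis using assms by simp
  next
    case False
    then show ?thesis
      using mass_on_edge[OF uv(2) False, of A] mass_on_edge[OF uv(3) False, of A]
        X_on_edge(2)[OF assms(1) uv(1,2) False] X_on_edge(2)[OF assms(2) uv(1,3) False]
        dst_on_edge[OF assms(1,2) uv] by auto
  qed
qed

lemma mass_lipschitz:
  assumes "p \<in> X" "q \<in> X"
  shows "\<bar>mass A p - mass A q\<bar> \<le> dst p q"
proof (cases "coedge p q")
  case True
  then show ?thesis by (rule mass_along[OF assms])
next
  case False
  obtain x y where xy: "x \<in> supp p" "y \<in> supp q" "across p q = via p q x y"
    using across_attained[OF assms] .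
  have V: "x \<in> V" "y \<in> V" using xy X_supp(3) assms by blast+
  \<comment> \<open>Within an edge the weight changes by at most the distance to the vertex; between
    distinct vertices it jumps by at most 1, while \<open>D\<close> is at least 1.\<close>
  have near: "\<bar>mass A r - (if z \<in> A then 1 else 0)\<bar> \<le> 1 - r z" if r: "r \<in> X" "z \<in> supp r" for r z
  proof -
    obtain w where w: "edge z w" "supp r \<subseteq> {z, w}" using supp_edge[OF r] .
    have "coedge r (pt z z 0)" unfolding coedge_def using w by (auto simp: supp_vertex)
    moreover have "z \<in> V" using w(1) by (simp add: edge_def)
    ultimately show ?thesis
      using mass_along[OF r(1) vertex_in_X, of z A] dst_vertex[OF r] by (simp add: mass_vertex)
  qed
  have "\<bar>(if x \<in> A then 1 else 0) - (if y \<in> A then 1 else 0 :: real)\<bar> \<le> real (D x y)"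
    using D_zero[OF V] by (cases "x = y") auto
  then have "\<bar>mass A p - mass A q\<bar> \<le> via p q x y"
    using near[OF assms(1) xy(1)] near[OF assms(2) xy(2)] unfolding via_def by linarith
  then show ?thesis using False assms xy(3) by (simp add: dst_eq)
qed

lemma openin_mass:
  shows "openin mtopology {p \<in> X. mass A p < c}" "openin mtopology {p \<in> X. c < mass A p}"
proof -
  show "openin mtopology {p \<in> X. mass A p < c}"
    unfolding openin_mtopology
  proof (intro conjI allI impI)
    fix p assume p: "p \<in> {p \<in> X. mass A p < c}"
    have "mball p (c - mass A p) \<subseteq> {p \<in> X. mass A p < c}"
    proof
      fix q assume q: "q \<in> mball p (c - mass A p)"
      then show "q \<in> {p \<in> X. mass A p < c}" using mass_lipschitz[of p q A] p by auto
    qed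
    then show "\<exists>r>0. mball p r \<subseteq> {p \<in> X. mass A p < c}"
      using p by (intro exI[of _ "c - mass A p"]) auto
  qed auto
  show "openin mtopology {p \<in> X. c < mass A p}"
    unfolding openin_mtopology
  proof (intro conjI allI impI)
    fix p assume p: "p \<in> {p \<in> X. c < mass A p}"
    have "mball p (mass A p - c) \<subseteq> {p \<in> X. c < mass A p}"
    proof
      fix q assume q: "q \<in> mball p (mass A p - c)"
      then show "q \<in> {p \<in> X. c < mass A p}" using mass_lipschitz[of p q A] p by auto
    qed
    then show "\<exists>r>0. mball p r \<subseteq> {p \<in> X. c < mass A p}"
      using p by (intro exI[of _ "mass A p - c"]) auto
  qed auto
qed

text \<open>Both coordinates of the midpoint are 1/2, so a route that leaves the edge through an end
  vertex already costs 1/2.\<close>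

lemma near_midpoint:
  assumes e: "edge u v" "u \<noteq> v" and q: "q \<in> X" "dst (pt u v (1/2)) q < 1/2"
  shows "supp q \<subseteq> {u, v}" "dst (pt u v (1/2)) q = \<bar>q u - 1/2\<bar>"
proof -
  let ?z = "pt u v (1/2)"
  have z: "?z \<in> X" using pt_in_X[OF e(1)] by simp
  have sz: "supp ?z = {u, v}" using e(2) by (auto simp: supp_def pt_def)
  have "coedge ?z q"
  proof (rule ccontr)
    assume n: "\<not> coedge ?z q"
    obtain x y where xy: "x \<in> supp ?z" "y \<in> supp q" "across ?z q = via ?z q x y"
      using across_attained[OF z q(1)] .
    have "?z x = 1/2" using xy(1) e(2) sz by (auto simp: pt_apply)
    then have "1/2 \<le> via ?z q x y" using X_supp(5)[OF q(1), of y] by (simp add: via_def)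
    then show False using n z q xy(3) by (simp add: dst_eq)
  qed
  then obtain a b where ab: "supp ?z \<subseteq> {a, b}" "supp q \<subseteq> {a, b}" unfolding coedge_def by blast
  then have "{a, b} = {u, v}" unfolding sz using e(2) by blast
  then show "supp q \<subseteq> {u, v}" using ab(2) by simp
  then have "dst ?z q = \<bar>?z u - q u\<bar>" using sz by (intro dst_on_edge[OF z q(1) e(1)]) auto
  then show "dst ?z q = \<bar>q u - 1/2\<bar>" using e(2) by (simp add: pt_apply abs_minus_commute)
qed

lemma on_edge_eqI:
  assumes "p \<in> X" "q \<in> X" "edge u v" "supp p \<subseteq> {u, v}" "supp q \<subseteq> {u, v}" "p u = q u"
  shows "p = q"
  using dst_on_edge[OF assms(1-5)] assms(1,2,6) by simp

text \<open>Barycentric weights are moved like a measure. The value 0 off \<open>V\<close> keeps the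
  support inside \<open>V\<close>.\<close>

definition push :: "('v \<Rightarrow> 'v) \<Rightarrow> ('v \<Rightarrow> real) \<Rightarrow> 'v \<Rightarrow> real" where
  "push \<phi> p = (\<lambda>x. if x \<in> V then p (inv_into V \<phi> x) else 0)"

definition aut :: "('v \<Rightarrow> 'v) \<Rightarrow> bool" where
  "aut \<phi> \<longleftrightarrow> bij_betw \<phi> V V \<and> (\<forall>x\<in>V. \<forall>y\<in>V. D (\<phi> x) (\<phi> y) = D x y)"

lemma autD:
  assumes "aut \<phi>"
  shows "inj_on \<phi> V" "\<phi> ` V = V" "x \<in> V \<Longrightarrow> \<phi> x \<in> V"
    "x \<in> V \<Longrightarrow> y \<in> V \<Longrightarrow> D (\<phi> x) (\<phi> y) = D x y" "x \<in> V \<Longrightarrow> inv_into V \<phi> (\<phi> x) = x"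
    "x \<in> V \<Longrightarrow> inv_into V \<phi> x \<in> V" "x \<in> V \<Longrightarrow> \<phi> (inv_into V \<phi> x) = x"
  using assms unfolding aut_def bij_betw_def by (auto simp: inv_into_into f_inv_into_f)

lemma edge_aut: "aut \<phi> \<Longrightarrow> edge u v \<Longrightarrow> edge (\<phi> u) (\<phi> v)"
  using autD(3,4) by (simp add: edge_def)

lemma push_pt:
  assumes "aut \<phi>" "u \<in> V" "v \<in> V"
  shows "push \<phi> (pt u v t) = pt (\<phi> u) (\<phi> v) t"
proof
  fix x
  show "push \<phi> (pt u v t) x = pt (\<phi> u) (\<phi> v) t x"
  proof (cases "x \<in> V")
    case True
    have "inv_into V \<phi> x = w \<longleftrightarrow> x = \<phi> w" if "w \<in> V" for w
      using autD(5)[OF assms(1) that] autD(7)[OF assms(1) True] by auto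
    then show ?thesis using assms(2,3) True by (simp add: push_def pt_def)
  next
    case False
    then have "x \<noteq> \<phi> u" "x \<noteq> \<phi> v" using autD(3)[OF assms(1)] assms(2,3) by blast+
    then show ?thesis using False by (simp add: push_def pt_def)
  qed
qed

lemma push_in_X: "aut \<phi> \<Longrightarrow> p \<in> X \<Longrightarrow> push \<phi> p \<in> X"
proof -
  assume a: "aut \<phi>" "p \<in> X"
  obtain u v t where p: "edge u v" "p = pt u v t" "0 \<le> t" "t \<le> 1" using X_E[OF a(2)] .
  have "push \<phi> p = pt (\<phi> u) (\<phi> v) t" unfolding p(2) using p(1) by (intro push_pt a) (auto simp: edge_def)
  then show ?thesis using pt_in_X[OF edge_aut[OF a(1) p(1)] p(3,4)] by simp
qed

lemma push_apply: "aut \<phi> \<Longrightarrow> y \<in> V \<Longrightarrow> push \<phi> p (\<phi> y) = p y"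
  using autD(3,5) by (simp add: push_def)

lemma supp_push:
  assumes "aut \<phi>" "supp p \<subseteq> V"
  shows "supp (push \<phi> p) = \<phi> ` supp p"
proof (intro equalityI subsetI)
  fix x assume "x \<in> supp (push \<phi> p)"
  then have "x \<in> V" "p (inv_into V \<phi> x) \<noteq> 0" by (auto simp: supp_def push_def split: if_splits)
  then show "x \<in> \<phi> ` supp p"
    using autD(7)[OF assms(1), of x] by (intro image_eqI[of _ _ "inv_into V \<phi> x"]) (auto simp: supp_def)
next
  fix x assume "x \<in> \<phi> ` supp p"
  then obtain y where "y \<in> supp p" "x = \<phi> y" by blast
  then show "x \<in> supp (push \<phi> p)" using push_apply[OF assms(1), of y p] assms(2) by (auto simp: supp_def)
qed

lemma push_comp:
  assumes "aut \<phi>" "aut \<psi>" "aut \<omega>" "\<And>x. x \<in> V \<Longrightarrow> \<omega> x = \<phi> (\<psi> x)" "p \<in> X"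
  shows "push \<phi> (push \<psi> p) = push \<omega> p"
proof -
  obtain u v t where p: "edge u v" "p = pt u v t" "0 \<le> t" "t \<le> 1" using X_E[OF assms(5)] .
  have "u \<in> V" "v \<in> V" using p(1) by (auto simp: edge_def)
  then show ?thesis unfolding p(2) using assms(1-4) autD(3)[OF assms(2)] by (simp add: push_pt)
qed

lemma push_id:
  assumes "aut \<phi>" "\<And>x. x \<in> V \<Longrightarrow> \<phi> x = x" "p \<in> X"
  shows "push \<phi> p = p"
proof -
  obtain u v t where p: "edge u v" "p = pt u v t" "0 \<le> t" "t \<le> 1" using X_E[OF assms(3)] .
  have "u \<in> V" "v \<in> V" using p(1) by (auto simp: edge_def)
  then show ?thesis unfolding p(2) using assms(1,2) by (simp add: push_pt)
qed

lemma dst_push_le: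
  assumes "aut \<phi>" "p \<in> X" "q \<in> X"
  shows "dst (push \<phi> p) (push \<phi> q) \<le> dst p q"
proof -
  note X = push_in_X[OF assms(1,2)] push_in_X[OF assms(1,3)]
  note sp = supp_push[OF assms(1) X_supp(3)[OF assms(2)]] supp_push[OF assms(1) X_supp(3)[OF assms(3)]]
  show ?thesis
  proof (cases "coedge p q")
    case True
    then obtain u v where uv: "edge u v" "supp p \<subseteq> {u, v}" "supp q \<subseteq> {u, v}"
      unfolding coedge_def by blast
    have u: "u \<in> V" using uv(1) by (simp add: edge_def)
    have "dst (push \<phi> p) (push \<phi> q) = \<bar>push \<phi> p (\<phi> u) - push \<phi> q (\<phi> u)\<bar>"
      using uv(2,3) by (intro dst_on_edge[OF X edge_aut[OF assms(1) uv(1)]]) (auto simp: sp)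
    also have "\<dots> = dst p q"
      using dst_on_edge[OF assms(2,3) uv] push_apply[OF assms(1) u] by simp
    finally show ?thesis by simp
  next
    case False
    obtain x y where xy: "x \<in> supp p" "y \<in> supp q" "across p q = via p q x y"
      using across_attained[OF assms(2,3)] .
    have V: "x \<in> V" "y \<in> V" using xy X_supp(3) assms by blast+
    have "dst (push \<phi> p) (push \<phi> q) \<le> across (push \<phi> p) (push \<phi> q)" by (rule dst_le_across[OF X])
    also have "\<dots> \<le> via (push \<phi> p) (push \<phi> q) (\<phi> x) (\<phi> y)"
      using xy(1,2) by (intro across_le[OF X]) (auto simp: sp)
    also have "\<dots> = via p q x y"
      using push_apply[OF assms(1)] V autD(4)[OF assms(1) V] by (simp add: via_def)
    finally show ?thesis using False assms xy(3) by (simp add: dst_eq)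
  qed
qed

lemma aut_inv:
  assumes "aut \<phi>"
  shows "aut (inv_into V \<phi>)"
  unfolding aut_def
proof (intro conjI ballI)
  show "bij_betw (inv_into V \<phi>) V V" using assms by (simp add: aut_def bij_betw_inv_into)
  fix x y assume "x \<in> V" "y \<in> V"
  then show "D (inv_into V \<phi> x) (inv_into V \<phi> y) = D x y"
    using autD(4)[OF assms, of "inv_into V \<phi> x" "inv_into V \<phi> y"] autD(6,7)[OF assms] by simp
qed

lemma aut_comp:
  assumes "aut \<phi>" "aut \<psi>"
  shows "aut (\<phi> \<circ> \<psi>)"
  unfolding aut_def
proof (intro conjI ballI)
  show "bij_betw (\<phi> \<circ> \<psi>) V V"
    using assms unfolding aut_def by (blast intro: bij_betw_trans)
  fix x y assume "x \<in> V" "y \<in> V"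
  then show "D ((\<phi> \<circ> \<psi>) x) ((\<phi> \<circ> \<psi>) y) = D x y"
    using autD(3,4)[OF assms(1)] autD(3,4)[OF assms(2)] by simp
qed

text \<open>Automorphisms cannot increase distances, and neither can their inverses.\<close>

lemma dst_push:
  assumes "aut \<phi>" "p \<in> X" "q \<in> X"
  shows "dst (push \<phi> p) (push \<phi> q) = dst p q"
proof (rule antisym[OF dst_push_le[OF assms]])
  let ?\<psi> = "inv_into V \<phi>"
  have id: "push ?\<psi> (push \<phi> r) = r" if "r \<in> X" for r
  proof -
    have "push ?\<psi> (push \<phi> r) = push (?\<psi> \<circ> \<phi>) r"
      by (rule push_comp[OF aut_inv[OF assms(1)] assms(1) aut_comp[OF aut_inv[OF assms(1)] assms(1)] _ that]) simp
    also have "\<dots> = r"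
      by (rule push_id[OF aut_comp[OF aut_inv[OF assms(1)] assms(1)] _ that]) (simp add: autD(5)[OF assms(1)])
    finally show ?thesis .
  qed
  show "dst p q \<le> dst (push \<phi> p) (push \<phi> q)"
    using dst_push_le[OF aut_inv[OF assms(1)] push_in_X[OF assms(1,2)] push_in_X[OF assms(1,3)]]
      id[OF assms(2)] id[OF assms(3)] by simp
qed

lemma mass_push:
  assumes "aut \<phi>" "p \<in> X"
  shows "mass A (push \<phi> p) = mass {x \<in> V. \<phi> x \<in> A} p"
proof -
  have V: "supp p \<subseteq> V" using X_supp(3)[OF assms(2)] .
  have "mass A (push \<phi> p) = (\<Sum>x\<in>supp p. if \<phi> x \<in> A then push \<phi> p (\<phi> x) else 0)"
    unfolding mass_def supp_push[OF assms(1) V]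
    using inj_on_subset[OF autD(1)[OF assms(1)] V] by (simp add: sum.reindex)
  also have "\<dots> = mass {x \<in> V. \<phi> x \<in> A} p"
    unfolding mass_def
  proof (rule sum.cong[OF HOL.refl])
    fix x assume "x \<in> supp p"
    then have "x \<in> V" using V by blast
    then show "(if \<phi> x \<in> A then push \<phi> p (\<phi> x) else 0) = (if x \<in> {x \<in> V. \<phi> x \<in> A} then p x else 0)"
      using push_apply[OF assms(1)] by simp
  qed
  finally show ?thesis .
qed

lemma mass_compl:
  assumes "p \<in> X"
  shows "mass (V - A) p = 1 - mass A p"
proof -
  obtain u v t where p: "edge u v" "p = pt u v t" "0 \<le> t" "t \<le> 1" using X_E[OF assms] .
  have uv: "u \<in> V" "v \<in> V" using p(1) by (auto simp: edge_def)
  show ?thesis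
  proof (cases "u = v")
    case True
    then have "p = pt u u 0" using p(2) pt_same by metis
    then show ?thesis using uv by (simp add: mass_vertex)
  next
    case False
    then show ?thesis
      unfolding p(2) mass_on_edge[OF supp_pt_subset False] using uv by (simp add: pt_apply)
  qed
qed

end


section \<open>Cayley graphs\<close>

locale cayley_graph = reflection_cocycle +
  assumes finite_S: "finite S"
    and generated: "generate K S = carrier K"
begin

section \<open>The word metric\<close>

lemma exists_word: "a \<in> carrier K \<Longrightarrow> \<exists>l\<in>lists S. ev l = a"
proof -
  assume "a \<in> carrier K"
  then have "a \<in> generate K S" using generated by simp
  then show ?thesis
  proof induction
    case one
    then show ?case by (intro bexI[of _ "[]"]) auto
  next
    case (incl h)
    then show ?case by (intro bexI[of _ "[h]"]) auto
  next
    case (inv h)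
    then show ?case using inv_gen[of h] by (intro bexI[of _ "[h]"]) auto
  next
    case (eng h1 h2)
    then obtain u v where uv: "u \<in> lists S" "ev u = h1" "v \<in> lists S" "ev v = h2" by blast
    show ?case
    proof (rule bexI)
      show "ev (u @ v) = h1 \<otimes> h2" using ev_append[OF uv(1,3)] uv(2,4) by simp
      show "u @ v \<in> lists S" using uv by simp
    qed
  qed
qed

text \<open>Edges come from right multiplication by generators, so left multiplication preserves
  \<open>wd\<close> and acts on the graph. The \<open>LEAST\<close> is attained because
  \<open>S\<close> generates.\<close>

definition wd :: "'a \<Rightarrow> 'a \<Rightarrow> nat" where
  "wd x y = (LEAST n. \<exists>l\<in>lists S. length l = n \<and> x \<otimes> ev l = y)"

lemma wd_le: "l \<in> lists S \<Longrightarrow> x \<otimes> ev l = y \<Longrightarrow> wd x y \<le> length l"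
  unfolding wd_def by (rule Least_le) blast

lemma wd_word:
  assumes "x \<in> carrier K" "y \<in> carrier K"
  obtains l where "l \<in> lists S" "length l = wd x y" "x \<otimes> ev l = y"
proof -
  obtain l where l: "l \<in> lists S" "ev l = inv x \<otimes> y" using exists_word[of "inv x \<otimes> y"] assms by auto
  have "x \<otimes> ev l = y" using l(2) assms by (simp flip: m_assoc)
  then have "\<exists>n. \<exists>l\<in>lists S. length l = n \<and> x \<otimes> ev l = y" using l(1) by blast
  from LeastI_ex[OF this] show ?thesis using that unfolding wd_def by blast
qed

lemma wd_sym_le:
  assumes "x \<in> carrier K" "y \<in> carrier K"
  shows "wd y x \<le> wd x y"
proof -
  obtain l where l: "l \<in> lists S" "length l = wd x y" "x \<otimes> ev l = y" using wd_word[OF assms] .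
  have "rev l \<in> lists S" using l(1) by (simp add: in_lists_conv_set)
  moreover have "y \<otimes> ev (rev l) = x"
    unfolding l(3)[symmetric] ev_rev[OF l(1)] using assms(1) ev_closed[OF l(1)] by (simp add: m_assoc)
  ultimately have "wd y x \<le> length (rev l)" by (rule wd_le)
  then show ?thesis using l(2) by simp
qed

sublocale metric_graph "carrier K" wd
proof
  fix x y z assume xy: "x \<in> carrier K" "y \<in> carrier K"
  obtain l where l: "l \<in> lists S" "length l = wd x y" "x \<otimes> ev l = y" using wd_word[OF xy] .
  show "wd x y = 0 \<longleftrightarrow> x = y"
  proof
    assume "wd x y = 0"
    then show "x = y" using l xy by simp
  next
    assume "x = y"
    then show "wd x y = 0" using wd_le[of "[]" x y] xy by simp
  qed
  show "wd x y = wd y x" using wd_sym_le[OF xy] wd_sym_le[OF xy(2,1)] by simp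
  show "wd x z \<le> wd x y + wd y z" if z: "z \<in> carrier K"
  proof -
    obtain l' where l': "l' \<in> lists S" "length l' = wd y z" "y \<otimes> ev l' = z" using wd_word[OF xy(2) z] .
    have "x \<otimes> ev (l @ l') = z"
      unfolding ev_append[OF l(1) l'(1)] using l(3) l'(3) xy ev_closed[OF l(1)] ev_closed[OF l'(1)]
      by (simp flip: m_assoc)
    moreover have "l @ l' \<in> lists S" using l(1) l'(1) by simp
    ultimately have "wd x z \<le> length (l @ l')" by (intro wd_le)
    then show ?thesis using l(2) l'(2) by simp
  qed
  show "\<exists>z\<in>carrier K. wd x z = 1 \<and> wd z y = n" if n: "wd x y = Suc n" for n
  proof -
    obtain s l' where sl: "l = s # l'" using l(2) n by (cases l) auto
    then have s: "s \<in> S" "l' \<in> lists S" "length l' = n" using l n by auto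
    have e: "(x \<otimes> s) \<otimes> ev l' = y" using l(3) s(1) xy ev_closed[OF s(2)] unfolding sl by (simp add: m_assoc)
    have c: "x \<otimes> s \<in> carrier K" using xy s by simp
    have le: "wd (x \<otimes> s) y \<le> n" using wd_le[OF s(2) e] s(3) by simp
    have le1: "wd x (x \<otimes> s) \<le> 1" using wd_le[of "[s]" x "x \<otimes> s"] s xy by simp
    obtain l1 where l1: "l1 \<in> lists S" "length l1 = wd x (x \<otimes> s)" "x \<otimes> ev l1 = x \<otimes> s"
      using wd_word[OF xy(1) c] .
    obtain l2 where l2: "l2 \<in> lists S" "length l2 = wd (x \<otimes> s) y" "x \<otimes> s \<otimes> ev l2 = y"
      using wd_word[OF c xy(2)] .
    have "x \<otimes> ev (l1 @ l2) = y"
      unfolding ev_append[OF l1(1) l2(1)] using l1(3) l2(3) xy ev_closed[OF l1(1)] ev_closed[OF l2(1)]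
      by (simp flip: m_assoc)
    moreover have "l1 @ l2 \<in> lists S" using l1(1) l2(1) by simp
    ultimately have "wd x y \<le> length (l1 @ l2)" by (intro wd_le)
    \<comment> \<open>The first letter of a shortest word leads to \<open>x \<otimes> s\<close>. The
      two distances are at most 1 and \<open>n\<close>, and their sum is at least
      \<open>n + 1\<close>.\<close>
    then have "wd x (x \<otimes> s) = 1 \<and> wd (x \<otimes> s) y = n" using n le le1 l1(2) l2(2) by simp
    then show ?thesis using c by blast
  qed
qed

lemma edge_cases:
  assumes "edge u v"
  shows "u = v \<or> (\<exists>s\<in>S. v = u \<otimes> s)"
proof -
  have uv: "u \<in> carrier K" "v \<in> carrier K" "wd u v \<le> 1" using assms by (auto simp: edge_def)
  obtain l where l: "l \<in> lists S" "length l = wd u v" "u \<otimes> ev l = v" using wd_word[OF uv(1,2)] .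
  show ?thesis
  proof (cases l)
    case Nil
    then show ?thesis using l uv by simp
  next
    case (Cons s l')
    have "length l \<le> 1" using l(2) uv(3) by simp
    then have "l' = []" "s \<in> S" using Cons l(1) by auto
    then show ?thesis using l(3) Cons by auto
  qed
qed

lemma edge_gen: "u \<in> carrier K \<Longrightarrow> s \<in> S \<Longrightarrow> edge u (u \<otimes> s)"
  using wd_le[of "[s]" u "u \<otimes> s"] by (simp add: edge_def)

lemma finite_ball:
  assumes "u \<in> carrier K"
  shows "finite {y \<in> carrier K. wd u y \<le> n}"
proof (rule finite_subset)
  show "finite ((\<lambda>l. u \<otimes> ev l) ` {l. set l \<subseteq> S \<and> length l \<le> n})"
    using finite_lists_length_le[OF finite_S] by simp
  show "{y \<in> carrier K. wd u y \<le> n} \<subseteq> (\<lambda>l. u \<otimes> ev l) ` {l. set l \<subseteq> S \<and> length l \<le> n}"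
  proof
    fix y assume y: "y \<in> {y \<in> carrier K. wd u y \<le> n}"
    then obtain l where l: "l \<in> lists S" "length l = wd u y" "u \<otimes> ev l = y" using wd_word[OF assms] by blast
    then have "set l \<subseteq> S" "length l \<le> n" using y by auto
    then show "y \<in> (\<lambda>l. u \<otimes> ev l) ` {l. set l \<subseteq> S \<and> length l \<le> n}" using l(3) by blast
  qed
qed

section \<open>Left translations of the graph\<close>

lemma wd_left_le:
  assumes "a \<in> carrier K" "x \<in> carrier K" "y \<in> carrier K"
  shows "wd (a \<otimes> x) (a \<otimes> y) \<le> wd x y"
proof -
  obtain l where l: "l \<in> lists S" "length l = wd x y" "x \<otimes> ev l = y" using wd_word[OF assms(2,3)] .
  have "a \<otimes> x \<otimes> ev l = a \<otimes> y" using l assms ev_closed[OF l(1)] by (simp add: m_assoc)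
  from wd_le[OF l(1) this] show ?thesis using l(2) by simp
qed

lemma cancel_inv:
  assumes "a \<in> carrier K" "x \<in> carrier K"
  shows "inv a \<otimes> (a \<otimes> x) = x" "a \<otimes> (inv a \<otimes> x) = x"
  using assms by (simp_all flip: m_assoc)

lemma aut_left:
  assumes "a \<in> carrier K"
  shows "aut ((\<otimes>) a)"
  unfolding aut_def
proof (intro conjI ballI)
  show "bij_betw ((\<otimes>) a) (carrier K) (carrier K)"
    by (rule bij_betwI[where g = "(\<otimes>) (inv a)"]) (use assms cancel_inv[OF assms] in auto)
  fix x y assume xy: "x \<in> carrier K" "y \<in> carrier K"
  have "wd (inv a \<otimes> (a \<otimes> x)) (inv a \<otimes> (a \<otimes> y)) \<le> wd (a \<otimes> x) (a \<otimes> y)"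
    using assms xy by (intro wd_left_le) auto
  then show "wd (a \<otimes> x) (a \<otimes> y) = wd x y"
    using wd_left_le[OF assms xy] cancel_inv(1)[OF assms] xy by simp
qed

text \<open>Restricted to \<open>X\<close> because elements of \<open>Bij X\<close> are
  extensional.\<close>

definition act :: "'a \<Rightarrow> ('a \<Rightarrow> real) \<Rightarrow> ('a \<Rightarrow> real)" where
  "act a = restrict (push ((\<otimes>) a)) X"

lemma act_eq: "p \<in> X \<Longrightarrow> act a p = push ((\<otimes>) a) p"
  by (simp add: act_def)

lemma act_in_X: "a \<in> carrier K \<Longrightarrow> p \<in> X \<Longrightarrow> act a p \<in> X"
  using push_in_X[OF aut_left] by (simp add: act_eq)

lemma act_pt: "a \<in> carrier K \<Longrightarrow> edge u v \<Longrightarrow> 0 \<le> t \<Longrightarrow> t \<le> 1 \<Longrightarrow> act a (pt u v t) = pt (a \<otimes> u) (a \<otimes> v) t"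
  using push_pt[OF aut_left, of a u v t] pt_in_X by (simp add: act_eq edge_def)

lemma act_apply: "a \<in> carrier K \<Longrightarrow> p \<in> X \<Longrightarrow> x \<in> carrier K \<Longrightarrow> act a p (a \<otimes> x) = p x"
  using push_apply[OF aut_left] by (simp add: act_eq)

lemma act_act: "a \<in> carrier K \<Longrightarrow> b \<in> carrier K \<Longrightarrow> p \<in> X \<Longrightarrow> act a (act b p) = act (a \<otimes> b) p"
  using push_comp[OF aut_left aut_left aut_left, of a b "a \<otimes> b" p] act_in_X[of b p]
  by (simp add: act_eq m_assoc)

lemma act_one: "p \<in> X \<Longrightarrow> act \<one> p = p"
  using push_id[OF aut_left, of \<one> p] by (simp add: act_eq)

lemma act_Bij: "a \<in> carrier K \<Longrightarrow> act a \<in> Bij X"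
proof -
  assume a: "a \<in> carrier K"
  have "bij_betw (act a) X X"
    by (rule bij_betwI[where g = "act (inv a)"]) (use a in \<open>auto simp: act_in_X act_act act_one\<close>)
  then show ?thesis by (simp add: Bij_def act_def)
qed

lemma act_isometry: "a \<in> carrier K \<Longrightarrow> act a \<in> isometries"
  using act_Bij dst_push[OF aut_left] by (simp add: isometries_def act_eq)

lemma act_hom: "act \<in> hom K (BijGroup X)"
proof (rule homI)
  show "act a \<in> carrier (BijGroup X)" if "a \<in> carrier K" for a
    using act_Bij[OF that] by (simp add: BijGroup_def)
  fix a b assume ab: "a \<in> carrier K" "b \<in> carrier K"
  have "act (a \<otimes> b) = compose X (act a) (act b)"
  proof
    fix p show "act (a \<otimes> b) p = compose X (act a) (act b) p"
      using act_act[OF ab] by (cases "p \<in> X") (simp_all add: compose_def, simp add: act_def)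
  qed
  then show "act (a \<otimes> b) = act a \<otimes>\<^bsub>BijGroup X\<^esub> act b"
    using act_Bij ab by (simp add: BijGroup_def)
qed

sublocale act: group_hom K "BijGroup X" act
  by (intro group_hom.intro group_hom_axioms.intro group_axioms group_BijGroup act_hom)

definition \<Gamma> :: "(('a \<Rightarrow> real) \<Rightarrow> ('a \<Rightarrow> real)) set" where
  "\<Gamma> = act ` carrier K"

lemma act_vertex: "a \<in> carrier K \<Longrightarrow> u \<in> carrier K \<Longrightarrow> act a (pt u u 0) = pt (a \<otimes> u) (a \<otimes> u) 0"
  using act_pt[of a u u 0] edge_refl by simp

section \<open>Midpoints and fixed points\<close>

lemma dominant_unique:
  assumes "p \<in> X" "p x > 1/2" "p y > 1/2"
  shows "x = y"
proof (rule ccontr)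
  assume "x \<noteq> y"
  moreover have "x \<in> supp p" "y \<in> supp p" using assms by (auto simp: supp_def)
  ultimately show False using X_supp(6)[OF assms(1)] assms(2,3) by fastforce
qed

definition midpoints :: "('a \<Rightarrow> real) set" where
  "midpoints = {pt u v (1/2) |u v. edge u v \<and> u \<noteq> v}"

text \<open>Away from midpoints a point has a closest vertex, singled out by a coordinate above
  1/2.\<close>

lemma midpoint_or_dominant:
  assumes "p \<in> X"
  shows "p \<in> midpoints \<or> (\<exists>x\<in>carrier K. p x > 1/2)"
proof -
  obtain u v t where p: "edge u v" "p = pt u v t" "0 \<le> t" "t \<le> 1" using X_E[OF assms] .
  have uv: "u \<in> carrier K" "v \<in> carrier K" using p(1) by (auto simp: edge_def)
  consider "u = v" | "u \<noteq> v" "t < 1/2" | "u \<noteq> v" "t > 1/2" | "u \<noteq> v" "t = 1/2" by linarith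
  then show ?thesis
  proof cases
    case 1
    then have "p u > 1/2" unfolding p(2) by (simp add: pt_apply)
    then show ?thesis using uv by blast
  next
    case 2
    then have "p u > 1/2" unfolding p(2) by (simp add: pt_apply)
    then show ?thesis using uv by blast
  next
    case 3
    then have "p v > 1/2" unfolding p(2) by (simp add: pt_apply)
    then show ?thesis using uv by blast
  next
    case 4
    then show ?thesis unfolding p(2) midpoints_def using p(1) by blast
  qed
qed

text \<open>An element fixing the point fixes its closest vertex, and only the identity has a fixed
  vertex under left multiplication.\<close>

lemma act_free:
  assumes "a \<in> carrier K" "p \<in> X" "act a p = p" "p \<notin> midpoints"
  shows "a = \<one>"
proof -
  obtain x where x: "x \<in> carrier K" "p x > 1/2" using midpoint_or_dominant assms by blast
  then have "p (a \<otimes> x) > 1/2" using act_apply[OF assms(1,2) x(1)] assms(3) by simp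
  then have "a \<otimes> x = x" using dominant_unique[OF assms(2) _ x(2)] by blast
  then show ?thesis using assms(1) x(1) by (simp add: r_cancel_one)
qed

text \<open>For v = u s', the cocycle rule says that the side of \<open>s\<close> changes exactly if
  u^-1 s u = s', that is s u = u s' = v.\<close>

lemma edge_crosses_wall:
  assumes e: "edge u v" and s: "s \<in> S" and sep: "(s \<in> N u) \<noteq> (s \<in> N v)"
  shows "v = s \<otimes> u" "u = s \<otimes> v" "u \<noteq> v"
proof -
  have uv: "u \<in> carrier K" "v \<in> carrier K" using e by (auto simp: edge_def)
  show "u \<noteq> v" using sep by blast
  then obtain s' where s': "s' \<in> S" "v = u \<otimes> s'" using edge_cases[OF e] by blast
  have "s \<in> N v \<longleftrightarrow> (s \<in> N u) \<noteq> (inv u \<otimes> s \<otimes> u \<in> N s')"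
    unfolding s'(2) using uv s s' by (intro N_mult) auto
  then have "inv u \<otimes> s \<otimes> u = s'" using sep N_gen[OF s'(1)] by auto
  then have "u \<otimes> s' = u \<otimes> (inv u \<otimes> (s \<otimes> u))" using uv s by (simp add: m_assoc)
  then show "v = s \<otimes> u" unfolding s'(2) using uv s cancel_inv(2)[OF uv(1)] by simp
  then show "u = s \<otimes> v" using uv s by simp
qed

lemma midpoint_fixed:
  assumes "edge u v" "a \<in> carrier K" "v = a \<otimes> u" "u = a \<otimes> v"
  shows "act a (pt u v (1/2)) = pt u v (1/2)"
proof -
  have "act a (pt u v (1/2)) = pt (a \<otimes> u) (a \<otimes> v) (1/2)" using assms(1,2) by (intro act_pt) auto
  also have "\<dots> = pt v u (1/2)" by (simp flip: assms(3,4))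
  also have "\<dots> = pt u v (1/2)" by (auto simp: pt_def)
  finally show ?thesis .
qed

text \<open>\<open>H\<close> holds the vertices beyond the wall and \<open>?f\<close> extends its
  indicator affinely. \<open>s\<close> flips \<open>H\<close>, hence reflects the values of
  \<open>?f\<close> in 1/2; the level 1/2 is attained only at midpoints of edges joining
  \<open>H\<close> to its complement, and those edges \<open>s\<close> inverts.\<close>

lemma reflection_gen:
  assumes s: "s \<in> S"
  shows "reflection (act s)"
proof -
  define H where "H = {x \<in> carrier K. s \<in> N x}"
  let ?f = "mass H"
  define A where "A = {p \<in> X. ?f p < 1/2}"
  define B where "B = {p \<in> X. 1/2 < ?f p}"
  have sK: "s \<in> carrier K" using s by simp
  have flip: "?f (act s p) = 1 - ?f p" if p: "p \<in> X" for p
  proof -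
    have "{x \<in> carrier K. s \<otimes> x \<in> H} = carrier K - H"
      unfolding H_def using N_left[OF s _ sK] s by (auto simp: invol)
    then show ?thesis
      using mass_push[OF aut_left[OF sK] p, of H] mass_compl[OF p, of H] p by (simp add: act_eq)
  qed
  have half: "\<exists>u v. edge u v \<and> u \<in> H \<and> v \<notin> H \<and> p = pt u v (1/2)" if p: "p \<in> X" "?f p = 1/2" for p
  proof -
    obtain u v t where uv: "edge u v" "p = pt u v t" "0 \<le> t" "t \<le> 1" using X_E[OF p(1)] .
    have ne: "u \<noteq> v"
    proof
      assume "u = v"
      then have "p = pt u u 0" using uv(2) pt_same by metis
      then show False using p(2) by (simp add: mass_vertex split: if_splits)
    qed
    have "?f p = (if u \<in> H then 1 - t else 0) + (if v \<in> H then t else 0)"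
      unfolding uv(2) mass_on_edge[OF supp_pt_subset ne] using ne by (simp add: pt_apply)
    then consider "u \<in> H" "v \<notin> H" "t = 1/2" | "u \<notin> H" "v \<in> H" "t = 1/2"
      using p(2) by (auto split: if_splits)
    then show ?thesis
    proof cases
      case 1 then show ?thesis using uv by blast
    next
      case 2
      then have "p = pt v u (1/2)" using uv(2) by (auto simp: pt_def)
      then show ?thesis using 2 edge_sym[OF uv(1)] by blast
    qed
  qed
  have cross: "v = s \<otimes> u" "u = s \<otimes> v" "u \<noteq> v" if "edge u v" "u \<in> H" "v \<notin> H" for u v
    using edge_crosses_wall[OF that(1) s] that by (auto simp: H_def edge_def)
  have wall: "wall (act s) = {p \<in> X. ?f p = 1/2}"
  proof (intro equalityI subsetI)
    fix p assume "p \<in> wall (act s)"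
    then show "p \<in> {p \<in> X. ?f p = 1/2}" using flip[of p] by (auto simp: wall_def)
  next
    fix p assume p: "p \<in> {p \<in> X. ?f p = 1/2}"
    then obtain u v where uv: "edge u v" "u \<in> H" "v \<notin> H" "p = pt u v (1/2)" using half by blast
    then have "act s p = p" using midpoint_fixed[OF uv(1) sK cross(1,2)[OF uv(1-3)]] by simp
    then show "p \<in> wall (act s)" using p by (simp add: wall_def)
  qed
  have ss: "act s (act s p) = p" if "p \<in> X" for p
    using act_act[OF sK sK that] act_one[OF that] by (simp add: invol s)
  have swap: "act s ` A = B" "act s ` B = A"
  proof -
    have AB: "act s p \<in> B" if "p \<in> A" for p
      using that flip[of p] act_in_X[OF sK] by (simp add: A_def B_def)
    have BA: "act s p \<in> A" if "p \<in> B" for p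
      using that flip[of p] act_in_X[OF sK] by (simp add: A_def B_def)
    have X: "A \<subseteq> X" "B \<subseteq> X" by (auto simp: A_def B_def)
    show "act s ` A = B"
    proof (intro equalityI subsetI)
      fix p assume "p \<in> B"
      then show "p \<in> act s ` A" using ss[of p] BA[of p] X by (intro image_eqI[of _ _ "act s p"]) auto
    qed (use AB in auto)
    show "act s ` B = A"
    proof (intro equalityI subsetI)
      fix p assume "p \<in> A"
      then show "p \<in> act s ` B" using ss[of p] AB[of p] X by (intro image_eqI[of _ _ "act s p"]) auto
    qed (use BA in auto)
  qed
  show ?thesis
  proof (rule reflectionI[OF geodesic_space act_isometry[OF sK] ss _ _ _ _ swap])
    show "openin mtopology A" "openin mtopology B" unfolding A_def B_def by (rule openin_mass)+
    show "A \<inter> B = {}" "A \<union> B = X - wall (act s)" unfolding wall by (auto simp: A_def B_def)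
    have "pt \<one> \<one> 0 \<in> A"
      using vertex_in_X[OF one_closed] N_one by (simp add: A_def mass_vertex H_def)
    then show "A \<noteq> {}" by blast
  next
    fix z assume "z \<in> wall (act s)"
    then obtain u v where uv: "edge u v" "u \<in> H" "v \<notin> H" "z = pt u v (1/2)" using half unfolding wall by blast
    have ne: "u \<noteq> v" using cross(3)[OF uv(1-3)] .
    have zX: "z \<in> X" unfolding uv(4) using pt_in_X[OF uv(1)] by simp
    \<comment> \<open>A ball of radius 1/2 stays inside the edge, where \<open>?f\<close> is the
      coordinate at \<open>u\<close>; side and distance from the midpoint determine that
      coordinate.\<close>
    have near: "supp q \<subseteq> {u, v}" "dst z q = \<bar>q u - 1/2\<bar>" "?f q = q u" if q: "q \<in> X" "dst z q < 1/2" for q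
    proof -
      show 1: "supp q \<subseteq> {u, v}" "dst z q = \<bar>q u - 1/2\<bar>"
        using near_midpoint[OF uv(1) ne q(1)] q(2) unfolding uv(4) by auto
      show "?f q = q u" using mass_on_edge[OF 1(1) ne, of H] uv(2,3) by simp
    qed
    have eq: "a = b" if ab: "a \<in> X" "b \<in> X" "dst z a < 1/2" "dst z b < 1/2" "a u = b u" for a b
      by (rule on_edge_eqI[OF ab(1,2) uv(1) near(1)[OF ab(1,3)] near(1)[OF ab(2,4)] ab(5)])
    have "mball z (1/2) \<inter> wall (act s) \<subseteq> {z}"
    proof
      fix q assume q: "q \<in> mball z (1/2) \<inter> wall (act s)"
      then have qX: "q \<in> X" "dst z q < 1/2" "?f q = 1/2" unfolding wall by auto
      then have "q u = z u" using near(3)[of q] ne unfolding uv(4) by (simp add: pt_apply)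
      then show "q \<in> {z}" using eq[OF qX(1) zX qX(2)] zX by simp
    qed
    moreover have "a = b" if ab: "a \<in> A \<and> b \<in> A \<or> a \<in> B \<and> b \<in> B" "dst z a < 1/2" "dst z b = dst z a" for a b
    proof -
      have X: "a \<in> X" "b \<in> X" "dst z b < 1/2" using ab by (auto simp: A_def B_def)
      have "a u = b u"
        using ab near(2,3)[OF X(1) ab(2)] near(2,3)[OF X(2,3)] by (auto simp: A_def B_def)
      then show ?thesis by (rule eq[OF X(1,2) ab(2) X(3)])
    qed
    ultimately show "\<exists>e>0. mball z e \<inter> wall (act s) \<subseteq> {z} \<and>
      (\<forall>a b. (a \<in> A \<and> b \<in> A \<or> a \<in> B \<and> b \<in> B) \<and> dst z a < e \<and> dst z b = dst z a \<longrightarrow> a = b)"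
      by (intro exI[of _ "1/2"] conjI) auto
  qed
qed

text \<open>The midpoint of the edge from u to us is fixed by the conjugate u s u^-1, which
  exchanges the two ends.\<close>

lemma midpoint_in_wall:
  assumes "p \<in> midpoints"
  shows "\<exists>r\<in>\<Gamma>. reflection r \<and> p \<in> wall r"
proof -
  obtain u v where uv: "edge u v" "u \<noteq> v" "p = pt u v (1/2)" using assms unfolding midpoints_def by blast
  obtain s where s: "s \<in> S" "v = u \<otimes> s" using edge_cases[OF uv(1)] uv(2) by blast
  have uK: "u \<in> carrier K" "s \<in> carrier K" using uv(1) s by (auto simp: edge_def)
  let ?t = "u \<otimes> s \<otimes> inv u"
  have tK: "?t \<in> carrier K" using uK by simp
  have tu: "?t \<otimes> u = u \<otimes> s" using uK by (simp add: m_assoc)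
  have eq: "act ?t (act u x) = act u (act s x)" if "x \<in> X" for x
    unfolding act_act[OF tK uK(1) that] act_act[OF uK(1,2) that] tu by (rule HOL.refl)
  have "reflection (act ?t)"
    by (rule reflection_conj(1)[where f = "act u" and r = "act s" and r' = "act ?t",
          OF act_isometry[OF uK(1)] reflection_gen[OF s(1)] act_isometry[OF tK] eq])
  moreover have "act ?t p = p"
  proof -
    have "?t \<otimes> v = u" unfolding s(2) using uK s by (simp add: m_assoc cancel_inv invol)
    then show ?thesis unfolding uv(3) using tu s(2) by (intro midpoint_fixed[OF uv(1) tK]) auto
  qed
  moreover have "p \<in> X" unfolding uv(3) using pt_in_X[OF uv(1)] by simp
  ultimately show ?thesis using tK by (auto simp: \<Gamma>_def wall_def)
qed

lemma identity_not_reflection: "\<not> reflection (act \<one>)"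
proof
  assume "reflection (act \<one>)"
  then obtain A B where AB: "A \<noteq> B" 
    "connected_components_of (subtopology mtopology (X - wall (act \<one>))) = {A, B}"
    unfolding reflection_def by (elim conjE exE) (rule that)
  have "wall (act \<one>) = X" unfolding wall_def using act_one by blast
  then have "X - wall (act \<one>) = {}" by (simp only: Diff_cancel)
  from AB(2)[unfolded this] show False by (simp add: connected_components_of_def)
qed

lemma walls: "(\<Union>r\<in>{r \<in> \<Gamma>. reflection r}. wall r) = midpoints"
proof (intro equalityI subsetI)
  fix p assume "p \<in> (\<Union>r\<in>{r \<in> \<Gamma>. reflection r}. wall r)"
  then obtain a where a: "a \<in> carrier K" "reflection (act a)" "p \<in> X" "act a p = p"
    by (auto simp: \<Gamma>_def wall_def)
  then have "a \<noteq> \<one>" using identity_not_reflection by blast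
  then show "p \<in> midpoints" using act_free[OF a(1,3,4)] by blast
next
  fix p assume "p \<in> midpoints"
  then show "p \<in> (\<Union>r\<in>{r \<in> \<Gamma>. reflection r}. wall r)" using midpoint_in_wall by blast
qed

section \<open>The fundamental chamber\<close>

definition C :: "('a \<Rightarrow> real) set" where
  "C = mball (pt \<one> \<one> 0) (1/2)"

lemma base_in_X: "pt \<one> \<one> 0 \<in> X"
  by (rule vertex_in_X) simp

lemma dst_base:
  assumes "p \<in> X" "\<one> \<in> supp p"
  shows "dst (pt \<one> \<one> 0) p = 1 - p \<one>"
  using dst_vertex[OF assms] commute[of p] by simp

lemma base_coord: "p \<in> X \<Longrightarrow> 1 - p \<one> \<le> dst (pt \<one> \<one> 0) p"
  using mass_lipschitz[OF base_in_X, of p "{\<one>}"] mass_singleton[of p \<one>] mass_vertex[of "{\<one>}" \<one>] by simp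

lemma C_eq: "C = {p \<in> X. p \<one> > 1/2}"
proof (intro equalityI subsetI)
  fix p assume "p \<in> C"
  then show "p \<in> {p \<in> X. p \<one> > 1/2}" using base_coord[of p] by (auto simp: C_def)
next
  fix p assume p: "p \<in> {p \<in> X. p \<one> > 1/2}"
  then have "\<one> \<in> supp p" by (auto simp: supp_def)
  then show "p \<in> C" using dst_base[of p] p base_in_X by (auto simp: C_def)
qed

text \<open>Along a geodesic from the centre the distance to the centre only grows, so a ball is
  star-shaped.\<close>

lemma connectedin_C: "connectedin mtopology C"
proof (rule connectedin_if_geodesics[OF geodesic_space])
  show "pt \<one> \<one> 0 \<in> C" "C \<subseteq> X" using base_in_X by (auto simp: C_def)
  fix y \<xi> assume y: "y \<in> C" and g: "geodesic (pt \<one> \<one> 0) y \<xi>"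
  show "\<xi> ` {0..dst (pt \<one> \<one> 0) y} \<subseteq> C"
  proof
    fix z assume "z \<in> \<xi> ` {0..dst (pt \<one> \<one> 0) y}"
    then obtain t where t: "t \<in> {0..dst (pt \<one> \<one> 0) y}" "z = \<xi> t" by blast
    then have "dst (pt \<one> \<one> 0) z \<le> dst (pt \<one> \<one> 0) y" "z \<in> X"
      using geodesic_dist_endpoints(1)[OF g t(1)] geodesic_endpoints(3)[OF g t(1)] by auto
    then show "z \<in> C" using y base_in_X by (auto simp: C_def)
  qed
qed

lemma half_coord_midpoint:
  assumes "p \<in> X" "p x = 1/2"
  shows "p \<in> midpoints"
proof (rule ccontr)
  assume "p \<notin> midpoints"
  then obtain y where y: "p y > 1/2" using midpoint_or_dominant[OF assms(1)] by blast
  then have "x \<in> supp p" "y \<in> supp p" "x \<noteq> y" using assms(2) by (auto simp: supp_def)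
  then show False using X_supp(6)[OF assms(1)] y assms(2) by fastforce
qed

text \<open>A coordinate equal to 1/2 occurs only at midpoints, so off the midpoints the space
  splits into the open sets where the coordinate at the base vertex is above or below 1/2.\<close>

lemma chamber_C: "chamber \<Gamma> C"
proof -
  let ?Y = "subtopology mtopology (X - midpoints)"
  let ?o = "pt \<one> \<one> 0"
  have CY: "C \<subseteq> X - midpoints"
  proof
    fix p assume p: "p \<in> C"
    have "p \<notin> midpoints"
    proof
      assume "p \<in> midpoints"
      then obtain u v where "u \<noteq> v" "p = pt u v (1/2)" unfolding midpoints_def by blast
      then have "p \<one> \<le> 1/2" by (auto simp: pt_def)
      then show False using p unfolding C_eq by simp
    qed
    then show "p \<in> X - midpoints" using p unfolding C_eq by simp
  qed
  have oC: "?o \<in> C" using base_in_X by (simp add: C_def)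
  have "connected_component_of_set ?Y ?o = C"
  proof
    show "C \<subseteq> connected_component_of_set ?Y ?o"
      using connectedin_C CY oC by (intro connected_component_of_maximal) (auto simp: connectedin_subtopology)
    have con: "connectedin ?Y (connected_component_of_set ?Y ?o)" by (rule connectedin_connected_component_of)
    have "?o \<in> topspace ?Y" using CY oC by auto
    then have o: "?o \<in> connected_component_of_set ?Y ?o" by (simp add: connected_component_of_refl)
    let ?B = "{p \<in> X. mass {\<one>} p < 1/2}"
    show "connected_component_of_set ?Y ?o \<subseteq> C"
    proof (rule connectedin_separation[OF _ _ _ _ _ o oC])
      show "connectedin mtopology (connected_component_of_set ?Y ?o)"
        using con by (simp add: connectedin_subtopology)
      show "openin mtopology C" by (simp add: C_def)
      show "openin mtopology ?B" by (rule openin_mass)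
      show "C \<inter> ?B = {}" using mass_singleton unfolding C_eq by force
      show "connected_component_of_set ?Y ?o \<subseteq> C \<union> ?B"
      proof
        fix p assume "p \<in> connected_component_of_set ?Y ?o"
        then have p: "p \<in> X" "p \<notin> midpoints" using con by (auto simp: connectedin_subtopology)
        then have "p \<one> \<noteq> 1/2" using half_coord_midpoint by blast
        then show "p \<in> C \<union> ?B" using p(1) mass_singleton[OF p(1), of \<one>] unfolding C_eq by auto
      qed
    qed
  qed
  moreover have "connected_component_of_set ?Y ?o \<in> connected_components_of ?Y"
    using CY oC by (auto simp: connected_component_in_connected_components_of)
  ultimately show ?thesis unfolding chamber_def walls by simp
qed

lemma compact_closure_C: "compactin mtopology (mtopology closure_of C)"
proof -
  let ?o = "pt \<one> \<one> 0"
  \<comment> \<open>The closed chamber is covered by finitely many half-edges. The degenerate edge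
    for \<open>\<one>\<close> covers the base vertex also when \<open>S\<close> is empty.\<close>
  let ?T = "insert \<one> S"
  let ?J = "\<lambda>s. pt \<one> s ` {0..1/2}"
  have J: "compactin mtopology (?J s)" if s: "s \<in> ?T" for s
  proof -
    have e: "edge \<one> s" using s edge_refl[OF one_closed] edge_gen[OF one_closed, of s] by auto
    have X: "pt \<one> s t \<in> X" if "t \<in> {0..1/2}" for t using that by (intro pt_in_X[OF e]) auto
    have "continuous_map (top_of_set {0..1/2}) mtopology (pt \<one> s)"
      unfolding continuous_map_to_metric
    proof (intro ballI allI impI)
      fix t \<epsilon> :: real assume t: "t \<in> topspace (top_of_set {0..1/2})" and e0: "\<epsilon> > 0"
      let ?U = "{0..1/2} \<inter> ball t \<epsilon>"
      have "openin (top_of_set {0..1/2}) ?U" by (intro openin_open_Int) simp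
      moreover have "pt \<one> s r \<in> mball (pt \<one> s t) \<epsilon>" if r: "r \<in> ?U" for r
      proof -
        have "dst (pt \<one> s t) (pt \<one> s r) = \<bar>pt \<one> s t \<one> - pt \<one> s r \<one>\<bar>"
          using t r by (intro dst_on_edge[OF X X e]) (simp_all add: supp_pt_subset)
        also have "\<dots> \<le> \<bar>t - r\<bar>" by (cases "s = \<one>") (auto simp: pt_apply)
        also have "\<dots> < \<epsilon>" using r by (simp add: dist_real_def)
        finally show ?thesis using X t r by simp
      qed
      ultimately show "\<exists>U. openin (top_of_set {0..1/2}) U \<and> t \<in> U \<and> (\<forall>r\<in>U. pt \<one> s r \<in> mball (pt \<one> s t) \<epsilon>)"
        using t e0 by (intro exI[of _ ?U]) auto
    qed
    then show ?thesis
      by (rule image_compactin[rotated]) (simp add: compactin_subtopology)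
  qed
  have "compactin mtopology (\<Union>s\<in>?T. ?J s)"
    using J finite_S by (intro compactin_Union) auto
  moreover have "mtopology closure_of C \<subseteq> (\<Union>s\<in>?T. ?J s)"
  proof
    fix p assume "p \<in> mtopology closure_of C"
    moreover have "mtopology closure_of C \<subseteq> mcball ?o (1/2)"
      unfolding C_def by (intro closure_of_minimal mball_subset_mcball closedin_mcball)
    ultimately have p: "p \<in> X" "dst ?o p \<le> 1/2" by auto
    then have p1: "p \<one> \<ge> 1/2" using base_coord[of p] by simp
    then have "\<one> \<in> supp p" by (auto simp: supp_def)
    then obtain w where w: "edge \<one> w" "supp p \<subseteq> {\<one>, w}" using supp_edge[OF p(1)] by blast
    have eq: "p = pt \<one> w (p w)" by (rule X_on_edge(1)[OF p(1) w])
    show "p \<in> (\<Union>s\<in>?T. ?J s)"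
    proof (cases "w = \<one>")
      case True
      then have "p = pt \<one> \<one> 0" using eq pt_same by metis
      then show ?thesis by auto
    next
      case False
      then obtain s where s: "s \<in> S" "w = s" using edge_cases[OF w(1)] by auto
      have "p w \<in> {0..1/2}" using X_on_edge(2)[OF p(1) w] False p1 X_supp(4)[OF p(1), of w] by auto
      then show ?thesis using eq s by blast
    qed
  qed
  ultimately show ?thesis by (rule closed_compactin) simp
qed

lemma proper_action_\<Gamma>: "proper_action \<Gamma>"
  unfolding proper_action_def
proof (intro ballI allI impI)
  fix p and r :: real assume p: "p \<in> X"
  obtain u where u: "u \<in> supp p" using X_supp(2)[OF p] by blast
  have uK: "u \<in> carrier K" using u X_supp(3)[OF p] by blast
  \<comment> \<open>\<open>p\<close> is within 1 of its vertex \<open>u\<close>, and the image of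
    \<open>p\<close> is within 1 of the translate of \<open>u\<close>; hence the distance of the two
    vertices exceeds that of the two points by at most 2.\<close>
  let ?n = "nat \<lceil>r + 2\<rceil>"
  let ?Y = "{y \<in> carrier K. wd u y \<le> ?n}"
  have "{\<gamma> \<in> \<Gamma>. \<gamma> p \<in> mball p r} \<subseteq> (\<lambda>y. act (y \<otimes> inv u)) ` ?Y"
  proof
    fix \<gamma> assume "\<gamma> \<in> {\<gamma> \<in> \<Gamma>. \<gamma> p \<in> mball p r}"
    then obtain a where a: "a \<in> carrier K" "\<gamma> = act a" "dst p (act a p) < r" by (auto simp: \<Gamma>_def)
    let ?u = "pt u u 0" and ?au = "pt (a \<otimes> u) (a \<otimes> u) 0"
    have auK: "a \<otimes> u \<in> carrier K" using a uK by simp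
    have X: "?u \<in> X" "?au \<in> X" "act a p \<in> X" using vertex_in_X uK auK act_in_X[OF a(1) p] by blast+
    have "dst (act a p) ?au = dst p ?u"
      using dst_push[OF aut_left[OF a(1)] p X(1)] act_vertex[OF a(1) uK] p X(1) by (simp add: act_eq)
    moreover have "dst p ?u \<le> 1" using dst_vertex[OF p u] X_supp(4)[OF p, of u] by simp
    moreover have "dst ?u ?au \<le> dst ?u p + dst p ?au" by (rule triangle[OF X(1) p X(2)])
    moreover have "dst p ?au \<le> dst p (act a p) + dst (act a p) ?au" by (rule triangle[OF p X(3,2)])
    moreover have "dst ?u p = dst p ?u" by (rule commute)
    ultimately have "real (wd u (a \<otimes> u)) \<le> r + 2" using a(3) dst_vertices[OF uK auK] by linarith
    then have "a \<otimes> u \<in> ?Y" using auK by (simp add: le_nat_iff) linarith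
    moreover have "\<gamma> = act (a \<otimes> u \<otimes> inv u)" using a(1,2) uK by (simp add: m_assoc)
    ultimately show "\<gamma> \<in> (\<lambda>y. act (y \<otimes> inv u)) ` ?Y" by blast
  qed
  then show "finite {\<gamma> \<in> \<Gamma>. \<gamma> p \<in> mball p r}"
    using finite_ball[OF uK, of ?n] by (meson finite_imageI finite_subset)
qed

theorem cocompact_discrete_reflection_group_\<Gamma>: "cocompact_discrete_reflection_group \<Gamma>"
proof -
  have sub: "subgroup \<Gamma> (BijGroup X)" unfolding \<Gamma>_def by (rule act.img_is_subgroup)
  have gen: "\<Gamma> = generate (BijGroup X) (act ` S)"
    using act.generate_img[OF gens] generated by (simp add: \<Gamma>_def)
  have "{\<gamma> \<in> \<Gamma>. \<gamma> ` C = C} = {\<one>\<^bsub>BijGroup X\<^esub>}"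
  proof (intro equalityI subsetI)
    fix \<gamma> assume "\<gamma> \<in> {\<gamma> \<in> \<Gamma>. \<gamma> ` C = C}"
    then obtain a where a: "a \<in> carrier K" "\<gamma> = act a" "act a ` C = C" by (auto simp: \<Gamma>_def)
    have "pt \<one> \<one> 0 \<in> C" using base_in_X by (simp add: C_def)
    then have "act a (pt \<one> \<one> 0) \<in> C" using a(3) by blast
    then have "pt a a 0 \<in> C" using act_vertex[OF a(1) one_closed] a(1) by simp
    then have "pt a a 0 \<one> > 1/2" unfolding C_eq by simp
    then have "a = \<one>" by (auto simp: pt_def split: if_splits)
    then show "\<gamma> \<in> {\<one>\<^bsub>BijGroup X\<^esub>}" using a(2) by simp
  next
    fix \<gamma> assume "\<gamma> \<in> {\<one>\<^bsub>BijGroup X\<^esub>}"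
    then have g: "\<gamma> = act \<one>" by simp
    have "act \<one> p = p" if "p \<in> C" for p using that act_one[of p] unfolding C_eq by blast
    then have "act \<one> ` C = C" by (simp del: act.hom_one cong: image_cong_simp)
    then show "\<gamma> \<in> {\<gamma> \<in> \<Gamma>. \<gamma> ` C = C}" unfolding g \<Gamma>_def using one_closed by blast
  qed
  moreover have "\<forall>r\<in>act ` S. reflection r" using reflection_gen by blast
  moreover have "\<Gamma> \<subseteq> isometries" using act_isometry by (auto simp: \<Gamma>_def)
  ultimately show ?thesis
    unfolding cocompact_discrete_reflection_group_def reflection_group_def isometry_group_def
    using sub gen proper_action_\<Gamma> chamber_C compact_closure_C by blast
qed

lemma iso_\<Gamma>: "K \<cong> (BijGroup X)\<lparr>carrier := \<Gamma>\<rparr>"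
proof -
  have "inj_on act (carrier K)"
    unfolding act.inj_on_one_iff
  proof (intro allI impI)
    fix a assume a: "a \<in> carrier K" "act a = \<one>\<^bsub>BijGroup X\<^esub>"
    have "act a (pt \<one> \<one> 0) = pt \<one> \<one> 0" using a(2) base_in_X by (simp add: BijGroup_def)
    then have "pt a a 0 = pt \<one> \<one> 0" using act_vertex[OF a(1) one_closed] a(1) by simp
    then have "supp (pt a a 0) = supp (pt \<one> \<one> 0)" by simp
    then show "a = \<one>" by (simp add: supp_vertex)
  qed
  then have "act \<in> iso K ((BijGroup X)\<lparr>carrier := \<Gamma>\<rparr>)"
    using act_hom by (auto simp: iso_def hom_def bij_betw_def \<Gamma>_def)
  then show ?thesis by (rule is_isoI)
qed

end

section \<open>The equivalence\<close>

lemma coxeter_group_cong: "G \<cong> H \<Longrightarrow> coxeter_group H \<Longrightarrow> coxeter_group G"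
  unfolding coxeter_group_def using iso_trans by blast

lemma coxeter_group_if_iso_to_reflection_group:
  assumes "Metric_space X d" "Metric_space.geodesic_space X d"
    "iso_to_cocompact_discrete_reflection_group G X d"
  shows "coxeter_group G"
proof -
  obtain \<Gamma> where \<Gamma>: "Metric_space.cocompact_discrete_reflection_group X d \<Gamma>"
    "G \<cong> (BijGroup X)\<lparr>carrier := \<Gamma>\<rparr>"
    using assms(3) unfolding iso_to_cocompact_discrete_reflection_group_def by blast
  show ?thesis
    by (rule coxeter_group_cong[OF \<Gamma>(2)
          Metric_space.coxeter_group_if_cocompact_discrete[OF assms(1,2) \<Gamma>(1)]])
qed

text \<open>The witness space consists of functions from the naturals to the reals, which suffices
  because Coxeter groups are countable. Since one formula cannot quantify over types, the second
  conjunct states the forward direction for spaces on an arbitrary type \<open>'x\<close>.\<close>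

theorem theorem3p6:
  fixes G :: "('g, 'c) monoid_scheme"
  assumes "group G"
  shows "((\<exists>(X :: (nat \<Rightarrow> real) set) d.
             Metric_space X d \<and> Metric_space.geodesic_space X d \<and>
             iso_to_cocompact_discrete_reflection_group G X d)
           \<longleftrightarrow> coxeter_group G)
       \<and> ((\<exists>(X :: 'x set) d.
             Metric_space X d \<and> Metric_space.geodesic_space X d \<and>
             iso_to_cocompact_discrete_reflection_group G X d)
           \<longrightarrow> coxeter_group G)"
proof (intro conjI iffI impI)
  assume "coxeter_group G"
  then obtain K :: "nat monoid" and S N where K: "reflection_cocycle K S N" "finite S"
    "generate K S = carrier K" "G \<cong> K"
    by (rule coxeter_group_cocycle[OF assms]) (rule that)
  interpret cayley_graph K S N
    by (intro cayley_graph.intro cayley_graph_axioms.intro K)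
  have "iso_to_cocompact_discrete_reflection_group G X dst"
    unfolding iso_to_cocompact_discrete_reflection_group_def
    using cocompact_discrete_reflection_group_\<Gamma> iso_trans[OF K(4) iso_\<Gamma>] by blast
  then show "\<exists>(X :: (nat \<Rightarrow> real) set) d. Metric_space X d \<and> Metric_space.geodesic_space X d \<and>
      iso_to_cocompact_discrete_reflection_group G X d"
    using Metric_space_axioms geodesic_space by blast
qed (use coxeter_group_if_iso_to_reflection_group in blast)+

end
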